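(* Let $n\ge1$, $\sigma\in J_n^+$, $\Lambda$ a continuous positive function on $[0,\infty)$, $\underline\vartheta,\overline\vartheta>0$, and $V\ge0$ continuous with $V(x,t)\ge\underline\vartheta\Lambda(t)|x|^\sigma$ for $|x|\ge1,t>0$ and $V(x,t)\le\overline\vartheta\Lambda(t)|x|^\sigma$ for $x\in\mathbb{R}^n,t>0$. Let $0<p<\varepsilon_0\underline\vartheta/\overline\vartheta$ ($p<1$), with $\varepsilon_0>0$ any constant such that $\int_{\{|x-y|\ge1\}}B(y)|x-y|^{\sigma+d}dy\ge\varepsilon_0|x|^{\sigma+d}$ for all $x$ and all $d\in[0,\frac{\sigma p}{1-p}]$, and let $a\ge\frac{\sigma}{1-p}$. Assume moreover that there is a continuous function $\alpha>0$ with $\alpha(\tau)\to1$ as $\tau\to0$ and $$V(x,t+\tau)\ge\alpha(\tau)V(x,t)\qquad(x\in\mathbb{R}^n,\ t,\tau>0).$$ For $\kappa\ge0$ let $V^\kappa(x,t)=V(x,t+\kappa)$ and let $u_{*V^\kappa}$ be the maximal s-solution of $\partial_tu-\Delta\partial_tu=\Delta u+V^\kappa u^p$, $u(\cdot,0)=0$. Then $0\le u\in\mathcal{Z}_{\infty,a}$ is a nontrivial (not identically zero) s-solution of $\partial_tu-\Delta\partial_tu=\Delta u+Vu^p$, $u(\cdot,0)=0$, if and only if $u(x,t)=u_{*V^\kappa}(x,[t-\kappa]_+)$ for some $\kappa\ge0$.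
   Context: $J_n^+=\{0\}\cup[1,\infty)$ if $n=1$, $[0,\infty)$ if $n\ge2$; $[s]_+=\max\{s,0\}$. $B=\mathcal{F}^{-1}((1+|\xi|^2)^{-1})$, $\mathcal{B}\varphi=B*\varphi$. $BC_a$: continuous functions with $|\varphi(x)|\le C|x|^a$ for large $|x|$; $\mathcal{Z}_{\infty,a}=C([0,\infty);BC_a)$. For a potential $W$, an s-solution of the zero-data problem is $0\le u$ with $\mu=e^tu\in\mathcal{Z}_{\infty,a}$ and $\mu(t)=\int_0^t\mathcal{B}\mu\,d\tau+\int_0^te^{(1-p)\tau}\mathcal{B}[W\mu^p]\,d\tau$; a maximal s-solution dominates every s-solution pointwise. For $W=V^\kappa$ (which satisfies the same two-sided bounds with $\Lambda(\cdot+\kappa)$) it exists and is unique (a result of the same paper), and it is denoted $u_{*V^\kappa}$. *)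

theory Defs
  imports "HOL-Analysis.Analysis"
begin

text \<open>Real power |r|^e with the convention r^0 = 1 (also for r = 0).\<close>
definition pw :: "real \<Rightarrow> real \<Rightarrow> real" where
  "pw r e = (if e = 0 then 1 else r powr e)"

definition Jplus :: "nat \<Rightarrow> real set" where
  "Jplus n = (if n = 1 then {0} \<union> {1..} else {0..})"

text \<open>Bessel kernel B = F^{-1}((1+|xi|^2)^{-1}): the integrable function whose Fourier
  transform (convention F f(xi) = int f(y) e^{-i xi.y} dy) is (1+|xi|^2)^{-1}.\<close>
definition Bker :: "real^'n \<Rightarrow> real" where
  "Bker = (SOME g. integrable lebesgue g \<and>
     (\<forall>\<xi>::real^'n. integral\<^sup>L lebesgue (\<lambda>y. complex_of_real (g y) * cis (- (\<xi> \<bullet> y)))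
        = complex_of_real (1 / (1 + (norm \<xi>)\<^sup>2))))"

definition Bop :: "(real^'n \<Rightarrow> real) \<Rightarrow> real^'n \<Rightarrow> real" where
  "Bop \<phi> x = (LINT y|lebesgue. Bker (x - y) * \<phi> y)"

definition BC :: "real \<Rightarrow> (real^'n \<Rightarrow> real) set" where
  "BC a = {\<phi>. continuous_on UNIV \<phi> \<and>
      (\<exists>C R. \<forall>x. norm x \<ge> R \<longrightarrow> \<bar>\<phi> x\<bar> \<le> C * pw (norm x) a)}"

definition wnorm :: "real \<Rightarrow> (real^'n \<Rightarrow> real) \<Rightarrow> real" where
  "wnorm a \<phi> = (SUP x. \<bar>\<phi> x\<bar> / (1 + norm x) powr a)"

definition Zinf :: "real \<Rightarrow> (real^'n \<Rightarrow> real \<Rightarrow> real) \<Rightarrow> bool" where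
  "Zinf a \<mu> \<longleftrightarrow> (\<forall>t\<ge>0. (\<lambda>x. \<mu> x t) \<in> BC a) \<and>
     (\<forall>t0\<ge>0. ((\<lambda>t. wnorm a (\<lambda>x. \<mu> x t - \<mu> x t0)) \<longlongrightarrow> 0) (at t0 within {0..}))"

definition s_solution :: "(real^'n \<Rightarrow> real \<Rightarrow> real) \<Rightarrow> real \<Rightarrow> real
     \<Rightarrow> (real^'n \<Rightarrow> real \<Rightarrow> real) \<Rightarrow> bool" where
  "s_solution W p a u \<longleftrightarrow>
     (\<forall>x t. t \<ge> 0 \<longrightarrow> 0 \<le> u x t) \<and>
     (let \<mu> = (\<lambda>x t. exp t * u x t) in
        Zinf a \<mu> \<and>
        (\<forall>x t. t \<ge> 0 \<longrightarrow>
           \<mu> x t = (LINT \<tau>:{0..t}|lborel. Bop (\<lambda>y. \<mu> y \<tau>) x)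
                  + (LINT \<tau>:{0..t}|lborel. exp ((1 - p) * \<tau>) *
                        Bop (\<lambda>y. W y \<tau> * (\<mu> y \<tau>) powr p) x)))"

definition max_s_solution :: "(real^'n \<Rightarrow> real \<Rightarrow> real) \<Rightarrow> real \<Rightarrow> real
     \<Rightarrow> (real^'n \<Rightarrow> real \<Rightarrow> real) \<Rightarrow> bool" where
  "max_s_solution W p a u \<longleftrightarrow> s_solution W p a u \<and>
     (\<forall>v. s_solution W p a v \<longrightarrow> (\<forall>x t. t \<ge> 0 \<longrightarrow> v x t \<le> u x t))"

end

theory Submission
  imports Defs "HOL-Probability.Probability"
begin

text \<open>
  With \<open>\<mu> = e^t u\<close> the s-solutions are the fixed points of a monotone integral operator \<open>\<Phi>\<close>.
  A fixed point that is positive at arbitrarily small times dominates the explicit barrier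
  \<open>\<phi>(x,t) = ((1-p) \<epsilon> \<theta>lo L(t) |x|^\<sigma>)^(1/(1-p))\<close>, where \<open>L(t)\<close> is the integral of
  \<open>e^((1-p)\<tau>) \<Lambda>(\<tau>)\<close> over \<open>[0,t]\<close>: positivity of the Bessel kernel gives a bound
  \<open>c e^(-b|x|)\<close>, and inserting a lower bound into the sublinear equation repeatedly
  replaces the rate \<open>b\<close> by \<open>p b\<close>, and afterwards a power \<open>|x|^e\<close> by \<open>|x|^(\<sigma> + p e)\<close>.
  Above \<open>\<phi>\<close> the map \<open>\<Phi>\<close> is a contraction for the weight \<open>L^(1/(1-p)) e^(t/\<rho>) e^(e|x|)\<close>
  with small \<open>e\<close>, because the hypothesis on \<open>p\<close> says \<open>\<rho> = p \<theta>up / (\<epsilon> \<theta>lo) < 1\<close>; every fixed point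
  is bounded by a multiple of that weight. Hence an immediately positive s-solution dominates every
  s-solution, and iterating \<open>\<Phi>\<close> from \<open>\<phi>\<close> produces one. A general nontrivial s-solution vanishes
  up to a time \<open>\<kappa>\<close> and is immediately positive after it.
\<close>

section \<open>Weights and admissible functions\<close>

text \<open>The obstacle is that \<open>r powr p\<close> is not Lipschitz at 0: zero data admit the
  zero solution and others, so no contraction can hold without a lower barrier. By concavity the
  reaction linearised at \<open>\<phi>\<close> has coefficient at most
  \<open>\<rho> * q * lam / L\<close>, because the growth |x|^\<sigma> of the potential cancels
  against that of the barrier. This coefficient blows up at t = 0, but
  \<open>q * lam * L powr (q - 1)\<close> is the derivative of \<open>L powr q\<close>, so against
  this time weight it integrates exactly and leaves just the factor \<open>\<rho>\<close>. The
  factor e^(t/\<rho>) absorbs the linear term in the same integration. In space an exponential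
  weight is chosen because its convolution constant tends to 1 with e tending to 0, whereas that of
  (1+|x|)^a is a fixed number. The constant in \<open>\<phi>\<close> is the attracting fixed point
  of an iteration D := \<kappa> D^p, whose limit forgets its start; this makes the lower bound
  independent of the solution. \<open>Bker\<close> is given by a choice operator, so its positivity
  and decay come from identifying it almost everywhere with a superposition of heat kernels.\<close>

lemma powr_le_exp:
  fixes a e :: real
  assumes "e > 0" "a \<ge> 0"
  obtains C where "C > 0" "\<And>r. r \<ge> 0 \<Longrightarrow> (1 + r) powr a \<le> C * exp (e * r)"
proof
  let ?C = "((a + 1) / e) powr a * exp e"
  show "?C > 0" using assms by simp
  fix r :: real assume r: "r \<ge> 0"
  \<comment> \<open>Dividing by \<open>a + 1\<close> instead of \<open>a\<close> keeps the case
    \<open>a = 0\<close>.\<close>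
  let ?z = "e * (1 + r) / (a + 1)"
  have "1 + r = (a + 1) / e * ?z" using assms by simp
  also have "\<dots> \<le> (a + 1) / e * exp ?z"
    using assms by (intro mult_left_mono order_trans[OF _ exp_ge_add_one_self]) auto
  finally have "(1 + r) powr a \<le> ((a + 1) / e * exp ?z) powr a"
    using r assms by (intro powr_mono2) auto
  also have "\<dots> = ((a + 1) / e) powr a * exp (?z * a)"
    using assms by (subst powr_mult) (auto simp: exp_powr_real)
  also have "?z * a \<le> e * (1 + r)"
  proof -
    have "?z * a = e * (1 + r) * (a / (a + 1))" by simp
    also have "\<dots> \<le> e * (1 + r) * 1" using assms r by (intro mult_left_mono) auto
    finally show ?thesis by simp
  qed
  then have "((a + 1) / e) powr a * exp (?z * a) \<le> ((a + 1) / e) powr a * exp (e * (1 + r))"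
    by (intro mult_left_mono) auto
  also have "\<dots> = ?C * exp (e * r)" by (simp add: algebra_simps exp_add)
  finally show "(1 + r) powr a \<le> ?C * exp (e * r)" .
qed

lemma one_plus_norm_powr_submult:
  assumes "a \<ge> 0"
  shows "(1 + norm (x - y)) powr a \<le> (1 + norm x) powr a * (1 + norm y) powr a"
proof -
  have "1 + norm (x - y) \<le> 1 + norm x + norm y" using norm_triangle_ineq4[of x y] by simp
  also have "\<dots> \<le> (1 + norm x) * (1 + norm y)" by (simp add: algebra_simps)
  finally have "(1 + norm (x - y)) powr a \<le> ((1 + norm x) * (1 + norm y)) powr a"
    using assms by (intro powr_mono2) auto
  then show ?thesis by (simp add: powr_mult)
qed

lemma exp_norm_submult:
  assumes "e \<ge> 0"
  shows "exp (e * norm (x - y)) \<le> exp (e * norm x) * exp (e * norm y)"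
  using assms norm_triangle_ineq4[of x y] by (simp flip: exp_add distrib_left add: mult_left_mono)

text \<open>Concavity. The slope is taken at the smaller point \<open>v\<close>, since that is the
  function which the barrier bounds away from 0.\<close>

lemma powr_diff_le_tangent:
  fixes u v p :: real
  assumes "0 < v" "v \<le> u" "0 < p" "p < 1"
  shows "u powr p - v powr p \<le> p * v powr (p - 1) * (u - v)"
proof (cases "u = v")
  case False
  then have "v < u" using assms by simp
  then obtain z where z: "v < z" "z < u" "u powr p - v powr p = (u - v) * (p * z powr (p - 1))"
    using MVT2[of v u "\<lambda>x. x powr p" "\<lambda>x. p * x powr (p - 1)"] has_real_derivative_powr assms(1)
    by (metis less_le_trans)
  have "z powr (p - 1) \<le> v powr (p - 1)" using z assms by (intro powr_mono2') auto
  then have "(u - v) * (p * z powr (p - 1)) \<le> (u - v) * (p * v powr (p - 1))"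
    using assms by (intro mult_left_mono) auto
  then show ?thesis using z by (simp add: mult_ac)
qed simp

section \<open>Real powers with the convention that exponent 0 gives 1\<close>

lemma pw_nonneg: "r \<ge> 0 \<Longrightarrow> pw r e \<ge> 0"
  by (simp add: pw_def)

lemma pw_le_powr: "r \<ge> 0 \<Longrightarrow> e \<ge> 0 \<Longrightarrow> pw r e \<le> (1 + r) powr e"
  by (auto simp: pw_def intro!: powr_mono2 ge_one_powr_ge_zero)

lemma pw_ge_one: "r \<ge> 1 \<Longrightarrow> e \<ge> 0 \<Longrightarrow> pw r e \<ge> 1"
  by (auto simp: pw_def ge_one_powr_ge_zero)

lemma pw_add: "s \<ge> 0 \<Longrightarrow> e \<ge> 0 \<Longrightarrow> pw r s * pw r e = pw r (s + e)"
  by (auto simp: pw_def powr_add)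

text \<open>For \<open>d = 0\<close> this fails at a zero base, since \<open>0 powr 0 = 0\<close>
  while \<open>pw r 0 = 1\<close>.\<close>

lemma pw_powr: "d \<noteq> 0 \<Longrightarrow> (pw r e) powr d = pw r (e * d)"
  by (auto simp: pw_def powr_powr)

lemma continuous_on_pw_norm:
  assumes "e \<ge> 0" "continuous_on S f"
  shows "continuous_on S (\<lambda>x. pw (norm (f x)) e)"
  using assms by (cases "e = 0") (auto simp: pw_def intro!: continuous_on_powr' continuous_on_norm continuous_on_const)

text \<open>The solution class: nonnegative elements of \<open>Z\<^sub>\<infinity>\<^sub>,\<^sub>a\<close>, with continuity into \<open>BC\<^sub>a\<close> relaxed to joint
  continuity with bounds uniform on compact time intervals. For solutions of the integral equation the two
  notions agree.\<close>

definition adm :: "real \<Rightarrow> ('a::euclidean_space \<Rightarrow> real \<Rightarrow> real) \<Rightarrow> bool" where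
  "adm a f \<longleftrightarrow> continuous_on (UNIV \<times> {0..}) (\<lambda>(x, t). f x t) \<and> (\<forall>x t. t \<ge> 0 \<longrightarrow> 0 \<le> f x t) \<and>
     (\<forall>T. \<exists>C. \<forall>x. \<forall>t\<in>{0..T}. f x t \<le> C * (1 + norm x) powr a)"

lemma adm_nonneg: "adm a f \<Longrightarrow> t \<ge> 0 \<Longrightarrow> 0 \<le> f x t"
  by (simp add: adm_def)

lemma adm_continuous: "adm a f \<Longrightarrow> continuous_on (UNIV \<times> {0..}) (\<lambda>(x, t). f x t)"
  by (simp add: adm_def)

lemma adm_bound:
  fixes f :: "'a::euclidean_space \<Rightarrow> real \<Rightarrow> real"
  assumes "adm a f"
  obtains C where "C \<ge> 0" "\<And>x t. t \<in> {0..T} \<Longrightarrow> f x t \<le> C * (1 + norm x) powr a"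
proof -
  obtain C where C: "\<And>x t. t \<in> {0..T} \<Longrightarrow> f x t \<le> C * (1 + norm x) powr a"
    using assms unfolding adm_def by blast
  show ?thesis
  proof (rule that[of "max C 0"])
    fix x :: 'a and t assume "t \<in> {0..T}"
    then have "f x t \<le> C * (1 + norm x) powr a" by (rule C)
    also have "\<dots> \<le> max C 0 * (1 + norm x) powr a" by (intro mult_right_mono) auto
    finally show "f x t \<le> max C 0 * (1 + norm x) powr a" .
  qed simp
qed

lemma adm_continuous_space:
  assumes "adm a f" "t \<ge> 0"
  shows "continuous_on UNIV (\<lambda>x. f x t)"
proof -
  have "continuous_on UNIV ((\<lambda>(x, t). f x t) \<circ> (\<lambda>x. (x, t)))"
    using assms by (intro continuous_on_compose continuous_intros continuous_on_subset[OF adm_continuous[OF assms(1)]]) auto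
  then show ?thesis by (simp add: o_def)
qed

lemma adm_measurable: "adm a f \<Longrightarrow> t \<ge> 0 \<Longrightarrow> (\<lambda>x. f x t) \<in> borel_measurable borel"
  by (intro borel_measurable_continuous_onI adm_continuous_space)

lemma adm_continuous_time:
  assumes "adm a f"
  shows "continuous_on {0..} (f x)"
proof -
  have "continuous_on {0..} ((\<lambda>(x, t). f x t) \<circ> (\<lambda>t. (x, t)))"
    by (intro continuous_on_compose continuous_intros continuous_on_subset[OF adm_continuous[OF assms(1)]]) auto
  then show ?thesis by (simp add: o_def)
qed

lemma adm_integrable_time:
  assumes "adm a f" "s \<ge> 0"
  shows "f x integrable_on {s..t}"
  by (rule integrable_continuous_interval) (use assms in \<open>auto intro: continuous_on_subset[OF adm_continuous_time]\<close>)

lemma adm_max: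
  fixes f g :: "'a::euclidean_space \<Rightarrow> real \<Rightarrow> real"
  assumes "adm a f" "adm a g"
  shows "adm a (\<lambda>x t. max (f x t) (g x t))"
  unfolding adm_def
proof (intro conjI allI impI)
  have "continuous_on (UNIV \<times> {0..}) (\<lambda>z. max ((\<lambda>(x, t). f x t) z) ((\<lambda>(x, t). g x t) z))"
    by (intro continuous_intros adm_continuous[OF assms(1)] adm_continuous[OF assms(2)])
  then show "continuous_on (UNIV \<times> {0..}) (\<lambda>(x, t). max (f x t) (g x t))" by (simp add: case_prod_beta')
  show "0 \<le> max (f x t) (g x t)" if "t \<ge> 0" for x t
    using adm_nonneg[OF assms(1) that, of x] by simp
  fix T
  obtain C where C: "C \<ge> 0" "\<And>x t. t \<in> {0..T} \<Longrightarrow> f x t \<le> C * (1 + norm x) powr a"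
    using adm_bound[OF assms(1)] by blast
  obtain D where D: "D \<ge> 0" "\<And>x t. t \<in> {0..T} \<Longrightarrow> g x t \<le> D * (1 + norm x) powr a"
    using adm_bound[OF assms(2)] by blast
  show "\<exists>C. \<forall>x. \<forall>t\<in>{0..T}. max (f x t) (g x t) \<le> C * (1 + norm x) powr a"
  proof (intro exI[of _ "C + D"] allI ballI)
    fix x :: 'a and t assume t: "t \<in> {0..T}"
    have "0 \<le> C * (1 + norm x) powr a" "0 \<le> D * (1 + norm x) powr a" using C D by auto
    then show "max (f x t) (g x t) \<le> (C + D) * (1 + norm x) powr a"
      unfolding distrib_right using C(2)[OF t, of x] D(2)[OF t, of x] by linarith
  qed
qed

lemma time_integral_Lipschitz:
  fixes f :: "real \<Rightarrow> real"
  assumes f: "continuous_on {0..} f" and b: "\<And>\<tau>. \<tau> \<in> {0..T} \<Longrightarrow> \<bar>f \<tau>\<bar> \<le> M"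
    and s: "s \<in> {0..T}" and t: "t \<in> {0..T}"
  shows "\<bar>integral {0..t} f - integral {0..s} f\<bar> \<le> M * \<bar>t - s\<bar>"
proof -
  have *: "\<bar>integral {0..t} f - integral {0..s} f\<bar> \<le> M * \<bar>t - s\<bar>" if "0 \<le> s" "s \<le> t" "t \<le> T" for s t
  proof -
    have i: "f integrable_on {u..v}" if "0 \<le> u" for u v
      by (rule integrable_continuous_interval) (use that in \<open>auto intro: continuous_on_subset[OF f]\<close>)
    have "integral {0..t} f = integral {0..s} f + integral {s..t} f"
      using that i by (intro Henstock_Kurzweil_Integration.integral_combine[symmetric]) auto
    moreover have "norm (integral {s..t} f) \<le> M * (t - s)"
      using that b by (intro integral_bound continuous_on_subset[OF f]) auto
    ultimately show ?thesis using that by simp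
  qed
  show ?thesis
    using *[of s t] *[of t s] s t by (cases "s \<le> t") (auto simp: abs_minus_commute)
qed

text \<open>The sequential form suits dominated convergence and estimates along a convergent, hence
  bounded, sequence of points.\<close>

lemma continuous_on_half_spaceI:
  fixes f :: "'a::euclidean_space \<Rightarrow> real \<Rightarrow> real"
  assumes "\<And>X S x t. X \<longlonglongrightarrow> x \<Longrightarrow> S \<longlonglongrightarrow> t \<Longrightarrow> (\<And>n. S n \<ge> 0) \<Longrightarrow> t \<ge> 0 \<Longrightarrow> (\<lambda>n. f (X n) (S n)) \<longlonglongrightarrow> f x t"
  shows "continuous_on (UNIV \<times> {0..}) (\<lambda>(x, t). f x t)"
  unfolding continuous_on_sequentially
proof (intro ballI allI impI, elim conjE)
  fix z :: "'a \<times> real" and u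
  assume z: "z \<in> UNIV \<times> {0..}" and u: "\<forall>n. u n \<in> UNIV \<times> {0..}" and lim: "u \<longlonglongrightarrow> z"
  have "(\<lambda>n. f (fst (u n)) (snd (u n))) \<longlonglongrightarrow> f (fst z) (snd z)"
    by (rule assms[OF tendsto_fst[OF lim] tendsto_snd[OF lim]]) (use z u in \<open>auto simp: mem_Times_iff\<close>)
  then show "((\<lambda>(x, t). f x t) \<circ> u) \<longlonglongrightarrow> (case z of (x, t) \<Rightarrow> f x t)"
    by (simp add: o_def case_prod_beta')
qed

text \<open>Joint continuity separates the variables: with the upper limit frozen the integral is
  continuous in x, and moving the upper limit costs a Lipschitz error that is uniform along a
  bounded sequence of points.\<close>

lemma adm_time_integral:
  fixes f :: "'a::euclidean_space \<Rightarrow> real \<Rightarrow> real"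
  assumes f: "adm a f"
  shows "adm a (\<lambda>x t. integral {0..t} (f x))"
  unfolding adm_def
proof (intro conjI allI impI)
  show "0 \<le> integral {0..t} (f x)" if "t \<ge> 0" for x t
    by (intro Henstock_Kurzweil_Integration.integral_nonneg adm_integrable_time[OF f]) (auto intro: adm_nonneg[OF f])
  show "\<exists>C. \<forall>x. \<forall>t\<in>{0..T}. integral {0..t} (f x) \<le> C * (1 + norm x) powr a" for T
  proof -
    obtain C where C: "C \<ge> 0" "\<And>x t. t \<in> {0..T} \<Longrightarrow> f x t \<le> C * (1 + norm x) powr a"
      using adm_bound[OF f] by blast
    show ?thesis
    proof (intro exI[of _ "C * T"] allI ballI)
      fix x :: 'a and t assume t: "t \<in> {0..T}"
      have "\<bar>integral {0..t} (f x) - integral {0..0} (f x)\<bar> \<le> (C * (1 + norm x) powr a) * \<bar>t - 0\<bar>"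
        using t C adm_nonneg[OF f] by (intro time_integral_Lipschitz[of _ T] adm_continuous_time[OF f]) auto
      then have "integral {0..t} (f x) \<le> (C * (1 + norm x) powr a) * t" using t by simp
      also have "\<dots> \<le> (C * (1 + norm x) powr a) * T" using t C by (intro mult_left_mono) auto
      finally show "integral {0..t} (f x) \<le> C * T * (1 + norm x) powr a" by (simp add: mult_ac)
    qed
  qed
  show "continuous_on (UNIV \<times> {0..}) (\<lambda>(x, t). integral {0..t} (f x))"
  proof (rule continuous_on_half_spaceI)
    fix X :: "nat \<Rightarrow> 'a" and S x t
    assume X: "X \<longlonglongrightarrow> x" and S: "S \<longlonglongrightarrow> t" and S0: "\<And>n. S n \<ge> 0" and t0: "t \<ge> (0::real)"
    obtain R where R: "\<And>n. norm (X n) \<le> R" using convergent_imp_Bseq[OF convergentI[OF X]] by (auto simp: Bseq_def)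
    obtain T where T: "T > 0" "\<And>n. \<bar>S n\<bar> \<le> T" using convergent_imp_Bseq[OF convergentI[OF S]] by (auto simp: Bseq_def)
    have tT: "t \<le> T" using S T(2) by (intro LIMSEQ_le_const2[OF S]) (auto simp: abs_le_iff)
    obtain C where C: "C \<ge> 0" "\<And>x t. t \<in> {0..T} \<Longrightarrow> f x t \<le> C * (1 + norm x) powr a"
      using adm_bound[OF f] by blast
    have "continuous_on UNIV (\<lambda>x. integral (cbox 0 t) (f x))"
      by (intro integral_continuous_on_param continuous_on_subset[OF adm_continuous[OF f]]) auto
    then have "(\<lambda>n. integral {0..t} (f (X n))) \<longlonglongrightarrow> integral {0..t} (f x)"
      using X by (auto simp: continuous_on_eq_continuous_at intro: isCont_tendsto_compose)
    moreover have "(\<lambda>n. integral {0..S n} (f (X n)) - integral {0..t} (f (X n))) \<longlonglongrightarrow> 0"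
    proof -
      define M where "M = C * max ((1 + R) powr a) 1"
      \<comment> \<open>\<open>adm\<close> puts no sign on \<open>a\<close>. For negative
        \<open>a\<close> the weight is at most 1, hence the maximum.\<close>
      have le: "(1 + norm (X n)) powr a \<le> max ((1 + R) powr a) 1" for n
      proof (cases "a \<ge> 0")
        case True
        then have "(1 + norm (X n)) powr a \<le> (1 + R) powr a" using R[of n] by (intro powr_mono2) auto
        then show ?thesis by simp
      next
        case False
        then have "(1 + norm (X n)) powr a \<le> 1" using powr_mono[of a 0 "1 + norm (X n)"] by (auto split: if_splits)
        then show ?thesis by simp
      qed
      have "\<bar>integral {0..S n} (f (X n)) - integral {0..t} (f (X n))\<bar> \<le> M * \<bar>S n - t\<bar>" for n
      proof (rule time_integral_Lipschitz[of _ T])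
        fix \<tau> assume \<tau>: "\<tau> \<in> {0..T}"
        have "f (X n) \<tau> \<le> C * (1 + norm (X n)) powr a" by (rule C(2)[OF \<tau>])
        also have "\<dots> \<le> M" unfolding M_def using C le by (intro mult_left_mono) auto
        finally show "\<bar>f (X n) \<tau>\<bar> \<le> M" using adm_nonneg[OF f, of \<tau> "X n"] \<tau> by simp
      qed (use S0[of n] T(2)[of n] t0 tT in \<open>auto intro: adm_continuous_time[OF f] simp: abs_le_iff\<close>)
      then have "eventually (\<lambda>n. norm (integral {0..S n} (f (X n)) - integral {0..t} (f (X n))) \<le> M * \<bar>S n - t\<bar>) sequentially"
        by simp
      moreover have "(\<lambda>n. M * \<bar>S n - t\<bar>) \<longlonglongrightarrow> 0"
        using tendsto_mult[OF tendsto_const[of M] tendsto_rabs[OF tendsto_diff[OF S tendsto_const[of t]]]] by simp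
      ultimately show ?thesis by (rule Lim_null_comparison)
    qed
    ultimately have "(\<lambda>n. integral {0..t} (f (X n)) + (integral {0..S n} (f (X n)) - integral {0..t} (f (X n)))) \<longlonglongrightarrow> integral {0..t} (f x) + 0"
      by (rule tendsto_add)
    then show "(\<lambda>n. integral {0..S n} (f (X n))) \<longlonglongrightarrow> integral {0..t} (f x)" by simp
  qed
qed

text \<open>A convergent sequence and its limit lie in one compact set. This serves limits that are
  uniform on compact sets only.\<close>

lemma continuous_on_half_space_compact_exhaustion:
  fixes F :: "'a::euclidean_space \<times> real \<Rightarrow> real"
  assumes "\<And>R T. continuous_on (cball 0 R \<times> {0..T}) F"
  shows "continuous_on (UNIV \<times> {0..}) F"
  unfolding continuous_on_sequentially
proof (intro ballI allI impI, elim conjE)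
  fix z :: "'a \<times> real" and u assume z: "z \<in> UNIV \<times> {0..}" and u: "\<forall>n. u n \<in> UNIV \<times> {0::real..}" and lim: "u \<longlonglongrightarrow> z"
  obtain R where R: "\<And>n. norm (u n) \<le> R" using convergent_imp_Bseq[OF convergentI[OF lim]] by (auto simp: Bseq_def)
  have zR: "norm z \<le> R" using tendsto_norm[OF lim] R by (intro LIMSEQ_le_const2) auto
  have "norm (fst w) \<le> R \<and> \<bar>snd w\<bar> \<le> R" if "norm w \<le> R" for w :: "'a \<times> real"
    using that norm_fst_le[of "fst w" "snd w"] norm_snd_le[of "snd w" "fst w"] by auto
  then have "u n \<in> cball 0 R \<times> {0..R}" "z \<in> cball 0 R \<times> {0..R}" for n
    using u z R[of n] zR by (auto simp: mem_Times_iff abs_le_iff)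
  then show "(F \<circ> u) \<longlonglongrightarrow> F z" using assms[of R R] lim unfolding continuous_on_sequentially by blast
qed

section \<open>Convolution with a probability density\<close>

text \<open>These are the properties of the Bessel kernel on which the analysis rests. The lower
  bound is only almost everywhere because the kernel will be a Bochner integral, which has the
  default value 0 where it diverges, as at the origin in dimension at least 2.\<close>

locale conv_kernel =
  fixes k :: "'a::euclidean_space \<Rightarrow> real" and e0 b0 c0 :: real
  assumes k_measurable [measurable]: "k \<in> borel_measurable borel"
    and k_nonneg: "k y \<ge> 0"
    and k_integral: "integral\<^sup>L lborel k = 1"
    and e0: "e0 > 0" and k_exp: "integrable lborel (\<lambda>y. k y * exp (e0 * norm y))"
    and b0: "b0 \<ge> 0" and c0: "c0 > 0" and k_lower: "AE y in lborel. k y \<ge> c0 * exp (- (b0 * norm y))"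
begin

definition K :: "('a \<Rightarrow> real) \<Rightarrow> 'a \<Rightarrow> real" where
  "K f x = (\<integral>y. k y * f (x - y) \<partial>lborel)"

abbreviation expmom :: "real \<Rightarrow> real" where
  "expmom e \<equiv> (\<integral>y. k y * exp (e * norm y) \<partial>lborel)"

lemma k_exp_moment: "e \<le> e0 \<Longrightarrow> integrable lborel (\<lambda>y. k y * exp (e * norm y))"
  by (rule Bochner_Integration.integrable_bound[OF k_exp])
    (auto simp: k_nonneg abs_mult intro!: mult_left_mono mult_right_mono)

lemma k_integrable: "integrable lborel k"
  using k_exp_moment[of 0] e0 by simp

text \<open>Dominated convergence: the moment tends to the total mass 1 as the rate tends to 0. The
  slack between \<open>\<rho>\<close> and 1 is later spent here.\<close>

lemma k_exp_moment_near_one: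
  assumes "\<rho> > 1"
  obtains e where "0 < e" "e \<le> e0" "expmom e < \<rho>"
proof -
  let ?e = "\<lambda>n. e0 / real (Suc n)"
  have e: "0 < ?e n" "?e n \<le> e0" for n using e0 by (auto simp: field_simps)
  have "(\<lambda>n. expmom (?e n)) \<longlonglongrightarrow> (\<integral>y. k y * exp (0 * norm y) \<partial>lborel)"
  proof (rule integral_dominated_convergence[where w = "\<lambda>y. k y * exp (e0 * norm y)"])
    have "?e \<longlonglongrightarrow> 0" using tendsto_mult[OF tendsto_const[of e0] LIMSEQ_inverse_real_of_nat] by (simp add: divide_inverse)
    then show "AE y in lborel. (\<lambda>n. k y * exp (?e n * norm y)) \<longlonglongrightarrow> k y * exp (0 * norm y)"
      by (intro AE_I2 tendsto_intros)
    show "AE y in lborel. norm (k y * exp (?e n * norm y)) \<le> k y * exp (e0 * norm y)" for n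
    proof (intro AE_I2)
      fix y :: 'a
      have "?e n * norm y \<le> e0 * norm y" using e(2)[of n] by (rule mult_right_mono) simp
      then have "k y * exp (?e n * norm y) \<le> k y * exp (e0 * norm y)" by (intro mult_left_mono k_nonneg) simp
      then show "norm (k y * exp (?e n * norm y)) \<le> k y * exp (e0 * norm y)" by (simp add: k_nonneg abs_mult)
    qed
  qed (use k_exp in auto)
  then have "(\<lambda>n. expmom (?e n)) \<longlonglongrightarrow> 1" by (simp add: k_integral)
  then have "eventually (\<lambda>n. expmom (?e n) < \<rho>) sequentially"
    using assms by (rule order_tendstoD)
  then obtain n where "expmom (?e n) < \<rho>" by (auto simp: eventually_sequentially)
  with e[of n] show ?thesis by (rule that)
qed

lemma k_powr_moment:
  assumes "a \<ge> 0"
  shows "integrable lborel (\<lambda>y. k y * (1 + norm y) powr a)"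
proof -
  obtain C where C: "C > 0" "\<And>r. r \<ge> 0 \<Longrightarrow> (1 + r) powr a \<le> C * exp (e0 * r)"
    using powr_le_exp[OF e0 assms] by blast
  show ?thesis
  proof (rule Bochner_Integration.integrable_bound[OF integrable_mult_right[OF k_exp, of C]])
    have "k y * (1 + norm y) powr a \<le> k y * (C * exp (e0 * norm y))" for y
      by (intro mult_left_mono C k_nonneg) auto
    then show "AE y in lborel. norm (k y * (1 + norm y) powr a) \<le> norm (C * (k y * exp (e0 * norm y)))"
      using C(1) by (auto simp: abs_mult k_nonneg mult_ac)
  qed measurable
qed

text \<open>A submultiplicative weight factors out of the convolution: |f(x - y)| \<le> M
  \<omega>(x) \<omega>(y), and the y-part is integrated against the kernel.\<close>

lemma
  assumes f: "f \<in> borel_measurable borel" and le: "\<And>z. \<bar>f z\<bar> \<le> M * \<omega> z" and M: "M \<ge> 0"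
    and \<omega>: "\<And>y. \<omega> (x - y) \<le> \<omega> x * \<omega> y" and int: "integrable lborel (\<lambda>y. k y * \<omega> y)"
  shows K_integrable_weight: "integrable lborel (\<lambda>y. k y * f (x - y))"
    and K_bound_weight: "\<bar>K f x\<bar> \<le> M * \<omega> x * (\<integral>y. k y * \<omega> y \<partial>lborel)"
proof -
  have b: "\<bar>k y * f (x - y)\<bar> \<le> M * \<omega> x * (k y * \<omega> y)" for y
  proof -
    have "\<bar>f (x - y)\<bar> \<le> M * (\<omega> x * \<omega> y)" using le \<omega> M by (meson mult_left_mono order_trans)
    then have "k y * \<bar>f (x - y)\<bar> \<le> k y * (M * (\<omega> x * \<omega> y))" by (intro mult_left_mono k_nonneg)
    then show ?thesis by (simp add: abs_mult k_nonneg mult_ac)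
  qed
  have i: "integrable lborel (\<lambda>y. M * \<omega> x * (k y * \<omega> y))" using int by simp
  show "integrable lborel (\<lambda>y. k y * f (x - y))"
  proof (rule Bochner_Integration.integrable_bound[OF i])
    show "(\<lambda>y. k y * f (x - y)) \<in> borel_measurable lborel" using f by measurable
    show "AE y in lborel. norm (k y * f (x - y)) \<le> norm (M * \<omega> x * (k y * \<omega> y))"
      using b by (auto intro!: AE_I2 order_trans[OF b])
  qed
  have "\<bar>K f x\<bar> \<le> (\<integral>y. \<bar>k y * f (x - y)\<bar> \<partial>lborel)" unfolding K_def by (rule integral_abs_bound)
  also have "\<dots> \<le> (\<integral>y. M * \<omega> x * (k y * \<omega> y) \<partial>lborel)"
    by (rule integral_mono'[OF i]) (use b in \<open>auto intro: order_trans[OF abs_ge_zero]\<close>)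
  finally show "\<bar>K f x\<bar> \<le> M * \<omega> x * (\<integral>y. k y * \<omega> y \<partial>lborel)" by simp
qed

text \<open>The convolution constant of the polynomial weight. It may be well above 1, so it serves
  a priori bounds and the majorant, not the contraction.\<close>

definition A :: "real \<Rightarrow> real" where "A a = (\<integral>y. k y * (1 + norm y) powr a \<partial>lborel)"

lemma A_ge_one:
  assumes "a \<ge> 0"
  shows "A a \<ge> 1"
proof -
  have "k y * 1 \<le> k y * (1 + norm y) powr a" for y
    using assms by (intro mult_left_mono k_nonneg ge_one_powr_ge_zero) auto
  then have "integral\<^sup>L lborel k \<le> A a"
    unfolding A_def by (intro integral_mono k_integrable k_powr_moment assms) auto
  then show ?thesis by (simp add: k_integral)
qed

lemma
  assumes "f \<in> borel_measurable borel" "\<And>z. \<bar>f z\<bar> \<le> M * (1 + norm z) powr a" "M \<ge> 0" "a \<ge> 0"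
  shows K_integrable_powr: "integrable lborel (\<lambda>y. k y * f (x - y))"
    and K_bound_powr: "\<bar>K f x\<bar> \<le> M * (1 + norm x) powr a * A a"
proof -
  show "integrable lborel (\<lambda>y. k y * f (x - y))"
    by (rule K_integrable_weight) (use assms k_powr_moment one_plus_norm_powr_submult in blast)+
  show "\<bar>K f x\<bar> \<le> M * (1 + norm x) powr a * A a"
    unfolding A_def by (rule K_bound_weight) (use assms k_powr_moment one_plus_norm_powr_submult in blast)+
qed

lemma K_bound_exp:
  assumes "f \<in> borel_measurable borel" "\<And>z. \<bar>f z\<bar> \<le> M * exp (e * norm z)" "M \<ge> 0" "0 \<le> e" "e \<le> e0"
  shows "\<bar>K f x\<bar> \<le> M * exp (e * norm x) * expmom e"
  by (rule K_bound_weight) (use assms k_exp_moment exp_norm_submult in blast)+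

lemma K_integrable:
  assumes "adm a f" "a \<ge> 0" "t \<ge> 0"
  shows "integrable lborel (\<lambda>y. k y * f (x - y) t)"
proof -
  obtain C where "C \<ge> 0" "\<And>x t'. t' \<in> {0..t} \<Longrightarrow> f x t' \<le> C * (1 + norm x) powr a"
    using adm_bound[OF assms(1)] by blast
  then show ?thesis using assms adm_nonneg[OF assms(1)]
    by (intro K_integrable_powr[where f = "\<lambda>x. f x t" and M = C and a = a] adm_measurable[OF assms(1)]) auto
qed

lemma adm_K:
  assumes f: "adm a f" and a: "a \<ge> 0"
  shows "adm a (\<lambda>x t. K (\<lambda>y. f y t) x)"
  unfolding adm_def
proof (intro conjI allI impI)
  show "0 \<le> K (\<lambda>y. f y t) x" if "t \<ge> 0" for x t
    unfolding K_def using adm_nonneg[OF f that] by (intro Bochner_Integration.integral_nonneg) (auto simp: k_nonneg)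
  show "\<exists>C. \<forall>x. \<forall>t\<in>{0..T}. K (\<lambda>y. f y t) x \<le> C * (1 + norm x) powr a" for T
  proof -
    obtain C where C: "C \<ge> 0" "\<And>x t. t \<in> {0..T} \<Longrightarrow> f x t \<le> C * (1 + norm x) powr a"
      using adm_bound[OF f] by blast
    show ?thesis
    proof (intro exI[of _ "C * A a"] allI ballI)
      fix x t assume t: "t \<in> {0..T}"
      have "\<bar>K (\<lambda>y. f y t) x\<bar> \<le> C * (1 + norm x) powr a * A a"
        using t C a adm_nonneg[OF f] by (intro K_bound_powr adm_measurable[OF f]) auto
      then show "K (\<lambda>y. f y t) x \<le> C * A a * (1 + norm x) powr a" by (simp add: mult_ac)
    qed
  qed
  show "continuous_on (UNIV \<times> {0..}) (\<lambda>(x, t). K (\<lambda>y. f y t) x)"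
  proof (rule continuous_on_half_spaceI)
    fix X :: "nat \<Rightarrow> 'a" and S x t
    assume X: "X \<longlonglongrightarrow> x" and S: "S \<longlonglongrightarrow> t" and S0: "\<And>n. S n \<ge> 0" and t0: "t \<ge> (0::real)"
    obtain R where R: "R > 0" "\<And>n. norm (X n) \<le> R" using convergent_imp_Bseq[OF convergentI[OF X]] by (auto simp: Bseq_def)
    obtain T where T: "T > 0" "\<And>n. \<bar>S n\<bar> \<le> T" using convergent_imp_Bseq[OF convergentI[OF S]] by (auto simp: Bseq_def)
    obtain C where C: "C \<ge> 0" "\<And>x t. t \<in> {0..T} \<Longrightarrow> f x t \<le> C * (1 + norm x) powr a"
      using adm_bound[OF f] by blast
    have "(\<lambda>n. \<integral>y. k y * f (X n - y) (S n) \<partial>lborel) \<longlonglongrightarrow> (\<integral>y. k y * f (x - y) t \<partial>lborel)"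
    \<comment> \<open>\<open>R\<close> bounds the points \<open>X n\<close>, so by
      submultiplicativity one integrable function dominates all translates.\<close>
    proof (rule integral_dominated_convergence[where w = "\<lambda>y. C * (1 + R) powr a * (k y * (1 + norm y) powr a)"])
      show "integrable lborel (\<lambda>y. C * (1 + R) powr a * (k y * (1 + norm y) powr a))"
        by (intro integrable_mult_right k_powr_moment a)
      show "AE y in lborel. (\<lambda>n. k y * f (X n - y) (S n)) \<longlonglongrightarrow> k y * f (x - y) t"
      proof (intro AE_I2 tendsto_mult tendsto_const)
        fix y
        have "(\<lambda>n. (X n - y, S n)) \<longlonglongrightarrow> (x - y, t)" by (intro tendsto_intros X S)
        then have "((\<lambda>(x, t). f x t) \<circ> (\<lambda>n. (X n - y, S n))) \<longlonglongrightarrow> (\<lambda>(x, t). f x t) (x - y, t)"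
          using adm_continuous[OF f] S0 t0 unfolding continuous_on_sequentially by auto
        then show "(\<lambda>n. f (X n - y) (S n)) \<longlonglongrightarrow> f (x - y) t" by (simp add: o_def)
      qed
      show "(\<lambda>y. k y * f (X n - y) (S n)) \<in> borel_measurable lborel" for n
        using K_integrable[OF f a S0[of n], of "X n"] by auto
      show "(\<lambda>y. k y * f (x - y) t) \<in> borel_measurable lborel"
        using K_integrable[OF f a t0, of x] by auto
      show "AE y in lborel. norm (k y * f (X n - y) (S n)) \<le> C * (1 + R) powr a * (k y * (1 + norm y) powr a)" for n
      proof (intro AE_I2)
        fix y
        have "f (X n - y) (S n) \<le> C * (1 + norm (X n - y)) powr a" using T(2)[of n] S0[of n] by (intro C) auto
        also have "\<dots> \<le> C * ((1 + norm (X n)) powr a * (1 + norm y) powr a)"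
          by (intro mult_left_mono one_plus_norm_powr_submult a C)
        also have "\<dots> \<le> C * ((1 + R) powr a * (1 + norm y) powr a)"
          using R(2)[of n] a by (intro mult_left_mono mult_right_mono powr_mono2 C) auto
        finally have "k y * f (X n - y) (S n) \<le> k y * (C * ((1 + R) powr a * (1 + norm y) powr a))"
          by (intro mult_left_mono k_nonneg)
        then show "norm (k y * f (X n - y) (S n)) \<le> C * (1 + R) powr a * (k y * (1 + norm y) powr a)"
          using k_nonneg[of y] adm_nonneg[OF f S0[of n]] by (simp add: abs_mult mult_ac)
      qed
    qed
    then show "(\<lambda>n. K (\<lambda>y. f y (S n)) (X n)) \<longlonglongrightarrow> K (\<lambda>y. f y t) x" by (simp add: K_def)
  qed
qed

end

section \<open>The integral operator\<close>

text \<open>The bounds on the potential include t = 0. The condition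
  \<open>p * \<theta>up < \<epsilon> * \<theta>lo\<close> is \<open>\<rho> < 1\<close> without
  division. \<open>eps_prop\<close> covers the powers from \<sigma> to \<sigma>/(1-p), which are all
  the spatial powers that the bootstrap meets.\<close>

locale pseudoparabolic = conv_kernel k e0 b0 c0
  for k :: "'a::euclidean_space \<Rightarrow> real" and e0 b0 c0 +
  fixes W :: "'a \<Rightarrow> real \<Rightarrow> real" and \<Lambda> :: "real \<Rightarrow> real" and \<sigma> \<theta>lo \<theta>up \<epsilon> p a :: real
  assumes sigma: "\<sigma> \<ge> 0"
    and Lam_cont: "continuous_on {0..} \<Lambda>"
    and Lam_pos: "t \<ge> 0 \<Longrightarrow> \<Lambda> t > 0"
    and theta: "\<theta>lo > 0" "\<theta>up > 0"
    and W_cont: "continuous_on (UNIV \<times> {0..}) (\<lambda>(x, t). W x t)"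
    and W_nonneg: "t \<ge> 0 \<Longrightarrow> W x t \<ge> 0"
    and W_lower: "norm x \<ge> 1 \<Longrightarrow> t \<ge> 0 \<Longrightarrow> W x t \<ge> \<theta>lo * \<Lambda> t * pw (norm x) \<sigma>"
    and W_upper: "t \<ge> 0 \<Longrightarrow> W x t \<le> \<theta>up * \<Lambda> t * pw (norm x) \<sigma>"
    and eps: "\<epsilon> > 0"
    and eps_prop: "d \<in> {0..\<sigma> * p / (1 - p)} \<Longrightarrow>
        (\<integral>y. k y * (if norm (x - y) \<ge> 1 then pw (norm (x - y)) (\<sigma> + d) else 0) \<partial>lborel) \<ge> \<epsilon> * pw (norm x) (\<sigma> + d)"
    and p: "0 < p" "p < 1" "p * \<theta>up < \<epsilon> * \<theta>lo"
    and a: "a \<ge> \<sigma> / (1 - p)"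
begin

text \<open>The exponent of the scalar equation y' = lam y^p, whose positive solution starting from
  0 is ((1-p) L)^q.\<close>

definition "q = 1 / (1 - p)"

definition lam :: "real \<Rightarrow> real" where "lam t = exp ((1 - p) * t) * \<Lambda> t"

definition L :: "real \<Rightarrow> real" where "L t = integral {0..t} lam"

definition Nl :: "('a \<Rightarrow> real \<Rightarrow> real) \<Rightarrow> 'a \<Rightarrow> real \<Rightarrow> real" where
  "Nl f y t = f y t + exp ((1 - p) * t) * (W y t * f y t powr p)"

text \<open>The two integrals of the s-solution equation are merged, so that a single nonnegative
  integrand gives monotonicity both in the function and in time.\<close>

definition \<Phi> :: "('a \<Rightarrow> real \<Rightarrow> real) \<Rightarrow> 'a \<Rightarrow> real \<Rightarrow> real" where
  "\<Phi> f x t = integral {0..t} (\<lambda>\<tau>. K (\<lambda>y. Nl f y \<tau>) x)"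

lemma q: "q > 1" "q * (1 - p) = 1" "q * p = q - 1" "1 / q = 1 - p"
  using p by (auto simp: q_def field_simps)

lemma a_nonneg: "a \<ge> 0"
  using a sigma p by (meson divide_nonneg_pos diff_gt_0_iff_gt order_trans)

text \<open>The role of \<open>a \<ge> \<sigma> / (1 - p)\<close>: growth of order \<open>a\<close>
  survives the reaction, whose order is \<open>\<sigma> + a * p\<close>.\<close>

lemma sigma_le: "\<sigma> + a * p \<le> a"
  using a p by (simp add: field_simps)

lemma lam_pos: "t \<ge> 0 \<Longrightarrow> lam t > 0"
  by (simp add: lam_def Lam_pos)

lemma lam_cont: "continuous_on {0..} lam"
  unfolding lam_def by (intro continuous_intros Lam_cont)

section \<open>The primitive \<open>L\<close> and exact time integrals of its powers\<close>

lemma L_0 [simp]: "L 0 = 0"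
  by (simp add: L_def)

lemma lam_integrable: "s \<ge> 0 \<Longrightarrow> lam integrable_on {s..t}"
  by (rule integrable_continuous_interval) (auto intro: continuous_on_subset[OF lam_cont])

lemma L_derivative: "t > 0 \<Longrightarrow> (L has_real_derivative lam t) (at t)"
proof -
  assume t: "t > 0"
  have "(L has_real_derivative lam t) (at t within {0..t + 1})"
    unfolding L_def by (intro integral_has_real_derivative continuous_on_subset[OF lam_cont]) (use t in auto)
  then show ?thesis using t at_within_interior[of t "{0..t+1}"] by (simp add: interior_atLeastAtMost_real)
qed

lemma L_cont: "continuous_on {0..} L"
  unfolding continuous_on_eq_continuous_within
proof
  fix t :: real assume t: "t \<in> {0..}"
  show "continuous (at t within {0..}) L"
  proof (cases "t = 0")
    case True
    have "continuous_on {0..1} L"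
      unfolding L_def by (intro indefinite_integral_continuous_1 lam_integrable) simp
    then have "continuous (at 0 within {0..1}) L" by (simp add: continuous_on_eq_continuous_within)
    moreover have "at 0 within {0..1} = at (0::real) within {0..}"
      by (rule at_within_nhd[of _ "{-1<..<1}"]) auto
    ultimately show ?thesis using True by simp
  next
    case False
    then show ?thesis using t DERIV_isCont[OF L_derivative[of t]] continuous_at_imp_continuous_at_within by fastforce
  qed
qed

lemma L_strict_mono: "0 \<le> s \<Longrightarrow> s < t \<Longrightarrow> L s < L t"
proof -
  assume st: "0 \<le> s" "s < t"
  have "\<exists>l z. s < z \<and> z < t \<and> (L has_real_derivative l) (at z) \<and> L t - L s = (t - s) * l"
  proof (rule MVT)
    show "continuous_on {s..t} L" by (rule continuous_on_subset[OF L_cont]) (use st in auto)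
    show "L differentiable (at x)" if "s < x" "x < t" for x
      using L_derivative[of x] st that by (auto simp: real_differentiable_def)
  qed (use st in auto)
  then obtain l z where z: "s < z" "z < t" "(L has_real_derivative l) (at z)" "L t - L s = (t - s) * l" by blast
  have "l = lam z" using DERIV_unique[OF z(3) L_derivative] z(1) st by simp
  then have "(t - s) * l > 0" using lam_pos[of z] st z by simp
  then show ?thesis using z by simp
qed

lemma L_mono: "0 \<le> s \<Longrightarrow> s \<le> t \<Longrightarrow> L s \<le> L t"
  using L_strict_mono[of s t] by (cases "s = t") auto

lemma L_pos: "t > 0 \<Longrightarrow> L t > 0" using L_strict_mono[of 0 t] by simp

lemma L_nonneg: "t \<ge> 0 \<Longrightarrow> L t \<ge> 0" using L_mono[of 0 t] by simp

text \<open>Since \<open>q * p = q - 1\<close>, the integrand is an exact derivative. Hence a lower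
  bound with time profile \<open>(L t - L s) powr q\<close> reproduces this profile under the
  reaction.\<close>

lemma has_integral_lam_powr:
  assumes "0 \<le> s" "s \<le> t"
  shows "((\<lambda>\<tau>. lam \<tau> * (L \<tau> - L s) powr (q * p)) has_integral (1 - p) * (L t - L s) powr q) {s..t}"
proof -
  have "((\<lambda>\<tau>. lam \<tau> * (L \<tau> - L s) powr (q * p)) has_integral (1 - p) * (L t - L s) powr q - (1 - p) * (L s - L s) powr q) {s..t}"
  \<comment> \<open>Differentiability is needed only inside the interval: the chain rule for
    \<open>powr\<close> wants a positive base, which is lost at the left endpoint.\<close>
  proof (rule fundamental_theorem_of_calculus_interior[OF assms(2)])
    show "continuous_on {s..t} (\<lambda>\<tau>. (1 - p) * (L \<tau> - L s) powr q)"
    proof (intro continuous_on_mult continuous_on_const continuous_on_powr' continuous_on_diff continuous_on_subset[OF L_cont] ballI conjI impI)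
      show "0 \<le> L \<tau> - L s" if "\<tau> \<in> {s..t}" for \<tau> using L_mono[of s \<tau>] assms that by simp
    qed (use q(1) assms in auto)
    fix \<tau> assume \<tau>: "\<tau> \<in> {s<..<t}"
    have pos: "L \<tau> - L s > 0" using L_strict_mono[of s \<tau>] \<tau> assms by simp
    have "((\<lambda>\<tau>. L \<tau> - L s) has_real_derivative lam \<tau> - 0) (at \<tau>)"
      using \<tau> assms by (intro DERIV_diff L_derivative DERIV_const) auto
    from DERIV_cmult[OF DERIV_fun_powr[OF this pos, of q], of "1 - p"]
    have "((\<lambda>\<tau>. (1 - p) * (L \<tau> - L s) powr q) has_real_derivative (q * (1 - p)) * (lam \<tau> * (L \<tau> - L s) powr (q - 1))) (at \<tau>)"
      by (simp add: mult_ac)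
    moreover have "(q * (1 - p)) * (lam \<tau> * (L \<tau> - L s) powr (q - 1)) = lam \<tau> * (L \<tau> - L s) powr (q * p)"
      unfolding q(2) q(3) by simp
    ultimately show "((\<lambda>\<tau>. (1 - p) * (L \<tau> - L s) powr q) has_vector_derivative lam \<tau> * (L \<tau> - L s) powr (q * p)) (at \<tau>)"
      by (simp add: has_real_derivative_iff_has_vector_derivative)
  qed
  then show ?thesis by simp
qed

text \<open>The product rule for \<open>L powr q\<close> and an exponential. It is used with
  \<open>\<eta> = 1 / \<rho>\<close> for the contraction and with \<open>\<eta> = A a\<close> for
  the majorant.\<close>

lemma has_integral_powr_exp:
  assumes "0 \<le> t"
  shows "((\<lambda>\<tau>. \<eta> * (L \<tau> powr q * exp (\<eta> * \<tau>)) + q * (lam \<tau> * L \<tau> powr (q * p) * exp (\<eta> * \<tau>)))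
     has_integral L t powr q * exp (\<eta> * t)) {0..t}"
proof -
  have "((\<lambda>\<tau>. \<eta> * (L \<tau> powr q * exp (\<eta> * \<tau>)) + q * (lam \<tau> * L \<tau> powr (q * p) * exp (\<eta> * \<tau>)))
     has_integral L t powr q * exp (\<eta> * t) - L 0 powr q * exp (\<eta> * 0)) {0..t}"
  proof (rule fundamental_theorem_of_calculus_interior[OF assms])
    show "continuous_on {0..t} (\<lambda>\<tau>. L \<tau> powr q * exp (\<eta> * \<tau>))"
      using assms q(1) by (intro continuous_on_mult continuous_on_const continuous_on_exp continuous_on_id continuous_on_powr'
          continuous_on_subset[OF L_cont] ballI conjI impI L_nonneg) auto
    fix \<tau> assume \<tau>: "\<tau> \<in> {0<..<t}"
    have "((\<lambda>\<tau>. L \<tau> powr q * exp (\<eta> * \<tau>)) has_real_derivative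
       (q * L \<tau> powr (q - 1) * lam \<tau>) * exp (\<eta> * \<tau>) + (exp (\<eta> * \<tau>) * \<eta>) * L \<tau> powr q) (at \<tau>)"
    proof -
      have 1: "((\<lambda>\<tau>. L \<tau> powr q) has_real_derivative q * L \<tau> powr (q - 1) * lam \<tau>) (at \<tau>)"
        using DERIV_fun_powr[OF L_derivative[of \<tau>] L_pos[of \<tau>], of q] \<tau> by simp
      have 2: "((\<lambda>\<tau>. exp (\<eta> * \<tau>)) has_real_derivative exp (\<eta> * \<tau>) * \<eta>) (at \<tau>)"
        by (auto intro!: derivative_eq_intros)
      show ?thesis by (rule DERIV_mult[OF 1 2])
    qed
    then show "((\<lambda>\<tau>. L \<tau> powr q * exp (\<eta> * \<tau>)) has_vector_derivative
       \<eta> * (L \<tau> powr q * exp (\<eta> * \<tau>)) + q * (lam \<tau> * L \<tau> powr (q * p) * exp (\<eta> * \<tau>))) (at \<tau>)"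
      unfolding q(3) has_real_derivative_iff_has_vector_derivative[symmetric]
      by (rule DERIV_cong) (simp add: algebra_simps)
  qed
  then show ?thesis by simp
qed

lemma W_le:
  assumes "t \<ge> 0"
  shows "exp ((1 - p) * t) * W x t \<le> \<theta>up * lam t * pw (norm x) \<sigma>"
  using mult_left_mono[OF W_upper[OF assms, of x], of "exp ((1 - p) * t)"] by (simp add: lam_def mult_ac)

section \<open>Mapping properties and monotonicity of the integral operator\<close>

lemma Nl_bound:
  assumes t: "t \<ge> 0" and f: "0 \<le> f x t" "f x t \<le> M * (1 + norm x) powr a" and M: "M \<ge> 0"
  shows "Nl f x t \<le> (M + \<theta>up * lam t * M powr p) * (1 + norm x) powr a"
proof -
  have "exp ((1 - p) * t) * (W x t * f x t powr p) \<le> (\<theta>up * lam t * pw (norm x) \<sigma>) * f x t powr p"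
    using mult_right_mono[OF W_le[OF t], of "f x t powr p" x] by (simp add: mult_ac)
  also have "\<dots> \<le> (\<theta>up * lam t * (1 + norm x) powr \<sigma>) * (M powr p * (1 + norm x) powr (a * p))"
  proof (intro mult_mono)
    have "f x t powr p \<le> (M * (1 + norm x) powr a) powr p" using f p by (intro powr_mono2) auto
    then show "f x t powr p \<le> M powr p * (1 + norm x) powr (a * p)" using M by (simp add: powr_mult powr_powr)
    show "pw (norm x) \<sigma> \<le> (1 + norm x) powr \<sigma>" by (rule pw_le_powr[OF norm_ge_zero sigma])
  qed (use theta lam_pos[OF t] in \<open>auto intro!: pw_nonneg mult_nonneg_nonneg\<close>)
  also have "\<dots> = \<theta>up * lam t * M powr p * (1 + norm x) powr (\<sigma> + a * p)" by (simp add: powr_add mult_ac)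
  also have "\<dots> \<le> \<theta>up * lam t * M powr p * (1 + norm x) powr a"
    using theta lam_pos[OF t] by (intro mult_left_mono powr_mono sigma_le) auto
  finally show ?thesis unfolding Nl_def distrib_right using f by linarith
qed

lemma Nl_nonneg: "t \<ge> 0 \<Longrightarrow> 0 \<le> f x t \<Longrightarrow> 0 \<le> Nl f x t"
  by (simp add: Nl_def W_nonneg)

lemma lam_bounded: obtains B where "B \<ge> 0" "\<And>t. t \<in> {0..T} \<Longrightarrow> lam t \<le> B"
proof -
  have "bounded (lam ` {0..T})"
    by (intro compact_imp_bounded compact_continuous_image continuous_on_subset[OF lam_cont]) auto
  then obtain B where B: "\<And>x. x \<in> lam ` {0..T} \<Longrightarrow> norm x \<le> B" unfolding bounded_iff by blast
  have "lam t \<le> max B 0" if "t \<in> {0..T}" for t using B[of "lam t"] that by auto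
  then show ?thesis using that[of "max B 0"] by simp
qed

lemma adm_Nl:
  assumes f: "adm a f"
  shows "adm a (Nl f)"
  unfolding adm_def
proof (intro conjI allI impI)
  show "0 \<le> Nl f x t" if "t \<ge> 0" for x t using Nl_nonneg adm_nonneg[OF f] that by blast
  have "continuous_on (UNIV \<times> {0..}) (\<lambda>z. (\<lambda>(x, t). f x t) z + exp ((1 - p) * snd z) * ((\<lambda>(x, t). W x t) z * ((\<lambda>(x, t). f x t) z) powr p))"
    using p adm_nonneg[OF f]
    by (intro continuous_on_add continuous_on_mult continuous_on_const continuous_on_exp continuous_on_snd
        continuous_on_id continuous_on_powr' adm_continuous[OF f] W_cont) auto
  then show "continuous_on (UNIV \<times> {0..}) (\<lambda>(x, t). Nl f x t)" by (simp add: Nl_def case_prod_beta')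
  fix T
  obtain C where C: "C \<ge> 0" "\<And>x t. t \<in> {0..T} \<Longrightarrow> f x t \<le> C * (1 + norm x) powr a"
    using adm_bound[OF f] by blast
  obtain B where B: "B \<ge> 0" "\<And>t. t \<in> {0..T} \<Longrightarrow> lam t \<le> B" using lam_bounded by blast
  show "\<exists>C. \<forall>x. \<forall>t\<in>{0..T}. Nl f x t \<le> C * (1 + norm x) powr a"
  proof (intro exI[of _ "C + \<theta>up * B * C powr p"] allI ballI)
    fix x t assume t: "t \<in> {0..T}"
    have "Nl f x t \<le> (C + \<theta>up * lam t * C powr p) * (1 + norm x) powr a"
      using t C adm_nonneg[OF f] by (intro Nl_bound) auto
    also have "\<dots> \<le> (C + \<theta>up * B * C powr p) * (1 + norm x) powr a"
      using t B theta by (intro mult_right_mono add_left_mono mult_left_mono) auto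
    finally show "Nl f x t \<le> (C + \<theta>up * B * C powr p) * (1 + norm x) powr a" .
  qed
qed

lemma adm_K_Nl: "adm a f \<Longrightarrow> adm a (\<lambda>x t. K (\<lambda>y. Nl f y t) x)"
  by (intro adm_K adm_Nl a_nonneg)

lemma adm_Phi: "adm a f \<Longrightarrow> adm a (\<Phi> f)"
  unfolding \<Phi>_def by (intro adm_time_integral adm_K_Nl)

lemma K_Nl_integrable: "adm a f \<Longrightarrow> s \<ge> 0 \<Longrightarrow> (\<lambda>\<tau>. K (\<lambda>y. Nl f y \<tau>) x) integrable_on {s..t}"
  using adm_integrable_time[OF adm_K_Nl] by blast

lemma Nl_mono: "t \<ge> 0 \<Longrightarrow> 0 \<le> f x t \<Longrightarrow> f x t \<le> g x t \<Longrightarrow> Nl f x t \<le> Nl g x t"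
  unfolding Nl_def using p by (intro add_mono mult_left_mono powr_mono2 W_nonneg) auto

lemma Phi_mono:
  assumes "adm a f" "adm a g" and le: "\<And>x \<tau>. \<tau> \<in> {0..t} \<Longrightarrow> f x \<tau> \<le> g x \<tau>"
  shows "\<Phi> f x t \<le> \<Phi> g x t"
  unfolding \<Phi>_def
proof (rule Henstock_Kurzweil_Integration.integral_le)
  fix \<tau> assume \<tau>: "\<tau> \<in> {0..t}"
  show "K (\<lambda>y. Nl f y \<tau>) x \<le> K (\<lambda>y. Nl g y \<tau>) x"
    unfolding K_def using \<tau> adm_nonneg[OF assms(1)]
    by (intro integral_mono K_integrable[OF adm_Nl] assms a_nonneg mult_left_mono k_nonneg Nl_mono le) auto
qed (use K_Nl_integrable assms in auto)

lemma Phi_split: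
  assumes "adm a f" "0 \<le> s" "s \<le> t"
  shows "\<Phi> f x t = \<Phi> f x s + integral {s..t} (\<lambda>\<tau>. K (\<lambda>y. Nl f y \<tau>) x)"
  unfolding \<Phi>_def using assms K_Nl_integrable
  by (intro Henstock_Kurzweil_Integration.integral_combine[symmetric]) auto

text \<open>The integrand is nonnegative. Consequently fixed points are nondecreasing in time, and
  positivity at a point persists.\<close>

lemma Phi_mono_time:
  assumes "adm a f" "0 \<le> s" "s \<le> t"
  shows "\<Phi> f x s \<le> \<Phi> f x t"
  unfolding Phi_split[OF assms]
  using Henstock_Kurzweil_Integration.integral_nonneg[OF K_Nl_integrable[OF assms(1,2)], of t x] adm_nonneg[OF adm_K_Nl[OF assms(1)]] assms(2)
  by (simp add: order_trans)

subsection \<open>Upper bound, contraction and comparison\<close>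

text \<open>Apart from a term with the factor \<open>t\<close>, which can be absorbed at small
  times, the bound is sublinear in \<open>M\<close>.\<close>

lemma Phi_bound:
  assumes f: "adm a f" and M: "M \<ge> 0" and t: "t \<ge> 0"
    and le: "\<And>y \<tau>. \<tau> \<in> {0..t} \<Longrightarrow> f y \<tau> \<le> M * (1 + norm y) powr a"
  shows "\<Phi> f x t \<le> A a * (t * M + \<theta>up * M powr p * L t) * (1 + norm x) powr a"
proof -
  let ?c = "(1 + norm x) powr a * A a"
  have "((\<lambda>\<tau>. M + \<theta>up * M powr p * lam \<tau>) has_integral (t * M + \<theta>up * M powr p * L t)) {0..t}"
    using t has_integral_const_real[of M 0 t]
    by (intro has_integral_add has_integral_mult_right) (auto simp: L_def lam_integrable integrable_integral)
  from has_integral_mult_right[OF this, of ?c]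
  have I: "((\<lambda>\<tau>. ?c * (M + \<theta>up * M powr p * lam \<tau>)) has_integral ?c * (t * M + \<theta>up * M powr p * L t)) {0..t}" .
  have "\<Phi> f x t \<le> ?c * (t * M + \<theta>up * M powr p * L t)"
    unfolding \<Phi>_def
  proof (rule has_integral_le[OF integrable_integral[OF K_Nl_integrable[OF f order_refl]] I])
    fix \<tau> assume \<tau>: "\<tau> \<in> {0..t}"
    have n: "0 \<le> Nl f y \<tau>" for y using Nl_nonneg adm_nonneg[OF f] \<tau> by auto
    have c: "M + \<theta>up * M powr p * lam \<tau> \<ge> 0" using M theta lam_pos[of \<tau>] \<tau> by auto
    have "\<bar>K (\<lambda>y. Nl f y \<tau>) x\<bar> \<le> (M + \<theta>up * M powr p * lam \<tau>) * (1 + norm x) powr a * A a"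
    proof (rule K_bound_powr[OF _ _ c a_nonneg])
      show "(\<lambda>y. Nl f y \<tau>) \<in> borel_measurable borel" using \<tau> by (intro adm_measurable[OF adm_Nl[OF f]]) auto
      show "\<bar>Nl f z \<tau>\<bar> \<le> (M + \<theta>up * M powr p * lam \<tau>) * (1 + norm z) powr a" for z
        using Nl_bound[of \<tau> f z M] \<tau> M le[OF \<tau>, of z] adm_nonneg[OF f, of \<tau> z] n[of z] by (simp add: mult_ac)
    qed
    then show "K (\<lambda>y. Nl f y \<tau>) x \<le> ?c * (M + \<theta>up * M powr p * lam \<tau>)" by (simp add: mult_ac)
  qed
  then show ?thesis by (simp add: mult_ac)
qed

text \<open>The contraction needs a bound that vanishes like \<open>L powr q\<close> at t = 0, which
  admissibility does not contain. On a short interval the weighted supremum m satisfies m \<le> m/2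
  + c L m^p, and solving this gives the rate; at later times the crude bound is enough.\<close>

lemma fixed_point_upper_bound:
  assumes f: "adm a f" and ffix: "\<And>x t. t \<ge> 0 \<Longrightarrow> f x t = \<Phi> f x t" and T: "T > 0"
  obtains C where "C \<ge> 0" "\<And>x t. t \<in> {0..T} \<Longrightarrow> f x t \<le> C * L t powr q * (1 + norm x) powr a"
proof -
  obtain C1 where C1: "C1 \<ge> 0" "\<And>x t. t \<in> {0..T} \<Longrightarrow> f x t \<le> C1 * (1 + norm x) powr a"
    using adm_bound[OF f] by blast
  have A: "A a \<ge> 1" by (rule A_ge_one[OF a_nonneg])
  \<comment> \<open>\<open>B * L t powr q\<close> solves m = 2 A \<theta>up L m^p; the 2 comes from
    absorbing half of m.\<close>
  define B where "B = (2 * A a * \<theta>up) powr q"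
  have small: "f x t \<le> B * L t powr q * (1 + norm x) powr a" if t: "t \<in> {0..T}" "A a * t \<le> 1 / 2" for x t
  proof -
    let ?S = "UNIV \<times> {0..t} :: ('a \<times> real) set"
    define F where "F z = f (fst z) (snd z) / (1 + norm (fst z)) powr a" for z
    define m where "m = (SUP z\<in>?S. F z)"
    have w: "(1 + norm y) powr a > 0" for y :: 'a using norm_ge_zero[of y] unfolding powr_gt_zero by linarith
    have bdd: "bdd_above (F ` ?S)"
    proof (rule bdd_aboveI2)
      fix z :: "'a \<times> real" assume "z \<in> ?S"
      then show "F z \<le> C1" using C1(2)[of "snd z" "fst z"] w t by (auto simp: F_def divide_le_eq)
    qed
    have le: "f y \<tau> \<le> m * (1 + norm y) powr a" if "\<tau> \<in> {0..t}" for y \<tau>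
    proof -
      have "F (y, \<tau>) \<le> m" unfolding m_def by (rule cSUP_upper[OF _ bdd]) (use that in auto)
      then show ?thesis using w by (simp add: F_def divide_le_eq)
    qed
    have "0 \<le> F (0, 0)" using adm_nonneg[OF f, of 0 0] by (simp add: F_def)
    also have "\<dots> \<le> m" unfolding m_def by (rule cSUP_upper[OF _ bdd]) (use t in auto)
    finally have m0: "m \<ge> 0" .
    \<comment> \<open>Each value at a time up to \<open>t\<close> is majorised by
      \<open>\<Phi> f\<close> at time \<open>t\<close>, so the supremum over the whole slab obeys
      the estimate at its final time.\<close>
    have "m \<le> A a * (t * m + \<theta>up * m powr p * L t)"
    proof (subst (1) m_def, rule cSUP_least)
      fix z :: "'a \<times> real" assume z: "z \<in> ?S"
      have "f (fst z) (snd z) = \<Phi> f (fst z) (snd z)" using z by (intro ffix) auto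
      also have "\<dots> \<le> \<Phi> f (fst z) t" using z by (intro Phi_mono_time[OF f]) auto
      also have "\<dots> \<le> A a * (t * m + \<theta>up * m powr p * L t) * (1 + norm (fst z)) powr a"
        using t by (intro Phi_bound[OF f m0 _ le]) auto
      finally show "F z \<le> A a * (t * m + \<theta>up * m powr p * L t)"
        using w by (simp add: F_def divide_le_eq)
    qed (use t in auto)
    also have "\<dots> = (A a * t) * m + A a * \<theta>up * L t * m powr p" by (simp add: algebra_simps)
    also have "\<dots> \<le> 1 / 2 * m + A a * \<theta>up * L t * m powr p" using t m0 by (intro add_right_mono mult_right_mono) auto
    finally have m1: "m \<le> (2 * A a * \<theta>up * L t) * m powr p" by simp
    have "m \<le> (2 * A a * \<theta>up * L t) powr q"
    proof (cases "m = 0")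
      case False
      then have mpos: "m > 0" using m0 by simp
      have "m = m powr (1 - p) * m powr p" using mpos by (simp flip: powr_add)
      then have "m powr (1 - p) \<le> 2 * A a * \<theta>up * L t"
        using m1 mpos by (metis mult_le_cancel_right_pos powr_gt_zero less_numeral_extra(3))
      then have "(m powr (1 - p)) powr q \<le> (2 * A a * \<theta>up * L t) powr q"
        using q(1) by (intro powr_mono2) auto
      then show ?thesis using mpos q(2) by (simp add: powr_powr mult.commute)
    qed simp
    also have "\<dots> = B * L t powr q" unfolding B_def using A theta L_nonneg t by (subst powr_mult[symmetric]) auto
    finally have "m * (1 + norm x) powr a \<le> B * L t powr q * (1 + norm x) powr a" by (rule mult_right_mono) simp
    then show ?thesis using le[of t x] t by simp
  qed
  define t0 where "t0 = min T (1 / (2 * A a))"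
  have t0: "t0 > 0" "t0 \<le> T" "A a * t0 \<le> 1 / 2" using T A by (auto simp: t0_def min_def field_simps)
  \<comment> \<open>After \<open>t0\<close> the factor \<open>L t powr q\<close> is bounded below,
    so \<open>C1\<close> can be divided by its value at \<open>t0\<close>.\<close>
  define C where "C = max B (C1 / L t0 powr q)"
  show ?thesis
  proof (rule that[of C])
    show "C \<ge> 0" by (simp add: C_def B_def le_max_iff_disj)
    fix x t assume t: "t \<in> {0..T}"
    show "f x t \<le> C * L t powr q * (1 + norm x) powr a"
    proof (cases "t \<le> t0")
      case True
      then have "A a * t \<le> 1 / 2" using t0 A by (meson mult_left_mono order_trans zero_le_one)
      then have "f x t \<le> B * L t powr q * (1 + norm x) powr a" by (rule small[OF t])
      also have "\<dots> \<le> C * L t powr q * (1 + norm x) powr a" unfolding C_def by (intro mult_right_mono) auto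
      finally show ?thesis .
    next
      case False
      have Lt: "L t0 powr q > 0" using L_pos[OF t0(1)] by simp
      have "L t0 powr q \<le> L t powr q" using False t0 L_nonneg L_mono q(1) by (intro powr_mono2) auto
      then have "C1 / L t0 powr q * L t0 powr q \<le> C * L t powr q"
        unfolding C_def using Lt C1 by (intro mult_mono) (auto simp: le_max_iff_disj)
      then have "C1 \<le> C * L t powr q" using Lt by simp
      then have "C1 * (1 + norm x) powr a \<le> C * L t powr q * (1 + norm x) powr a" by (rule mult_right_mono) simp
      then show ?thesis using C1(2)[OF t, of x] by linarith
    qed
  qed
qed

text \<open>Above \<open>\<phi>\<close> the derivative of the reaction, after the powers of |x|
  cancel, is at most \<open>\<rho> * q * lam t / L t\<close>.\<close>

definition \<rho> :: real where "\<rho> = p * \<theta>up / (\<epsilon> * \<theta>lo)"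

text \<open>With E = (1-p) \<epsilon> \<theta>lo, the prefactor E^q is the positive fixed point of D
  := E D^p, the scalar form of one lower-bound step.\<close>

definition \<phi> :: "'a \<Rightarrow> real \<Rightarrow> real" where "\<phi> x t = ((1 - p) * \<epsilon> * \<theta>lo * L t * pw (norm x) \<sigma>) powr q"

abbreviation wt :: "real \<Rightarrow> real \<Rightarrow> 'a \<Rightarrow> real \<Rightarrow> real" where
  "wt M e x t \<equiv> M * (L t powr q * exp (1 / \<rho> * t)) * exp (e * norm x)"

lemma rho: "0 < \<rho>" "\<rho> < 1"
  using p theta eps by (auto simp: \<rho>_def field_simps)

text \<open>The tangent slope at \<open>v\<close> is at most the slope at \<open>\<phi>\<close>,
  namely p / (E L |x|^\<sigma>). The upper bound of the potential cancels |x|^\<sigma>, and the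
  difference bound \<open>D * L t powr q\<close> turns the singular 1/L into
  \<open>L powr (q * p)\<close>.\<close>

lemma Nl_diff_le:
  assumes t: "t \<ge> 0" and v: "\<phi> x t \<le> v x t" and U: "v x t \<le> U x t"
    and d: "U x t - v x t \<le> D * L t powr q" and D: "D \<ge> 0"
  shows "Nl U x t - Nl v x t \<le> \<rho> * D * (1 / \<rho> * L t powr q + q * (lam t * L t powr (q * p)))"
proof -
  let ?P = "pw (norm x) \<sigma>" let ?E = "(1 - p) * \<epsilon> * \<theta>lo"
  have P0: "?P \<ge> 0" by (simp add: pw_nonneg)
  have E0: "?E > 0" using p eps theta by simp
  have "exp ((1 - p) * t) * (W x t * (U x t powr p - v x t powr p)) \<le> \<rho> * q * (lam t * L t powr (q * p)) * D"
  \<comment> \<open>The barrier vanishes in exactly these cases. At t = 0 the difference bound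
    forces \<open>U\<close> and \<open>v\<close> to agree; where |x|^\<sigma> is 0 the potential is
    0.\<close>
  proof (cases "t = 0 \<or> ?P = 0")
    case True
    then have "W x t * (U x t powr p - v x t powr p) = 0"
    proof
      assume "t = 0"
      then have "U x t = v x t" using d U by simp
      then show ?thesis by simp
    next
      assume "?P = 0"
      then have "W x t = 0" using W_upper[OF t, of x] W_nonneg[OF t, of x] by simp
      then show ?thesis by simp
    qed
    then have "exp ((1 - p) * t) * (W x t * (U x t powr p - v x t powr p)) = 0" by simp
    also have "\<dots> \<le> \<rho> * q * (lam t * L t powr (q * p)) * D"
      using rho q(1) lam_pos[OF t] D by (intro mult_nonneg_nonneg) auto
    finally show ?thesis .
  next
    case False
    then have tp: "t > 0" and P: "?P > 0" using t P0 by auto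
    have Lt: "L t > 0" by (rule L_pos[OF tp])
    have ELP: "?E * L t * ?P > 0" using E0 Lt P by simp
    then have \<phi>0: "\<phi> x t > 0" unfolding \<phi>_def powr_gt_zero by linarith
    then have v0: "v x t > 0" using v by simp
    have "v x t powr (p - 1) \<le> \<phi> x t powr (p - 1)" using \<phi>0 v p by (intro powr_mono2') auto
    also have "\<dots> = (?E * L t * ?P) powr (q * (p - 1))" by (simp add: \<phi>_def powr_powr)
    also have "q * (p - 1) = - 1" using q(2) by (simp add: algebra_simps)
    also have "(?E * L t * ?P) powr - 1 = 1 / (?E * L t * ?P)" using ELP by (simp add: powr_minus_divide)
    finally have vp: "v x t powr (p - 1) \<le> 1 / (?E * L t * ?P)" .
    have dL: "(U x t - v x t) / L t \<le> D * L t powr (q * p)"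
    proof -
      have "L t powr q = L t powr (q * p) * L t" unfolding q(3) using Lt by (simp add: powr_diff)
      then show ?thesis using d Lt by (simp add: divide_le_eq mult_ac)
    qed
    have "exp ((1 - p) * t) * (W x t * (U x t powr p - v x t powr p))
       \<le> (exp ((1 - p) * t) * W x t) * (p * v x t powr (p - 1) * (U x t - v x t))"
      unfolding mult.assoc[symmetric] using W_nonneg[OF t, of x] powr_diff_le_tangent[OF v0 U p(1,2)]
      by (simp add: mult.assoc mult_left_mono)
    also have "\<dots> \<le> (\<theta>up * lam t * ?P) * (p * (1 / (?E * L t * ?P)) * (U x t - v x t))"
    proof (rule mult_mono[OF W_le[OF t]])
      show "p * v x t powr (p - 1) * (U x t - v x t) \<le> p * (1 / (?E * L t * ?P)) * (U x t - v x t)"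
        using vp U p(1) by (intro mult_right_mono mult_left_mono) auto
      show "0 \<le> \<theta>up * lam t * ?P" using theta lam_pos[OF t] P by simp
      show "0 \<le> p * v x t powr (p - 1) * (U x t - v x t)" using U p by simp
    qed
    also have "\<dots> = (p * \<theta>up / ?E) * lam t * ((U x t - v x t) / L t)" using P by (simp add: mult_ac)
    also have "\<dots> \<le> (p * \<theta>up / ?E) * lam t * (D * L t powr (q * p))"
      using dL p theta E0 lam_pos[OF t] by (intro mult_left_mono) auto
    also have "p * \<theta>up / ?E = \<rho> * q" by (simp add: \<rho>_def q_def)
    finally show ?thesis by (simp add: mult_ac)
  qed
  then have "Nl U x t - Nl v x t \<le> D * L t powr q + \<rho> * q * (lam t * L t powr (q * p)) * D"
    using d unfolding Nl_def by (simp add: algebra_simps)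
  also have "\<dots> = \<rho> * D * (1 / \<rho> * L t powr q + q * (lam t * L t powr (q * p)))"
    using rho by (simp add: algebra_simps)
  finally show ?thesis .
qed

text \<open>The weight \<open>exp (e * norm x)\<close> is nearly invariant under the convolution for small \<open>e\<close>; together
  with the lower barrier \<open>\<phi>\<close> this makes the integral operator a contraction.\<close>

lemma Phi_contraction:
  assumes U: "adm a U" and v: "adm a v" and e: "0 \<le> e" "e \<le> e0" and M: "M \<ge> 0" and t: "t \<in> {0..T}"
    and low: "\<And>x \<tau>. \<tau> \<in> {0..T} \<Longrightarrow> \<phi> x \<tau> \<le> v x \<tau>"
    and vU: "\<And>x \<tau>. \<tau> \<in> {0..T} \<Longrightarrow> v x \<tau> \<le> U x \<tau>"
    and d: "\<And>x \<tau>. \<tau> \<in> {0..T} \<Longrightarrow> U x \<tau> - v x \<tau> \<le> wt M e x \<tau>"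
  shows "\<Phi> U x t - \<Phi> v x t
    \<le> wt ((\<rho> * expmom e) * M) e x t"
proof -
  let ?N = "expmom e"
  let ?c = "\<rho> * ?N * M * exp (e * norm x)"
  \<comment> \<open>\<open>?h\<close> is the exact derivative of
    \<open>L powr q * exp (\<tau> / \<rho>)\<close>, so the time integration loses nothing and the
    ratio is \<open>\<rho> * expmom e\<close>.\<close>
  let ?h = "\<lambda>\<tau>. 1 / \<rho> * (L \<tau> powr q * exp (1 / \<rho> * \<tau>)) + q * (lam \<tau> * L \<tau> powr (q * p) * exp (1 / \<rho> * \<tau>))"
  have I: "((\<lambda>\<tau>. ?c * ?h \<tau>) has_integral ?c * (L t powr q * exp (1 / \<rho> * t))) {0..t}"
    by (rule has_integral_mult_right[OF has_integral_powr_exp]) (use t in auto)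
  have "((\<lambda>\<tau>. K (\<lambda>y. Nl U y \<tau>) x - K (\<lambda>y. Nl v y \<tau>) x) has_integral (\<Phi> U x t - \<Phi> v x t)) {0..t}"
    unfolding \<Phi>_def by (intro has_integral_diff integrable_integral K_Nl_integrable U v) auto
  then have "\<Phi> U x t - \<Phi> v x t \<le> ?c * (L t powr q * exp (1 / \<rho> * t))"
  proof (rule has_integral_le[OF _ I])
    fix \<tau> assume \<tau>: "\<tau> \<in> {0..t}"
    then have \<tau>0: "\<tau> \<ge> 0" and \<tau>T: "\<tau> \<in> {0..T}" using t by auto
    have h0: "?h \<tau> \<ge> 0" using rho q(1) lam_pos[OF \<tau>0] by simp
    let ?d = "\<lambda>y. Nl U y \<tau> - Nl v y \<tau>"
    have "K (\<lambda>y. Nl U y \<tau>) x - K (\<lambda>y. Nl v y \<tau>) x = K ?d x"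
      unfolding K_def using K_integrable[OF adm_Nl[OF U] a_nonneg \<tau>0] K_integrable[OF adm_Nl[OF v] a_nonneg \<tau>0]
      by (simp add: right_diff_distrib)
    also have "\<bar>K ?d x\<bar> \<le> (\<rho> * M * ?h \<tau>) * exp (e * norm x) * ?N"
    proof (rule K_bound_exp[OF _ _ _ e])
      show "?d \<in> borel_measurable borel"
        by (intro borel_measurable_diff adm_measurable[OF adm_Nl] U v \<tau>0)
      show "0 \<le> \<rho> * M * ?h \<tau>" using rho M h0 by (intro mult_nonneg_nonneg) auto
      fix z
      have "0 \<le> ?d z" using Nl_mono[of \<tau> v z U] \<tau>0 adm_nonneg[OF v \<tau>0] vU[OF \<tau>T] by simp
      moreover have "?d z \<le> \<rho> * (M * exp (1 / \<rho> * \<tau>) * exp (e * norm z)) * (1 / \<rho> * L \<tau> powr q + q * (lam \<tau> * L \<tau> powr (q * p)))"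
        using d[OF \<tau>T, of z] M by (intro Nl_diff_le \<tau>0 low[OF \<tau>T] vU[OF \<tau>T]) (auto simp: mult_ac)
      ultimately show "\<bar>?d z\<bar> \<le> \<rho> * M * ?h \<tau> * exp (e * norm z)"
        using rho(1) by (simp add: algebra_simps)
    qed
    finally show "K (\<lambda>y. Nl U y \<tau>) x - K (\<lambda>y. Nl v y \<tau>) x \<le> ?c * ?h \<tau>" by (simp add: mult_ac abs_le_iff)
  qed
  then show ?thesis by (simp add: mult_ac)
qed

lemma contraction_weight:
  obtains e where "0 < e" "e \<le> e0" "0 \<le> \<rho> * expmom e"
    "\<rho> * expmom e < 1"
proof -
  have "1 / \<rho> > 1" using rho by simp
  then obtain e where e: "0 < e" "e \<le> e0" "expmom e < 1 / \<rho>"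
    by (rule k_exp_moment_near_one)
  have "expmom e \<ge> 0"
    by (intro Bochner_Integration.integral_nonneg) (simp add: k_nonneg)
  then show ?thesis using e rho by (intro that[of e]) (auto simp: field_simps)
qed

text \<open>Starts the contraction: a polynomially weighted a priori bound becomes one with an
  exponential weight of arbitrarily small rate.\<close>

lemma bound_to_exp_weight:
  assumes "C \<ge> 0" "e > 0"
  obtains M where "M \<ge> 0" "\<And>x t. t \<ge> 0 \<Longrightarrow>
    C * L t powr q * (1 + norm (x::'a)) powr a \<le> wt M e x t"
proof -
  obtain B where B: "B > 0" "\<And>r. r \<ge> 0 \<Longrightarrow> (1 + r) powr a \<le> B * exp (e * r)"
    using powr_le_exp[OF assms(2) a_nonneg] by blast
  show ?thesis
  proof (rule that[of "C * B"])
    show "C * B \<ge> 0" using assms B by simp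
    fix x :: 'a and t :: real assume t: "t \<ge> 0"
    have "1 \<le> exp (1 / \<rho> * t)" using t rho by simp
    then have "C * L t powr q * 1 * (1 + norm x) powr a \<le> C * L t powr q * exp (1 / \<rho> * t) * (B * exp (e * norm x))"
      using assms B by (intro mult_mono mult_left_mono B) auto
    then show "C * L t powr q * (1 + norm x) powr a \<le> C * B * (L t powr q * exp (1 / \<rho> * t)) * exp (e * norm x)"
      by (simp add: mult_ac)
  qed
qed

text \<open>Only \<open>f\<close> has to lie above the barrier; \<open>g\<close> is arbitrary.
  Applied to all s-solutions it yields maximality of \<open>f\<close>.\<close>

lemma fixed_point_comparison:
  assumes f: "adm a f" and ffix: "\<And>x t. t \<ge> 0 \<Longrightarrow> f x t = \<Phi> f x t"
    and low: "\<And>x t. t \<ge> 0 \<Longrightarrow> \<phi> x t \<le> f x t"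
    and g: "adm a g" and gfix: "\<And>x t. t \<ge> 0 \<Longrightarrow> g x t = \<Phi> g x t"
    and t: "t \<ge> 0"
  shows "g x t \<le> f x t"
proof -
  \<comment> \<open>The a priori bound requires a positive time, also when
    \<open>t = 0\<close>.\<close>
  define T where "T = t + 1"
  obtain C where C: "C \<ge> 0" "\<And>x t. t \<in> {0..T} \<Longrightarrow> g x t \<le> C * L t powr q * (1 + norm x) powr a"
    using fixed_point_upper_bound[OF g gfix, of T] t by (auto simp: T_def)
  obtain e where e: "0 < e" "e \<le> e0" "0 \<le> \<rho> * expmom e"
    "\<rho> * expmom e < 1" by (rule contraction_weight)
  obtain M where M: "M \<ge> 0" "\<And>x t. t \<ge> 0 \<Longrightarrow>
    C * L t powr q * (1 + norm (x::'a)) powr a \<le> wt M e x t"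
    using bound_to_exp_weight[OF C(1) e(1)] by blast
  define \<theta> where "\<theta> = \<rho> * expmom e"
  \<comment> \<open>The contraction compares ordered functions. \<open>U\<close> lies above
    \<open>f\<close>, and \<open>U \<le> \<Phi> U\<close> because both arguments of the maximum are
    fixed points of a monotone operator.\<close>
  define U where "U x t = max (g x t) (f x t)" for x t
  have U: "adm a U" unfolding U_def by (rule adm_max[OF g f])
  let ?w = "\<lambda>x \<tau>. (L \<tau> powr q * exp (1 / \<rho> * \<tau>)) * exp (e * norm x)"
  have w0: "?w x \<tau> \<ge> 0" for x :: 'a and \<tau> by simp
  have it: "U x \<tau> - f x \<tau> \<le> \<theta> ^ n * M * ?w x \<tau>" if "\<tau> \<in> {0..T}" for n x \<tau>
    using that
  proof (induction n arbitrary: x \<tau>)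
    case 0
    then have \<tau>: "\<tau> \<ge> 0" by simp
    have "g x \<tau> \<le> M * ?w x \<tau>" using C(2)[OF 0, of x] M(2)[OF \<tau>, of x] by (simp add: mult_ac)
    moreover have "0 \<le> M * ?w x \<tau>" using M by simp
    ultimately show ?case using adm_nonneg[OF f \<tau>, of x] by (simp add: U_def)
  next
    case (Suc n)
    then have \<tau>: "\<tau> \<ge> 0" by simp
    have "g x \<tau> = \<Phi> g x \<tau>" by (rule gfix[OF \<tau>])
    also have "\<dots> \<le> \<Phi> U x \<tau>" by (rule Phi_mono[OF g U]) (simp add: U_def)
    finally have 1: "g x \<tau> \<le> \<Phi> U x \<tau>" .
    have "f x \<tau> = \<Phi> f x \<tau>" by (rule ffix[OF \<tau>])
    moreover have "\<Phi> f x \<tau> \<le> \<Phi> U x \<tau>" by (rule Phi_mono[OF f U]) (simp add: U_def)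
    ultimately have "U x \<tau> - f x \<tau> \<le> \<Phi> U x \<tau> - \<Phi> f x \<tau>" using 1 by (simp add: U_def)
    also have "\<dots> \<le> wt (\<theta> * (\<theta> ^ n * M)) e x \<tau>"
      unfolding \<theta>_def
    proof (rule Phi_contraction[OF U f _ e(2) _ Suc.prems])
      show "0 \<le> (\<rho> * expmom e) ^ n * M" using e(3) M(1) by simp
      show "\<phi> x \<tau> \<le> f x \<tau>" if "\<tau> \<in> {0..T}" for x \<tau> using low that by simp
      show "f x \<tau> \<le> U x \<tau>" for x \<tau> by (simp add: U_def)
      show "U x \<tau> - f x \<tau> \<le> wt ((\<rho> * expmom e) ^ n * M) e x \<tau>"
        if "\<tau> \<in> {0..T}" for x \<tau> using Suc.IH[OF that, of x] by (simp add: \<theta>_def mult_ac)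
    qed (use e in simp)
    finally show ?case by (simp add: mult_ac)
  qed
  have "(\<lambda>n. \<theta> ^ n * (M * ?w x t)) \<longlonglongrightarrow> 0 * (M * ?w x t)"
    using e(3,4) by (intro tendsto_mult LIMSEQ_power_zero tendsto_const) (simp add: \<theta>_def)
  then have "U x t - f x t \<le> 0 * (M * ?w x t)"
    by (rule LIMSEQ_le_const) (use it[of t] t in \<open>auto simp: T_def mult_ac\<close>)
  then show ?thesis by (simp add: U_def)
qed

subsection \<open>Lower bound for immediately positive fixed points\<close>

text \<open>Turns the almost everywhere lower bound of the kernel into a lower bound of integrals,
  by keeping one ball only.\<close>

lemma k_integral_ball_lower:
  assumes int: "integrable lborel (\<lambda>y. k y * F y)" and F: "\<And>y. F y \<ge> 0"
    and m: "m \<ge> 0" "\<And>y. y \<in> ball z r \<Longrightarrow> F y \<ge> m" and R: "\<And>y. y \<in> ball z r \<Longrightarrow> norm y \<le> R"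
  shows "c0 * exp (- (b0 * R)) * m * measure lborel (ball z r) \<le> (\<integral>y. k y * F y \<partial>lborel)"
proof -
  let ?c = "c0 * exp (- (b0 * R)) * m"
  have "?c * measure lborel (ball z r) = (\<integral>y. ?c * indicator (ball z r) y \<partial>lborel)"
    by simp
  also have "\<dots> \<le> (\<integral>y. k y * F y \<partial>lborel)"
  proof (rule integral_mono_AE'[OF int])
    show "AE y in lborel. ?c * indicator (ball z r) y \<le> k y * F y"
      using k_lower
    proof eventually_elim
      case (elim y)
      show ?case
      proof (cases "y \<in> ball z r")
        case True
        have "b0 * norm y \<le> b0 * R" using R[OF True] b0 by (rule mult_left_mono)
        then have "c0 * exp (- (b0 * R)) \<le> k y" using elim c0 by (smt (verit) exp_le_cancel_iff mult_left_mono)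
        then have "c0 * exp (- (b0 * R)) * m \<le> k y * F y" using m True c0 k_nonneg by (intro mult_mono) auto
        then show ?thesis using True by simp
      qed (simp add: F k_nonneg)
    qed
  qed (simp add: F k_nonneg)
  finally show ?thesis .
qed

lemma measure_ball_pos: "r > 0 \<Longrightarrow> measure lborel (ball (z::'a) r) > 0"
  using content_ball_pos[of r z] by simp

text \<open>The potential is bounded below only outside the unit ball, so the region |x - y| < 1
  must be discarded. What is left has a lower bound uniform in x.\<close>

lemma k_exp_outside_unit_ball:
  obtains c where "c > 0" "\<And>x. c \<le> (\<integral>y. k y * (if norm (x - y) \<ge> 1 then exp (- (b0 * norm y)) else 0) \<partial>lborel)"
proof -
  define c where "c = c0 * exp (- (b0 * 3)) * exp (- (b0 * 3)) * measure lborel (ball (0::'a) 1)"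
  show ?thesis
  proof (rule that[of c])
    show "c > 0" unfolding c_def using c0 measure_ball_pos[of 1 0] by simp
    fix x :: 'a
    obtain b :: 'a where b: "b \<in> Basis" using nonempty_Basis by blast
    \<comment> \<open>A vector of length 2 pointing away from x: its unit ball lies at distance at
      least 1 from x and within the ball of radius 3.\<close>
    define z where "z = (if x = 0 then 2 *\<^sub>R b else - (2 / norm x) *\<^sub>R x)"
    have z: "norm z = 2" using b by (auto simp: z_def norm_Basis)
    have "norm (x - z) \<ge> 2"
    proof (cases "x = 0")
      case False
      then have "x - z = (1 + 2 / norm x) *\<^sub>R x" by (simp add: z_def algebra_simps)
      then have "norm (x - z) = (1 + 2 / norm x) * norm x" using False by (simp add: add_pos_nonneg)
      also have "\<dots> = norm x + 2" using False by (simp add: field_simps)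
      finally show ?thesis by simp
    qed (use z in auto)
    then have far: "norm (x - y) \<ge> 1" if "y \<in> ball z 1" for y
      using that norm_triangle_ineq[of "x - y" "y - z"] by (simp add: dist_norm norm_minus_commute)
    have near: "norm y \<le> 3" if "y \<in> ball z 1" for y
      using that z norm_triangle_ineq[of z "y - z"] by (simp add: dist_norm norm_minus_commute)
    have "c = c0 * exp (- (b0 * 3)) * exp (- (b0 * 3)) * measure lborel (ball z 1)"
      by (simp add: c_def content_ball)
    also have "\<dots> \<le> (\<integral>y. k y * (if norm (x - y) \<ge> 1 then exp (- (b0 * norm y)) else 0) \<partial>lborel)"
    proof (rule k_integral_ball_lower)
      show "integrable lborel (\<lambda>y. k y * (if norm (x - y) \<ge> 1 then exp (- (b0 * norm y)) else 0))"
        using b0 k_nonneg by (intro Bochner_Integration.integrable_bound[OF k_integrable]) (auto simp: abs_mult mult_left_le)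
      show "exp (- (b0 * 3)) \<le> (if norm (x - y) \<ge> 1 then exp (- (b0 * norm y)) else 0)" if "y \<in> ball z 1" for y
        using far[OF that] near[OF that] b0 by (simp add: mult_left_mono)
    qed (use near in auto)
    finally show "c \<le> (\<integral>y. k y * (if norm (x - y) \<ge> 1 then exp (- (b0 * norm y)) else 0) \<partial>lborel)" .
  qed
qed

lemma Phi_ge:
  assumes f: "adm a f" and st: "0 \<le> s" "s \<le> t" and I: "(h has_integral I) {s..t}"
    and le: "\<And>\<tau>. \<tau> \<in> {s..t} \<Longrightarrow> h \<tau> \<le> K (\<lambda>y. Nl f y \<tau>) x"
  shows "I \<le> \<Phi> f x t"
proof -
  have "I \<le> integral {s..t} (\<lambda>\<tau>. K (\<lambda>y. Nl f y \<tau>) x)"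
    by (rule has_integral_le[OF I integrable_integral[OF K_Nl_integrable[OF f st(1)]] le])
  also have "\<dots> \<le> \<Phi> f x t" unfolding Phi_split[OF f st] using adm_nonneg[OF adm_Phi[OF f] st(1)] by simp
  finally show ?thesis .
qed

text \<open>One lower-bound step: the spatial profile \<open>g\<close> becomes \<open>h\<close>, the
  time profile stays, and the constant \<open>D\<close> becomes
  \<open>c * \<theta>lo * (1 - p) * D powr p\<close>. Only the reaction outside the unit ball is
  used. The instances differ in \<open>g\<close>, \<open>h\<close> and \<open>c\<close>.\<close>

lemma Phi_lower_bootstrap:
  assumes f: "adm a f" and s: "0 \<le> s" and D: "D \<ge> 0" and g: "\<And>x. g x \<ge> 0" and c: "c \<ge> 0"
    and low: "\<And>x t. t \<in> {s..T} \<Longrightarrow> D * (L t - L s) powr q * g x \<le> f x t"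
    and gh: "\<And>x. c * h x \<le> (\<integral>y. k y * (if norm (x - y) \<ge> 1 then pw (norm (x - y)) \<sigma> * g (x - y) powr p else 0) \<partial>lborel)"
    and t: "t \<in> {s..T}"
  shows "c * \<theta>lo * (1 - p) * D powr p * (L t - L s) powr q * h x \<le> \<Phi> f x t"
proof -
  let ?J = "\<lambda>y. if norm (x - y) \<ge> 1 then pw (norm (x - y)) \<sigma> * g (x - y) powr p else 0"
  let ?c = "\<theta>lo * D powr p * (c * h x)"
  have "?c * ((1 - p) * (L t - L s) powr q) \<le> \<Phi> f x t"
  proof (rule Phi_ge[OF f s _ has_integral_mult_right[OF has_integral_lam_powr[OF s]]])
    show "s \<le> t" "s \<le> t" using t by auto
    fix \<tau> assume \<tau>: "\<tau> \<in> {s..t}"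
    then have \<tau>0: "\<tau> \<ge> 0" and \<tau>T: "\<tau> \<in> {s..T}" using s t by auto
    let ?X = "L \<tau> - L s"
    have X: "?X \<ge> 0" using L_mono[OF s] \<tau> by simp
    let ?d = "\<theta>lo * lam \<tau> * D powr p * ?X powr (q * p)"
    have d0: "?d \<ge> 0" using theta lam_pos[OF \<tau>0] by simp
    have nl: "?d * ?J y \<le> Nl f (x - y) \<tau>" for y
    proof (cases "norm (x - y) \<ge> 1")
      case True
      have "(D * ?X powr q * g (x - y)) powr p \<le> f (x - y) \<tau> powr p"
        using low[OF \<tau>T] D g p by (intro powr_mono2) auto
      then have fp: "D powr p * ?X powr (q * p) * g (x - y) powr p \<le> f (x - y) \<tau> powr p"
        using D g by (simp add: powr_mult powr_powr)
      have Wl: "\<theta>lo * lam \<tau> * pw (norm (x - y)) \<sigma> \<le> exp ((1 - p) * \<tau>) * W (x - y) \<tau>"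
        using mult_left_mono[OF W_lower[OF True \<tau>0], of "exp ((1 - p) * \<tau>)"] by (simp add: lam_def mult_ac)
      have "?d * ?J y = (\<theta>lo * lam \<tau> * pw (norm (x - y)) \<sigma>) * (D powr p * ?X powr (q * p) * g (x - y) powr p)"
        using True by (simp add: mult_ac)
      also have "\<dots> \<le> (exp ((1 - p) * \<tau>) * W (x - y) \<tau>) * f (x - y) \<tau> powr p"
        by (rule mult_mono[OF Wl fp]) (use W_nonneg[OF \<tau>0] in auto)
      also have "\<dots> \<le> Nl f (x - y) \<tau>" using adm_nonneg[OF f \<tau>0] by (simp add: Nl_def mult.assoc)
      finally show ?thesis .
    next
      case False
      then show ?thesis using adm_nonneg[OF adm_Nl[OF f] \<tau>0] by simp
    qed
    have "?c * (lam \<tau> * ?X powr (q * p)) = ?d * (c * h x)" by (simp add: mult_ac)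
    also have "\<dots> \<le> ?d * (\<integral>y. k y * ?J y \<partial>lborel)" by (intro mult_left_mono gh d0)
    also have "\<dots> = (\<integral>y. ?d * (k y * ?J y) \<partial>lborel)" by simp
    also have "\<dots> \<le> K (\<lambda>y. Nl f y \<tau>) x"
      unfolding K_def
    proof (rule integral_mono'[OF K_integrable[OF adm_Nl[OF f] a_nonneg \<tau>0]])
      show "?d * (k y * ?J y) \<le> k y * Nl f (x - y) \<tau>" for y
        using mult_left_mono[OF nl[of y] k_nonneg[of y]] by (simp add: mult_ac)
      show "0 \<le> k y * Nl f (x - y) \<tau>" for y
        by (intro mult_nonneg_nonneg k_nonneg Nl_nonneg adm_nonneg[OF f] \<tau>0)
    qed
    finally show "?c * (lam \<tau> * ?X powr (q * p)) \<le> K (\<lambda>y. Nl f y \<tau>) x" .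
  qed
  then show ?thesis by (simp add: mult_ac)
qed

text \<open>Explicit solution: the ratio of D to the fixed point \<open>\<kappa> powr q\<close> is
  raised to the power \<open>p\<close> at each step, so it tends to 1 from any positive
  start.\<close>

lemma sublinear_iteration:
  assumes "\<kappa> > 0" "D0 > 0"
  obtains D where "D 0 = D0" "\<And>n. D n > 0" "\<And>n. D (Suc n) = \<kappa> * D n powr p" "D \<longlonglongrightarrow> \<kappa> powr q"
proof -
  define r where "r = D0 / \<kappa> powr q"
  have r: "r > 0" using assms by (simp add: r_def)
  define D where "D n = \<kappa> powr q * r powr (p ^ n)" for n
  show ?thesis
  proof (rule that[of D])
    show "D 0 = D0" using assms r by (simp add: D_def r_def)
    show "D n > 0" for n using assms r by (simp add: D_def)
    show "D (Suc n) = \<kappa> * D n powr p" for n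
    proof -
      have "\<kappa> * D n powr p = (\<kappa> powr 1 * \<kappa> powr (q * p)) * r powr (p ^ Suc n)"
        using assms r by (simp add: D_def powr_mult powr_powr mult_ac)
      also have "\<kappa> powr 1 * \<kappa> powr (q * p) = \<kappa> powr q" unfolding powr_add[symmetric] q(3) by simp
      finally show ?thesis by (simp add: D_def)
    qed
    have "(\<lambda>n. \<kappa> powr q * r powr (p ^ n)) \<longlonglongrightarrow> \<kappa> powr q * r powr 0"
      using p r by (intro tendsto_intros LIMSEQ_power_zero) auto
    then show "D \<longlonglongrightarrow> \<kappa> powr q" using r by (simp add: D_def[abs_def])
  qed
qed

text \<open>Positivity at one point extends to a ball by continuity and to later times by
  monotonicity. The linear term then spreads it over all of space with the decay of the
  kernel.\<close>

lemma initial_exp_lower_bound: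
  assumes f: "adm a f" and ffix: "\<And>x t. t \<ge> 0 \<Longrightarrow> f x t = \<Phi> f x t"
    and \<tau>0: "0 < \<tau>0" "\<tau>0 < s" "f x0 \<tau>0 > 0"
  obtains c where "c > 0" "\<And>x t. t \<ge> s \<Longrightarrow> c * exp (- (b0 * norm x)) \<le> f x t"
proof -
  define \<eta> where "\<eta> = f x0 \<tau>0 / 2"
  have \<eta>: "\<eta> > 0" using \<tau>0 by (simp add: \<eta>_def)
  have "isCont (\<lambda>y. f y \<tau>0) x0"
    using adm_continuous_space[OF f, of \<tau>0] \<tau>0 by (simp add: continuous_on_eq_continuous_at)
  then obtain r where r: "r > 0" "\<And>y. dist y x0 < r \<Longrightarrow> dist (f y \<tau>0) (f x0 \<tau>0) < \<eta>"
    using \<eta> unfolding continuous_at_eps_delta by blast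
  have f\<eta>: "\<eta> \<le> f y \<tau>" if "dist y x0 < r" "\<tau> \<ge> \<tau>0" for y \<tau>
  proof -
    have "\<bar>f y \<tau>0 - f x0 \<tau>0\<bar> < \<eta>" using r(2)[OF that(1)] by (simp add: dist_real_def)
    then have "\<eta> \<le> f y \<tau>0" unfolding \<eta>_def by linarith
    also have "f y \<tau>0 \<le> f y \<tau>" using Phi_mono_time[OF f, of \<tau>0 \<tau> y] ffix that \<tau>0 by simp
    finally show ?thesis .
  qed
  define c1 where "c1 = c0 * exp (- (b0 * (norm x0 + r))) * \<eta> * measure lborel (ball (0::'a) r)"
  have c1: "c1 > 0" unfolding c1_def using c0 \<eta> measure_ball_pos[OF r(1)] by simp
  show ?thesis
  proof (rule that[of "(s - \<tau>0) * c1"])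
    show "(s - \<tau>0) * c1 > 0" using c1 \<tau>0 by simp
    fix x :: 'a and t assume t: "t \<ge> s"
    let ?e = "exp (- (b0 * norm x))"
    have "(t - \<tau>0) * (c1 * ?e) \<le> \<Phi> f x t"
    proof (rule Phi_ge[OF f, where s = \<tau>0 and h = "\<lambda>_. c1 * ?e"])
      show "((\<lambda>_. c1 * ?e) has_integral (t - \<tau>0) * (c1 * ?e)) {\<tau>0..t}"
        using has_integral_const_real[of "c1 * ?e" \<tau>0 t] t \<tau>0 by simp
      fix \<tau> assume \<tau>: "\<tau> \<in> {\<tau>0..t}"
      then have \<tau>': "\<tau> \<ge> 0" using \<tau>0 by simp
      \<comment> \<open>For y in this ball x - y is within r of \<open>x0\<close>, and |y| \<le> |x|
        + |x0| + r.\<close>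
      have "c0 * exp (- (b0 * (norm x + norm x0 + r))) * \<eta> * measure lborel (ball (x - x0) r) \<le> (\<integral>y. k y * Nl f (x - y) \<tau> \<partial>lborel)"
      proof (rule k_integral_ball_lower[OF K_integrable[OF adm_Nl[OF f] a_nonneg \<tau>']])
        fix y assume y: "y \<in> ball (x - x0) r"
        have "dist (x - y) x0 < r" using y by (simp add: dist_norm algebra_simps)
        then have "\<eta> \<le> f (x - y) \<tau>" using \<tau> by (intro f\<eta>) auto
        also have "\<dots> \<le> Nl f (x - y) \<tau>" using W_nonneg[OF \<tau>'] by (simp add: Nl_def)
        finally show "\<eta> \<le> Nl f (x - y) \<tau>" .
        have "norm y \<le> norm (x - x0) + norm (y - (x - x0))" by (metis add.commute diff_add_cancel norm_triangle_ineq)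
        then show "norm y \<le> norm x + norm x0 + r"
          using y norm_triangle_ineq4[of x x0] by (simp add: dist_norm norm_minus_commute)
      qed (use \<eta> adm_nonneg[OF adm_Nl[OF f] \<tau>'] in auto)
      moreover have "c0 * exp (- (b0 * (norm x + norm x0 + r))) * \<eta> * measure lborel (ball (x - x0) r) = c1 * ?e"
        using r(1) by (simp add: c1_def content_ball algebra_simps flip: exp_add)
      ultimately show "c1 * ?e \<le> K (\<lambda>y. Nl f y \<tau>) x" by (simp add: K_def)
    qed (use \<tau>0 t in auto)
    also have "\<Phi> f x t = f x t" using ffix t \<tau>0 by simp
    finally have "(t - \<tau>0) * (c1 * ?e) \<le> f x t" .
    moreover have "(s - \<tau>0) * (c1 * ?e) \<le> (t - \<tau>0) * (c1 * ?e)" using t c1 by (intro mult_right_mono) auto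
    ultimately show "(s - \<tau>0) * c1 * ?e \<le> f x t" by (simp add: mult.assoc)
  qed
qed

text \<open>Each step of the bootstrap multiplies the exponential decay rate by \<open>p < 1\<close>; the limit is a constant.\<close>

lemma constant_lower_bound:
  assumes f: "adm a f" and ffix: "\<And>x t. t \<ge> 0 \<Longrightarrow> f x t = \<Phi> f x t"
    and \<tau>0: "0 < \<tau>0" "\<tau>0 < s" "f x0 \<tau>0 > 0"
  obtains B where "B > 0" "\<And>x t. t \<ge> s \<Longrightarrow> B * (L t - L s) powr q \<le> f x t"
proof -
  have s: "s > 0" using \<tau>0 by simp
  obtain c1 where c1: "c1 > 0" "\<And>x t. t \<ge> s \<Longrightarrow> c1 * exp (- (b0 * norm x)) \<le> f x t"
    using initial_exp_lower_bound[OF f ffix \<tau>0] by blast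
  obtain c where c: "c > 0" "\<And>x. c \<le> (\<integral>y. k y * (if norm (x - y) \<ge> 1 then exp (- (b0 * norm y)) else 0) \<partial>lborel)"
    using k_exp_outside_unit_ball by blast
  define \<kappa> where "\<kappa> = c * \<theta>lo * (1 - p)"
  have \<kappa>: "\<kappa> > 0" using c theta p by (simp add: \<kappa>_def)
  show ?thesis
  proof (rule that[of "\<kappa> powr q"])
    show "\<kappa> powr q > 0" using \<kappa> by simp
    fix x :: 'a and t assume t: "t \<ge> s"
    \<comment> \<open>Leaves room beyond s even when \<open>t = s\<close>, so that
      \<open>L T - L s\<close> is positive.\<close>
    define T where "T = t + 1"
    have LT: "L T - L s > 0" using L_strict_mono[of s T] s t by (simp add: T_def)
    \<comment> \<open>The largest constant for which \<open>D0 * (L t - L s) powr q\<close> stays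
      below \<open>c1\<close> on [s, T]. It depends on T, but the limit
      \<open>\<kappa> powr q\<close> does not, so \<open>B\<close> serves all times.\<close>
    define D0 where "D0 = c1 / (L T - L s) powr q"
    have D0: "D0 > 0" using c1 LT by (simp add: D0_def)
    obtain D where D: "D 0 = D0" "\<And>n. D n > 0" "\<And>n. D (Suc n) = \<kappa> * D n powr p" "D \<longlonglongrightarrow> \<kappa> powr q"
      using sublinear_iteration[OF \<kappa> D0] by blast
    have it: "D n * (L t - L s) powr q * exp (- (b0 * p ^ n * norm x)) \<le> f x t" if "t \<in> {s..T}" for n x t
      using that
    proof (induction n arbitrary: x t)
      case 0
      have "(L t - L s) powr q \<le> (L T - L s) powr q"
        using 0 s q(1) L_mono[of s t] L_mono[of t T] by (intro powr_mono2) auto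
      then have "D0 * (L t - L s) powr q \<le> c1" using c1 LT by (simp add: D0_def divide_le_eq)
      then have "D0 * (L t - L s) powr q * exp (- (b0 * norm x)) \<le> c1 * exp (- (b0 * norm x))" by (rule mult_right_mono) simp
      also have "\<dots> \<le> f x t" using c1(2) 0 by simp
      finally show ?case using D by simp
    next
      case (Suc n)
      have "c * \<theta>lo * (1 - p) * D n powr p * (L t - L s) powr q * exp (- (b0 * p ^ Suc n * norm x)) \<le> \<Phi> f x t"
      proof (rule Phi_lower_bootstrap[OF f _ _ _ _ Suc.IH _ Suc.prems])
        fix x :: 'a
        let ?b = "b0 * p ^ Suc n"
        have "p ^ Suc n \<le> 1" using p by (intro power_le_one) auto
        then have b: "0 \<le> ?b" "?b \<le> b0" using b0 p by (auto intro: mult_left_le)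
        let ?g = "\<lambda>y. if norm (x - y) \<ge> 1 then pw (norm (x - y)) \<sigma> * exp (- (b0 * p ^ n * norm (x - y))) powr p else 0"
        let ?h = "\<lambda>y. if norm (x - y) \<ge> 1 then exp (- (b0 * norm y)) else 0"
        \<comment> \<open>The power \<open>p\<close> turns the rate \<open>b0 * p ^ n\<close> into
          \<open>?b\<close>. Since \<open>?b \<le> b0\<close>, the triangle inequality leaves the
          factor e^(-b0 |y|), free of n, and the same \<open>c\<close> serves every step.\<close>
        have gh: "exp (- (?b * norm x)) * ?h y \<le> ?g y" for y
        proof (cases "norm (x - y) \<ge> 1")
          case True
          have "?b * norm (x - y) \<le> ?b * norm x + b0 * norm y"
            using mult_left_mono[OF norm_triangle_ineq4[of x y] b(1)] mult_right_mono[OF b(2), of "norm y"]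
            unfolding distrib_left by simp
          then have "exp (- (?b * norm x)) * exp (- (b0 * norm y)) \<le> exp (- (?b * norm (x - y)))"
            by (simp flip: exp_add)
          also have "\<dots> = 1 * exp (- (b0 * p ^ n * norm (x - y))) powr p" by (simp add: exp_powr_real mult_ac)
          also have "\<dots> \<le> pw (norm (x - y)) \<sigma> * exp (- (b0 * p ^ n * norm (x - y))) powr p"
            using pw_ge_one[OF True sigma] by (intro mult_right_mono) auto
          finally show ?thesis using True by simp
        qed simp
        have "integrable lborel (\<lambda>y. k y * ?g y)"
        proof -
          have "integrable lborel (\<lambda>y. k y * (1 + norm (x - y)) powr \<sigma>)"
            using sigma by (intro K_integrable_powr[of "\<lambda>y. (1 + norm y) powr \<sigma>" 1 \<sigma>]) auto
          then show ?thesis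
          proof (rule Bochner_Integration.integrable_bound)
            have [measurable]: "(\<lambda>y. pw (norm (x - y)) \<sigma>) \<in> borel_measurable borel"
              unfolding pw_def by measurable
            show "(\<lambda>y. k y * ?g y) \<in> borel_measurable lborel" by measurable
            have "norm (k y * ?g y) \<le> norm (k y * (1 + norm (x - y)) powr \<sigma>)" for y
            proof -
              have "exp (- (b0 * p ^ n * norm (x - y))) powr p \<le> 1"
                using b0 p by (simp add: exp_powr_real)
              then have "pw (norm (x - y)) \<sigma> * exp (- (b0 * p ^ n * norm (x - y))) powr p \<le> (1 + norm (x - y)) powr \<sigma> * 1"
                using pw_le_powr[OF norm_ge_zero sigma, of "x - y"] by (intro mult_mono) auto
              then have "?g y \<le> (1 + norm (x - y)) powr \<sigma>" by simp
              moreover have "0 \<le> ?g y" by (simp add: pw_nonneg)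
              ultimately show ?thesis
                using mult_left_mono[OF _ k_nonneg[of y]] k_nonneg[of y] unfolding real_norm_def abs_mult by simp
            qed
            then show "AE y in lborel. norm (k y * ?g y) \<le> norm (k y * (1 + norm (x - y)) powr \<sigma>)"
              by (rule AE_I2)
          qed
        qed
        then have "(\<integral>y. exp (- (?b * norm x)) * (k y * ?h y) \<partial>lborel) \<le> (\<integral>y. k y * ?g y \<partial>lborel)"
          using mult_left_mono[OF gh k_nonneg]
          by (intro integral_mono') (auto simp: k_nonneg pw_nonneg mult_ac)
        moreover have "c * exp (- (?b * norm x)) \<le> (\<integral>y. exp (- (?b * norm x)) * (k y * ?h y) \<partial>lborel)"
          using mult_left_mono[OF c(2)[of x], of "exp (- (?b * norm x))"] by (simp add: mult.commute)
        ultimately show "c * exp (- (?b * norm x)) \<le> (\<integral>y. k y * ?g y \<partial>lborel)" by linarith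
      qed (use s D(2)[of n] c in \<open>auto simp: less_imp_le\<close>)
      then show ?case using ffix[of t x] Suc.prems s by (simp add: D \<kappa>_def)
    qed
    have "(\<lambda>n. D n * (L t - L s) powr q * exp (- (b0 * p ^ n * norm x))) \<longlonglongrightarrow> \<kappa> powr q * (L t - L s) powr q * exp (- (b0 * 0 * norm x))"
      using p by (intro tendsto_intros D LIMSEQ_power_zero) auto
    then show "\<kappa> powr q * (L t - L s) powr q \<le> f x t"
      using it[of t _ x] t by (intro LIMSEQ_le_const2) (auto simp: T_def)
  qed
qed

text \<open>Starting from the constant bound, each step replaces the exponent e by \<sigma> + p e
  and the constant by \<open>\<kappa> * D powr p\<close>; both converge. The final constant involves
  neither \<open>f\<close> nor the starting point, so \<open>s\<close> can later tend to 0.\<close>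

lemma power_lower_bound:
  assumes f: "adm a f" and ffix: "\<And>x t. t \<ge> 0 \<Longrightarrow> f x t = \<Phi> f x t"
    and \<tau>0: "0 < \<tau>0" "\<tau>0 < s" "f x0 \<tau>0 > 0" and t: "t \<ge> s"
  shows "((1 - p) * \<epsilon> * \<theta>lo) powr q * (L t - L s) powr q * pw (norm x) (\<sigma> * q) \<le> f x t"
\<comment> \<open>At the origin with \<sigma> > 0 the claimed bound is 0. Otherwise either the
  exponents are all 0 or the base is positive, so the limit in the exponent is
  unproblematic.\<close>
proof (cases "x = 0 \<and> \<sigma> \<noteq> 0")
  case True
  then show ?thesis using adm_nonneg[OF f, of t x] t \<tau>0 q(1) by (simp add: pw_def)
next
  case nz: False
  have s: "s > 0" using \<tau>0 by simp
  obtain B where B: "B > 0" "\<And>x t. t \<ge> s \<Longrightarrow> B * (L t - L s) powr q \<le> f x t"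
    using constant_lower_bound[OF f ffix \<tau>0] by blast
  define \<kappa> where "\<kappa> = \<epsilon> * \<theta>lo * (1 - p)"
  have \<kappa>: "\<kappa> > 0" using eps theta p by (simp add: \<kappa>_def)
  obtain D where D: "D 0 = B" "\<And>n. D n > 0" "\<And>n. D (Suc n) = \<kappa> * D n powr p" "D \<longlonglongrightarrow> \<kappa> powr q"
    using sublinear_iteration[OF \<kappa> B(1)] by blast
  \<comment> \<open>Closed form of e(n+1) = \<sigma> + p e(n), e(0) = 0. Every p e(n) stays in the
    range in which \<open>eps_prop\<close> holds.\<close>
  define e where "e n = \<sigma> * q * (1 - p ^ n)" for n
  have e_Suc: "e (Suc n) = \<sigma> + e n * p" for n
  proof -
    have "\<sigma> + e n * p = \<sigma> + \<sigma> * (q * p) * (1 - p ^ n)" by (simp add: e_def)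
    also have "\<dots> = \<sigma> * q - \<sigma> * (q - 1) * p ^ n" unfolding q(3) by (simp add: algebra_simps)
    also have "\<dots> = e (Suc n)" unfolding q(3)[symmetric] by (simp add: e_def algebra_simps)
    finally show ?thesis ..
  qed
  have e: "0 \<le> e n" "e n \<le> \<sigma> * q" for n
    using sigma q(1) p by (auto simp: e_def power_le_one intro!: mult_nonneg_nonneg mult_left_le)
  have it: "D n * (L t - L s) powr q * pw (norm x) (e n) \<le> f x t" if "t \<in> {s..t + 1}" for n x t
    using that
  proof (induction n arbitrary: x t)
    case 0
    then show ?case using B(2) D by (simp add: e_def pw_def)
  next
    case (Suc n)
    have "\<epsilon> * \<theta>lo * (1 - p) * D n powr p * (L t - L s) powr q * pw (norm x) (e (Suc n)) \<le> \<Phi> f x t"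
    proof (rule Phi_lower_bootstrap[OF f, where T = t and g = "\<lambda>x. pw (norm x) (e n)"])
      show "D n * (L t' - L s) powr q * pw (norm x) (e n) \<le> f x t'" if "t' \<in> {s..t}" for x t'
        using that by (intro Suc.IH) auto
      fix x :: 'a
      have "e n * p \<in> {0..\<sigma> * p / (1 - p)}"
        using e[of n] p mult_right_mono[OF e(2)[of n], of p] by (auto simp: q_def)
      have eq: "pw r \<sigma> * pw r (e n) powr p = pw r (\<sigma> + e n * p)" for r
        using p(1) e(1)[of n] sigma by (simp add: pw_powr pw_add)
      from eps_prop[OF \<open>e n * p \<in> _\<close>, of x]
      show "\<epsilon> * pw (norm x) (e (Suc n))
        \<le> (\<integral>y. k y * (if norm (x - y) \<ge> 1 then pw (norm (x - y)) \<sigma> * pw (norm (x - y)) (e n) powr p else 0) \<partial>lborel)"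
        unfolding e_Suc eq .
    qed (use s D(2)[of n] eps Suc.prems in \<open>auto simp: less_imp_le pw_nonneg\<close>)
    then show ?case using ffix[of t x] Suc.prems s by (simp add: D \<kappa>_def)
  qed
  have "(\<lambda>n. \<sigma> * q * (1 - p ^ n)) \<longlonglongrightarrow> \<sigma> * q * (1 - 0)"
    using p by (intro tendsto_intros LIMSEQ_power_zero) auto
  then have el: "e \<longlonglongrightarrow> \<sigma> * q" by (simp add: e_def[abs_def])
  have "(\<lambda>n. pw (norm x) (e n)) \<longlonglongrightarrow> pw (norm x) (\<sigma> * q)"
  proof (cases "\<sigma> = 0")
    case True
    then show ?thesis by (simp add: e_def)
  next
    case False
    then have x: "norm x > 0" using nz by simp
    then have "pw (norm x) d = norm x powr d" for d by (simp add: pw_def)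
    then show ?thesis using x el by (simp add: tendsto_powr)
  qed
  then have "(\<lambda>n. D n * (L t - L s) powr q * pw (norm x) (e n)) \<longlonglongrightarrow> \<kappa> powr q * (L t - L s) powr q * pw (norm x) (\<sigma> * q)"
    by (intro tendsto_mult D tendsto_const)
  then have "\<kappa> powr q * (L t - L s) powr q * pw (norm x) (\<sigma> * q) \<le> f x t"
    using it[of t _ x] t by (intro LIMSEQ_le_const2) auto
  then show ?thesis by (simp add: \<kappa>_def mult_ac)
qed

lemma phi_eq: "t \<ge> 0 \<Longrightarrow> \<phi> x t = ((1 - p) * \<epsilon> * \<theta>lo) powr q * L t powr q * pw (norm x) (\<sigma> * q)"
  unfolding \<phi>_def using p eps theta q(1) L_nonneg[of t] pw_nonneg[of "norm x" \<sigma>]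
  by (simp add: powr_mult pw_powr)

text \<open>Positivity at arbitrarily small times lets \<open>power_lower_bound\<close> be applied
  with starting times \<open>s n\<close> tending to 0, and \<open>L (s n)\<close> then tends to
  \<open>L 0 = 0\<close>.\<close>

lemma fixed_point_lower_bound:
  assumes f: "adm a f" and ffix: "\<And>x t. t \<ge> 0 \<Longrightarrow> f x t = \<Phi> f x t"
    and pos: "\<And>t. t > 0 \<Longrightarrow> \<exists>x \<tau>. 0 < \<tau> \<and> \<tau> < t \<and> f x \<tau> > 0" and t: "t \<ge> 0"
  shows "\<phi> x t \<le> f x t"
proof (cases "t = 0")
  case True
  then show ?thesis using adm_nonneg[OF f t, of x] by (simp add: \<phi>_def)
next
  case False
  define s where "s n = t / real (Suc n)" for n
  have s: "0 < s n" "s n \<le> t" for n using False t by (auto simp: s_def field_simps)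
  have le: "((1 - p) * \<epsilon> * \<theta>lo) powr q * (L t - L (s n)) powr q * pw (norm x) (\<sigma> * q) \<le> f x t" for n
  proof -
    obtain x0 \<tau> where h: "0 < \<tau>" "\<tau> < s n" "f x0 \<tau> > 0" using pos[OF s(1)[of n]] by blast
    show ?thesis by (rule power_lower_bound[OF f ffix h s(2)])
  qed
  have "s \<longlonglongrightarrow> 0" unfolding s_def using tendsto_mult[OF tendsto_const[of t] LIMSEQ_inverse_real_of_nat] by (simp add: divide_inverse)
  then have "(L \<circ> s) \<longlonglongrightarrow> L 0"
    using L_cont less_imp_le[OF s(1)] unfolding continuous_on_sequentially by (simp del: L_0)
  then have "(\<lambda>n. L (s n)) \<longlonglongrightarrow> 0" by (simp add: o_def)
  moreover have "L t > 0" using L_pos False t by simp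
  ultimately have "(\<lambda>n. ((1 - p) * \<epsilon> * \<theta>lo) powr q * (L t - L (s n)) powr q * pw (norm x) (\<sigma> * q))
    \<longlonglongrightarrow> ((1 - p) * \<epsilon> * \<theta>lo) powr q * (L t - 0) powr q * pw (norm x) (\<sigma> * q)"
    by (intro tendsto_intros) auto
  then show ?thesis unfolding phi_eq[OF t]
    using le by (intro LIMSEQ_le_const2) auto
qed

subsection \<open>Existence of a nontrivial fixed point\<close>

lemma pw_sigma_q_le: "pw (norm (x::'a)) (\<sigma> * q) \<le> (1 + norm x) powr a"
proof -
  have "pw (norm x) (\<sigma> * q) \<le> (1 + norm x) powr (\<sigma> * q)" using sigma q(1) by (intro pw_le_powr) auto
  also have "\<dots> \<le> (1 + norm x) powr a" using a by (intro powr_mono) (auto simp: q_def)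
  finally show ?thesis .
qed

lemma adm_phi: "adm a \<phi>"
  unfolding adm_def
proof (intro conjI allI impI)
  show "0 \<le> \<phi> x t" for x t by (simp add: \<phi>_def)
  have "continuous_on (UNIV \<times> {0..}) (\<lambda>z. ((1 - p) * \<epsilon> * \<theta>lo * L (snd z) * pw (norm (fst z :: 'a)) \<sigma>) powr q)"
  proof (intro continuous_on_powr' continuous_on_mult continuous_on_const continuous_on_pw_norm sigma ballI conjI impI)
    show "continuous_on (UNIV \<times> {0..}) (\<lambda>z. L (snd (z :: 'a \<times> real)))"
      by (rule continuous_on_compose2[OF L_cont]) (auto intro!: continuous_intros)
    show "continuous_on (UNIV \<times> {0..}) (fst :: 'a \<times> real \<Rightarrow> 'a)" by (intro continuous_intros)
    show "0 \<le> (1 - p) * \<epsilon> * \<theta>lo * L (snd z) * pw (norm (fst z)) \<sigma>" if "z \<in> UNIV \<times> {0..}" for z :: "'a \<times> real"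
      using that p eps theta L_nonneg[of "snd z"] pw_nonneg by (auto intro!: mult_nonneg_nonneg)
  qed (use q in auto)
  then show "continuous_on (UNIV \<times> {0..}) (\<lambda>(x, t). \<phi> x t)" by (simp add: \<phi>_def case_prod_beta')
  fix T
  show "\<exists>C. \<forall>x. \<forall>t\<in>{0..T}. \<phi> x t \<le> C * (1 + norm x) powr a"
  proof (intro exI[of _ "((1 - p) * \<epsilon> * \<theta>lo) powr q * L T powr q"] allI ballI)
    fix x :: 'a and t assume t: "t \<in> {0..T}"
    have "\<phi> x t = ((1 - p) * \<epsilon> * \<theta>lo) powr q * L t powr q * pw (norm x) (\<sigma> * q)" using t by (intro phi_eq) auto
    also have "\<dots> \<le> ((1 - p) * \<epsilon> * \<theta>lo) powr q * L T powr q * (1 + norm x) powr a"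
      using t by (intro mult_mono mult_left_mono pw_sigma_q_le powr_mono2 L_mono L_nonneg) (use q in \<open>auto simp: pw_nonneg\<close>)
    finally show "\<phi> x t \<le> ((1 - p) * \<epsilon> * \<theta>lo) powr q * L T powr q * (1 + norm x) powr a" .
  qed
qed

text \<open>\<open>\<phi>\<close> reproduces itself under one bootstrap step with
  \<open>s = 0\<close>. Its spatial exponent needs \<open>eps_prop\<close> at the right endpoint d =
  \<sigma>p/(1-p).\<close>

lemma phi_le_Phi:
  assumes "t \<ge> 0"
  shows "\<phi> x t \<le> \<Phi> \<phi> x t"
proof -
  let ?E = "(1 - p) * \<epsilon> * \<theta>lo"
  have E: "?E > 0" using p eps theta by simp
  have "\<epsilon> * \<theta>lo * (1 - p) * (?E powr q) powr p * (L t - L 0) powr q * pw (norm x) (\<sigma> * q) \<le> \<Phi> \<phi> x t"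
  proof (rule Phi_lower_bootstrap[OF adm_phi, where T = t and g = "\<lambda>x. pw (norm x) (\<sigma> * q)"])
    show "?E powr q * (L t' - L 0) powr q * pw (norm x) (\<sigma> * q) \<le> \<phi> x t'" if "t' \<in> {0..t}" for x t'
      using that by (simp add: phi_eq)
    fix x :: 'a
    have "\<sigma> * (q - 1) = \<sigma> * p / (1 - p)" unfolding q(3)[symmetric] by (simp add: q_def)
    moreover have "0 \<le> \<sigma> * (q - 1)" using sigma q(1) by simp
    ultimately have mem: "\<sigma> * (q - 1) \<in> {0..\<sigma> * p / (1 - p)}" by simp
    have 1: "pw r \<sigma> * pw r (\<sigma> * q) powr p = pw r (\<sigma> + \<sigma> * (q - 1))" for r
      unfolding q(3)[symmetric] using p(1) q(1) sigma by (simp add: pw_powr pw_add mult.assoc)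
    have 2: "\<sigma> + \<sigma> * (q - 1) = \<sigma> * q" by (simp add: algebra_simps)
    show "\<epsilon> * pw (norm x) (\<sigma> * q)
        \<le> (\<integral>y. k y * (if norm (x - y) \<ge> 1 then pw (norm (x - y)) \<sigma> * pw (norm (x - y)) (\<sigma> * q) powr p else 0) \<partial>lborel)"
      using eps_prop[OF mem, of x] unfolding 1 2 .
  qed (use eps assms in \<open>auto simp: pw_nonneg\<close>)
  moreover have "\<epsilon> * \<theta>lo * (1 - p) * (?E powr q) powr p = ?E powr q"
  proof -
    have "?E * (?E powr q) powr p = ?E powr 1 * ?E powr (q * p)" using E by (simp add: powr_powr)
    also have "\<dots> = ?E powr q" unfolding powr_add[symmetric] q(3) by simp
    finally show ?thesis by (simp add: mult_ac)
  qed
  ultimately show ?thesis using assms by (simp add: phi_eq)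
qed

text \<open>A supersolution: \<open>exp (A a * t)\<close> pays for the linear term, the entry
  \<open>(A a * \<theta>up) powr q\<close> for the reaction, and the other entry of the maximum puts
  \<open>\<phi>\<close> below it.\<close>

definition Smaj :: "'a \<Rightarrow> real \<Rightarrow> real" where
  "Smaj x t = max (((1 - p) * \<epsilon> * \<theta>lo) powr q) ((A a * \<theta>up) powr q) * (L t powr q * exp (A a * t)) * (1 + norm x) powr a"

lemma adm_Smaj: "adm a Smaj"
  unfolding adm_def
proof (intro conjI allI impI)
  let ?D = "max (((1 - p) * \<epsilon> * \<theta>lo) powr q) ((A a * \<theta>up) powr q)"
  have D: "?D \<ge> 0" by (simp add: le_max_iff_disj)
  show "0 \<le> Smaj x t" for x t unfolding Smaj_def using D by (intro mult_nonneg_nonneg) auto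
  have "continuous_on (UNIV \<times> {0..}) (\<lambda>z. ?D * (L (snd z) powr q * exp (A a * snd z)) * (1 + norm (fst z :: 'a)) powr a)"
  proof (intro continuous_on_mult continuous_on_powr' continuous_on_const continuous_on_exp continuous_on_snd
      continuous_on_fst continuous_on_id continuous_on_add continuous_on_norm ballI conjI impI)
    show "continuous_on (UNIV \<times> {0..}) (\<lambda>z. L (snd (z :: 'a \<times> real)))"
      by (rule continuous_on_compose2[OF L_cont]) (auto intro!: continuous_intros)
    show "0 < a" if "1 + norm (fst z) = 0" for z :: "'a \<times> real"
      using that norm_ge_zero[of "fst z"] by linarith
  qed (use q(1) in \<open>auto simp: L_nonneg\<close>)
  then show "continuous_on (UNIV \<times> {0..}) (\<lambda>(x, t). Smaj x t)" by (simp add: Smaj_def case_prod_beta')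
  fix T
  show "\<exists>C. \<forall>x. \<forall>t\<in>{0..T}. Smaj x t \<le> C * (1 + norm x) powr a"
  proof (intro exI[of _ "?D * (L T powr q * exp (A a * T))"] allI ballI)
    fix x :: 'a and t assume t: "t \<in> {0..T}"
    have "A a * t \<le> A a * T" using A_ge_one[OF a_nonneg] t by (intro mult_left_mono) auto
    moreover have "L t powr q \<le> L T powr q" using L_mono[of t T] L_nonneg[of t] t q(1) by (intro powr_mono2) auto
    ultimately show "Smaj x t \<le> ?D * (L T powr q * exp (A a * T)) * (1 + norm x) powr a"
      unfolding Smaj_def by (intro mult_right_mono mult_left_mono mult_mono D) auto
  qed
qed

lemma phi_le_Smaj: "t \<ge> 0 \<Longrightarrow> \<phi> x t \<le> Smaj x t"
proof -
  assume t: "t \<ge> 0"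
  have "1 \<le> exp (A a * t)" using t A_ge_one[OF a_nonneg] by simp
  then have "L t powr q * 1 \<le> L t powr q * exp (A a * t)" by (rule mult_left_mono) simp
  then show ?thesis unfolding phi_eq[OF t] Smaj_def
    by (intro mult_mono pw_sigma_q_le) (auto simp: pw_nonneg le_max_iff_disj)
qed

lemma Phi_Smaj_le:
  assumes t: "t \<ge> 0"
  shows "\<Phi> Smaj x t \<le> Smaj x t"
proof -
  define D where "D = max (((1 - p) * \<epsilon> * \<theta>lo) powr q) ((A a * \<theta>up) powr q)"
  have A1: "A a \<ge> 1" by (rule A_ge_one[OF a_nonneg])
  have "(A a * \<theta>up) powr q > 0" using A1 theta by simp
  then have D: "D > 0" by (simp add: D_def less_max_iff_disj)
  \<comment> \<open>The choice of \<open>D\<close> means A \<theta>up \<le> D^(1-p); multiplying by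
    D^p gives the claim, as \<open>q > 1\<close>.\<close>
  have D2: "A a * (\<theta>up * D powr p) \<le> D * q"
  proof -
    have "A a * \<theta>up = ((A a * \<theta>up) powr q) powr (1 - p)" using A1 theta q(2) by (simp add: powr_powr)
    also have "\<dots> \<le> D powr (1 - p)" unfolding D_def using p by (intro powr_mono2) auto
    finally have "A a * \<theta>up * D powr p \<le> D powr (1 - p) * D powr p" by (rule mult_right_mono) simp
    also have "\<dots> = D" using D by (simp flip: powr_add)
    also have "\<dots> \<le> D * q" using D q(1) by simp
    finally show ?thesis by (simp add: mult.assoc)
  qed
  let ?h = "\<lambda>\<tau>. A a * (L \<tau> powr q * exp (A a * \<tau>)) + q * (lam \<tau> * L \<tau> powr (q * p) * exp (A a * \<tau>))"
  let ?c = "D * (1 + norm x) powr a"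
  have I: "((\<lambda>\<tau>. ?c * ?h \<tau>) has_integral ?c * (L t powr q * exp (A a * t))) {0..t}"
    by (rule has_integral_mult_right[OF has_integral_powr_exp[OF t]])
  have "\<Phi> Smaj x t \<le> ?c * (L t powr q * exp (A a * t))"
    unfolding \<Phi>_def
  proof (rule has_integral_le[OF integrable_integral[OF K_Nl_integrable[OF adm_Smaj order_refl]] I])
    fix \<tau> assume "\<tau> \<in> {0..t}"
    then have \<tau>: "\<tau> \<ge> 0" by simp
    let ?M = "D * (L \<tau> powr q * exp (A a * \<tau>))"
    have M0: "?M \<ge> 0" using D by simp
    have lam0: "lam \<tau> > 0" by (rule lam_pos[OF \<tau>])
    have c0: "?M + \<theta>up * lam \<tau> * ?M powr p \<ge> 0" using M0 theta lam0 by simp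
    have "\<bar>K (\<lambda>y. Nl Smaj y \<tau>) x\<bar> \<le> (?M + \<theta>up * lam \<tau> * ?M powr p) * (1 + norm x) powr a * A a"
    proof (rule K_bound_powr[OF adm_measurable[OF adm_Nl[OF adm_Smaj] \<tau>] _ c0 a_nonneg])
      fix z :: 'a
      have "Nl Smaj z \<tau> \<le> (?M + \<theta>up * lam \<tau> * ?M powr p) * (1 + norm z) powr a"
        using Nl_bound[of \<tau> Smaj z ?M] \<tau> adm_nonneg[OF adm_Smaj \<tau>, of z] M0 by (simp add: Smaj_def D_def)
      then show "\<bar>Nl Smaj z \<tau>\<bar> \<le> (?M + \<theta>up * lam \<tau> * ?M powr p) * (1 + norm z) powr a"
        using adm_nonneg[OF adm_Nl[OF adm_Smaj] \<tau>, of z] by simp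
    qed
    moreover have "A a * (?M + \<theta>up * lam \<tau> * ?M powr p) \<le> D * ?h \<tau>"
    proof -
      have "?M powr p = D powr p * L \<tau> powr (q * p) * exp (A a * \<tau> * p)"
        using D by (simp add: powr_mult powr_powr exp_powr_real)
      also have "\<dots> \<le> D powr p * L \<tau> powr (q * p) * exp (A a * \<tau>)"
        using A1 \<tau> p by (intro mult_left_mono) (auto intro: mult_left_le)
      finally have "A a * (\<theta>up * lam \<tau> * ?M powr p) \<le> A a * (\<theta>up * lam \<tau> * (D powr p * L \<tau> powr (q * p) * exp (A a * \<tau>)))"
        using A1 theta lam0 by (intro mult_left_mono) auto
      also have "\<dots> = (A a * (\<theta>up * D powr p)) * (lam \<tau> * L \<tau> powr (q * p) * exp (A a * \<tau>))" by (simp add: mult_ac)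
      also have "\<dots> \<le> (D * q) * (lam \<tau> * L \<tau> powr (q * p) * exp (A a * \<tau>))"
        using lam0 by (intro mult_right_mono D2) auto
      finally show ?thesis by (simp add: algebra_simps)
    qed
    then have "A a * (?M + \<theta>up * lam \<tau> * ?M powr p) * (1 + norm x) powr a \<le> D * ?h \<tau> * (1 + norm x) powr a"
      by (rule mult_right_mono) simp
    ultimately show "K (\<lambda>y. Nl Smaj y \<tau>) x \<le> ?c * ?h \<tau>" by (simp add: mult_ac abs_le_iff)
  qed
  then show ?thesis by (simp add: Smaj_def D_def mult_ac)
qed

text \<open>The iterates increase from \<open>\<phi>\<close> and stay below \<open>Smaj\<close>, so
  they converge pointwise. All of them lie above the barrier, and the contraction adds a geometric
  rate, which makes the limit continuous and a fixed point. The result witnesses that maximal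
  s-solutions are nontrivial.\<close>

lemma exists_fixed_point:
  obtains f where "adm a f" "\<And>x t. t \<ge> 0 \<Longrightarrow> f x t = \<Phi> f x t" "\<And>x t. t \<ge> 0 \<Longrightarrow> \<phi> x t \<le> f x t"
proof -
  define F where "F n = (\<Phi> ^^ n) \<phi>" for n
  have F0: "F 0 = \<phi>" and FS: "F (Suc n) = \<Phi> (F n)" for n by (simp_all add: F_def)
  have Fa: "adm a (F n)" for n by (induction n) (simp_all add: F0 FS adm_phi adm_Phi)
  have mono1: "F n x t \<le> F (Suc n) x t" if "t \<ge> 0" for n x t
    using that
  proof (induction n arbitrary: x t)
    case 0 then show ?case by (simp add: F0 FS phi_le_Phi)
  next
    case (Suc n)
    have "\<Phi> (F n) x t \<le> \<Phi> (F (Suc n)) x t"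
      by (rule Phi_mono[OF Fa Fa]) (use Suc.IH in auto)
    then show ?case by (simp only: FS)
  qed
  have FSm: "F n x t \<le> Smaj x t" if "t \<ge> 0" for n x t
    using that
  proof (induction n arbitrary: x t)
    case 0 then show ?case by (simp add: F0 phi_le_Smaj)
  next
    case (Suc n)
    have "F (Suc n) x t \<le> \<Phi> Smaj x t" unfolding FS using Suc by (intro Phi_mono[OF Fa adm_Smaj]) auto
    also have "\<dots> \<le> Smaj x t" by (rule Phi_Smaj_le[OF Suc.prems])
    finally show ?case .
  qed
  have inc: "incseq (\<lambda>n. F n x t)" if "t \<ge> 0" for x t using mono1[OF that] by (intro incseq_SucI)
  have phiF: "\<phi> x t \<le> F n x t" if "t \<ge> 0" for n x t using incseqD[OF inc[OF that], of 0 n x] by (simp add: F0)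
  define f where "f x t = lim (\<lambda>n. F n x t)" for x t
  have lim: "(\<lambda>n. F n x t) \<longlonglongrightarrow> f x t" if t: "t \<ge> 0" for x t
  proof -
    obtain l where "(\<lambda>n. F n x t) \<longlonglongrightarrow> l" using incseq_convergent[OF inc[OF t]] FSm[OF t] by metis
    then show ?thesis unfolding f_def by (simp add: limI)
  qed
  have Ff: "F n x t \<le> f x t" if "t \<ge> 0" for n x t by (rule incseq_le[OF inc[OF that] lim[OF that]])
  have fS: "f x t \<le> Smaj x t" if "t \<ge> 0" for x t using FSm[OF that] by (intro LIMSEQ_le_const2[OF lim[OF that]]) auto
  obtain e where e: "0 < e" "e \<le> e0" "0 \<le> \<rho> * expmom e"
    "\<rho> * expmom e < 1" by (rule contraction_weight)
  define \<theta> where "\<theta> = \<rho> * expmom e"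
  have \<theta>: "0 \<le> \<theta>" "\<theta> < 1" using e by (auto simp: \<theta>_def)
  let ?w = "\<lambda>(x::'a) \<tau>. (L \<tau> powr q * exp (1 / \<rho> * \<tau>)) * exp (e * norm x)"
  have err: "\<exists>M\<ge>0. \<forall>n x. \<forall>t\<in>{0..T}. f x t - F n x t \<le> \<theta> ^ n * M * ?w x t" for T
  proof -
    let ?D = "max (((1 - p) * \<epsilon> * \<theta>lo) powr q) ((A a * \<theta>up) powr q) * exp (A a * T)"
    have D: "?D \<ge> 0" by (simp add: le_max_iff_disj)
    obtain M where M: "M \<ge> 0" "\<And>x t. t \<ge> 0 \<Longrightarrow>
      ?D * L t powr q * (1 + norm (x::'a)) powr a \<le> wt M e x t"
      using bound_to_exp_weight[OF D e(1)] by blast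
    have Sm: "Smaj x t \<le> M * ?w x t" if t: "t \<in> {0..T}" for x t
    proof -
      have "exp (A a * t) \<le> exp (A a * T)" using t A_ge_one[OF a_nonneg] by (simp add: mult_left_mono)
      then have "Smaj x t \<le> ?D * L t powr q * (1 + norm x) powr a"
        unfolding Smaj_def by (simp add: mult_ac mult_left_mono mult_right_mono le_max_iff_disj)
      then show ?thesis using M(2)[of t x] t by (simp add: mult_ac)
    qed
    have step: "F (Suc n) x t - F n x t \<le> \<theta> ^ n * M * ?w x t" if "t \<in> {0..T}" for n x t
      using that
    proof (induction n arbitrary: x t)
      case 0
      then show ?case using Sm[OF 0, of x] FSm[of t 1 x] adm_nonneg[OF adm_phi, of t x] by (simp add: F0)
    next
      case (Suc n)
      have "\<Phi> (F (Suc n)) x t - \<Phi> (F n) x t \<le> wt (\<theta> * (\<theta> ^ n * M)) e x t"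
        unfolding \<theta>_def
        by (rule Phi_contraction[OF Fa Fa _ e(2) _ Suc.prems])
          (use e M(1) phiF mono1 Suc.IH in \<open>auto simp: \<theta>_def mult_ac\<close>)
      then show ?case by (simp add: FS mult_ac)
    qed
    \<comment> \<open>Sum of a finite geometric series; the closed form allows letting the later
      index tend to infinity.\<close>
    have tele: "F (n + j) x t - F n x t \<le> (\<theta> ^ n - \<theta> ^ (n + j)) / (1 - \<theta>) * M * ?w x t" if "t \<in> {0..T}" for n j x t
    proof (induction j)
      case (Suc j)
      have "F (Suc (n + j)) x t - F n x t \<le> \<theta> ^ (n + j) * M * ?w x t + (\<theta> ^ n - \<theta> ^ (n + j)) / (1 - \<theta>) * M * ?w x t"
        using Suc step[OF that, of "n + j" x] by linarith
      also have "\<dots> = (\<theta> ^ (n + j) + (\<theta> ^ n - \<theta> ^ (n + j)) / (1 - \<theta>)) * M * ?w x t" by (simp only: distrib_right)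
      also have "\<theta> ^ (n + j) + (\<theta> ^ n - \<theta> ^ (n + j)) / (1 - \<theta>) = (\<theta> ^ n - \<theta> ^ (n + Suc j)) / (1 - \<theta>)"
        using \<theta> by (simp add: field_simps)
      finally show ?case by simp
    qed simp
    show ?thesis
    proof (intro exI[of _ "M / (1 - \<theta>)"] conjI allI ballI)
      show "M / (1 - \<theta>) \<ge> 0" using M \<theta> by simp
      fix n x t assume t: "t \<in> {0..T}"
      have "F m x t - F n x t \<le> \<theta> ^ n * (M / (1 - \<theta>)) * ?w x t" if "m \<ge> n" for m
      proof -
        have "F m x t - F n x t \<le> (\<theta> ^ n - \<theta> ^ m) / (1 - \<theta>) * M * ?w x t" using tele[OF t, of n "m - n" x] that by simp
        also have "\<dots> \<le> \<theta> ^ n / (1 - \<theta>) * M * ?w x t"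
          using \<theta> M by (intro mult_right_mono divide_right_mono) auto
        finally show ?thesis by simp
      qed
      moreover have "(\<lambda>m. F m x t - F n x t) \<longlonglongrightarrow> f x t - F n x t" using t by (intro tendsto_intros lim) auto
      ultimately show "f x t - F n x t \<le> \<theta> ^ n * (M / (1 - \<theta>)) * ?w x t"
        by (intro LIMSEQ_le_const2) auto
    qed
  qed
  have \<theta>0: "(\<lambda>n. \<theta> ^ n) \<longlonglongrightarrow> 0" using \<theta> by (intro LIMSEQ_power_zero) auto
  have cont: "continuous_on (UNIV \<times> {0..}) (\<lambda>(x, t). f x t)"
  proof (rule continuous_on_half_space_compact_exhaustion)
    fix R T
    obtain M where M: "M \<ge> 0" "\<And>n x t. t \<in> {0..T} \<Longrightarrow> f x t - F n x t \<le> \<theta> ^ n * M * ?w x t" using err[of T] by blast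
    \<comment> \<open>On a bounded set of space and time the weight is at most its value at time T
      and radius R, so convergence there is uniform.\<close>
    define B where "B = M * (L T powr q * exp (1 / \<rho> * T) * exp (e * R))"
    have unif: "\<bar>f x t - F n x t\<bar> \<le> \<theta> ^ n * B" if "t \<in> {0..T}" "norm x \<le> R" for n x t
    proof -
      have "1 / \<rho> * t \<le> 1 / \<rho> * T" using that rho by (intro mult_left_mono) auto
      moreover have "L t powr q \<le> L T powr q" using L_mono[of t T] L_nonneg[of t] that q(1) by (intro powr_mono2) auto
      moreover have "e * norm x \<le> e * R" using that e by (intro mult_left_mono) auto
      ultimately have "?w x t \<le> L T powr q * exp (1 / \<rho> * T) * exp (e * R)" by (intro mult_mono) auto
      then have "\<theta> ^ n * M * ?w x t \<le> \<theta> ^ n * M * (L T powr q * exp (1 / \<rho> * T) * exp (e * R))"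
        using \<theta> M by (intro mult_left_mono) auto
      then show ?thesis using M(2)[OF that(1), of x n] Ff[of t n x] that(1) by (simp add: B_def mult_ac)
    qed
    show "continuous_on (cball 0 R \<times> {0..T}) (\<lambda>(x, t). f x t)"
    proof (rule uniform_limit_theorem[where F = sequentially and f = "\<lambda>n (x, t). F n x t"])
      show "\<forall>\<^sub>F n in sequentially. continuous_on (cball 0 R \<times> {0..T}) (\<lambda>(x, t). F n x t)"
        by (intro always_eventually allI continuous_on_subset[OF adm_continuous[OF Fa]]) auto
      show "uniform_limit (cball 0 R \<times> {0..T}) (\<lambda>n (x, t). F n x t) (\<lambda>(x, t). f x t) sequentially"
      proof (rule uniform_limitI)
        fix \<delta> :: real assume \<delta>: "\<delta> > 0"
        have "(\<lambda>n. \<theta> ^ n * B) \<longlonglongrightarrow> 0 * B" by (intro tendsto_intros \<theta>0)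
        then have "eventually (\<lambda>n. \<theta> ^ n * B < \<delta>) sequentially" using \<delta> by (intro order_tendstoD) auto
        then show "\<forall>\<^sub>F n in sequentially. \<forall>z\<in>cball 0 R \<times> {0..T}. dist (case z of (x, t) \<Rightarrow> F n x t) (case z of (x, t) \<Rightarrow> f x t) < \<delta>"
        proof eventually_elim
          case (elim n)
          show ?case using unif[of _ _ n] elim by (force simp: dist_real_def abs_minus_commute)
        qed
      qed
    qed simp
  qed
  have fa: "adm a f"
    unfolding adm_def
  proof (intro conjI allI impI cont)
    show "0 \<le> f x t" if "t \<ge> 0" for x t using adm_nonneg[OF Fa that, of 0 x] Ff[OF that, of 0 x] by linarith
    fix T
    obtain C where C: "\<And>x t. t \<in> {0..T} \<Longrightarrow> Smaj x t \<le> C * (1 + norm x) powr a" using adm_bound[OF adm_Smaj] by blast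
    show "\<exists>C. \<forall>x. \<forall>t\<in>{0..T}. f x t \<le> C * (1 + norm x) powr a"
    proof (intro exI[of _ C] allI ballI)
      fix x t assume t: "t \<in> {0..T}"
      show "f x t \<le> C * (1 + norm x) powr a" using fS[of t x] C[OF t, of x] t by simp
    qed
  qed
  have ffix: "f x t = \<Phi> f x t" if t: "t \<ge> 0" for x t
  proof (rule LIMSEQ_unique)
    show "(\<lambda>n. F (Suc n) x t) \<longlonglongrightarrow> f x t" by (rule LIMSEQ_Suc[OF lim[OF t]])
    obtain M where M: "M \<ge> 0" "\<And>n x \<tau>. \<tau> \<in> {0..t} \<Longrightarrow> f x \<tau> - F n x \<tau> \<le> \<theta> ^ n * M * ?w x \<tau>" using err[of t] by blast
    \<comment> \<open>Together with \<open>lo\<close> this squeezes \<open>\<Phi> f\<close> between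
      \<open>F (Suc n)\<close> and the same iterate plus a geometric error.\<close>
    have up: "\<Phi> f x t - F (Suc n) x t \<le> \<theta> ^ n * (\<theta> * M * ?w x t)" for n
    proof -
      have "\<Phi> f x t - \<Phi> (F n) x t \<le> wt (\<theta> * (\<theta> ^ n * M)) e x t"
        unfolding \<theta>_def
        by (rule Phi_contraction[OF fa Fa _ e(2), where T = t])
          (use e M phiF Ff t in \<open>auto simp: \<theta>_def mult_ac\<close>)
      then show ?thesis by (simp add: FS mult_ac)
    qed
    have lo: "F (Suc n) x t \<le> \<Phi> f x t" for n unfolding FS using Ff by (intro Phi_mono[OF Fa fa]) auto
    have "(\<lambda>n. \<theta> ^ n * (\<theta> * M * ?w x t)) \<longlonglongrightarrow> 0 * (\<theta> * M * ?w x t)" by (intro tendsto_mult \<theta>0 tendsto_const)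
    then have "(\<lambda>n. \<theta> ^ n * (\<theta> * M * ?w x t)) \<longlonglongrightarrow> 0" by simp
    moreover have "\<forall>\<^sub>F n in sequentially. norm (F (Suc n) x t - \<Phi> f x t) \<le> \<theta> ^ n * (\<theta> * M * ?w x t)"
      using up lo by (simp add: abs_le_iff)
    ultimately have "(\<lambda>n. F (Suc n) x t - \<Phi> f x t) \<longlonglongrightarrow> 0" by (rule Lim_null_comparison[rotated])
    then show "(\<lambda>n. F (Suc n) x t) \<longlonglongrightarrow> \<Phi> f x t" by (rule LIM_zero_cancel)
  qed
  show ?thesis
  proof (rule that[OF fa ffix])
    show "\<phi> x t \<le> f x t" if "t \<ge> 0" for x t using Ff[OF that, of 0 x] by (simp add: F0)
  qed
qed

end

section \<open>Heat kernel and Fourier uniqueness\<close>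

text \<open>Fubini over coordinates: \<open>lborel\<close> is the image of the product of
  one-dimensional Lebesgue measures.\<close>

lemma
  fixes f :: "'a::euclidean_space \<Rightarrow> real \<Rightarrow> 'b::{real_normed_field,banach,second_countable_topology}"
  assumes f: "\<And>b. b \<in> Basis \<Longrightarrow> integrable lborel (f b)"
  shows integrable_lborel_prod_Basis: "integrable lborel (\<lambda>x::'a. \<Prod>b\<in>Basis. f b (x \<bullet> b))"
    and integral_lborel_prod_Basis:
      "(\<integral>(x::'a). (\<Prod>b\<in>Basis. f b (x \<bullet> b)) \<partial>lborel) = (\<Prod>b\<in>Basis. integral\<^sup>L lborel (f b))"
proof -
  interpret product_sigma_finite "\<lambda>_::'a. lborel :: real measure"
    by (simp add: product_sigma_finite_def sigma_finite_lborel)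
  let ?P = "PiM (Basis::'a set) (\<lambda>_. lborel :: real measure)"
  let ?e = "\<lambda>g::'a \<Rightarrow> real. \<Sum>b\<in>Basis. g b *\<^sub>R b"
  have meas: "(\<lambda>x::'a. \<Prod>b\<in>Basis. f b (x \<bullet> b)) \<in> borel_measurable borel"
  proof (intro borel_measurable_prod)
    fix b :: 'a assume "b \<in> Basis"
    then have "f b \<in> borel_measurable borel" using f[of b] by (auto dest: borel_measurable_integrable)
    then show "(\<lambda>x. f b (x \<bullet> b)) \<in> borel_measurable borel" by measurable
  qed
  have e: "?e \<in> ?P \<rightarrow>\<^sub>M borel" by measurable
  have "integrable ?P (\<lambda>g. \<Prod>b\<in>Basis. f b (g b))"
    by (rule product_integrable_prod) (use f in auto)
  then have 1: "integrable ?P (\<lambda>g. \<Prod>b\<in>Basis. f b (?e g \<bullet> b))" by simp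
  show "integrable lborel (\<lambda>x::'a. \<Prod>b\<in>Basis. f b (x \<bullet> b))"
    by (subst lborel_eq, subst integrable_distr_eq[OF e meas]) (rule 1)
  have "(\<integral>(x::'a). (\<Prod>b\<in>Basis. f b (x \<bullet> b)) \<partial>lborel) = (\<integral>g. (\<Prod>b\<in>Basis. f b (?e g \<bullet> b)) \<partial>?P)"
    by (subst lborel_eq, subst integral_distr[OF e meas]) simp
  also have "\<dots> = (\<integral>g. (\<Prod>b\<in>Basis. f b (g b)) \<partial>?P)" by simp
  also have "\<dots> = (\<Prod>b\<in>Basis. integral\<^sup>L lborel (f b))"
    by (rule product_integral_prod) (use f in auto)
  finally show "(\<integral>(x::'a). (\<Prod>b\<in>Basis. f b (x \<bullet> b)) \<partial>lborel) = (\<Prod>b\<in>Basis. integral\<^sup>L lborel (f b))" .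
qed

lemma normal_density_fourier:
  assumes "\<sigma> > 0"
  shows "(\<integral>x. complex_of_real (normal_density 0 \<sigma> x) * cis (t * x) \<partial>lborel)
    = complex_of_real (exp (- (\<sigma>\<^sup>2 * t\<^sup>2 / 2)))"
proof -
  have *: "\<bar>\<sigma>\<bar> * normal_density 0 \<sigma> (0 + \<sigma> * x) = std_normal_density x" for x
    using assms by (simp add: normal_density_def real_sqrt_mult power_mult_distrib)
  have "(\<integral>x. complex_of_real (normal_density 0 \<sigma> x) * cis (t * x) \<partial>lborel)
     = \<bar>\<sigma>\<bar> *\<^sub>R (\<integral>x. complex_of_real (normal_density 0 \<sigma> (0 + \<sigma> * x)) * cis (t * (0 + \<sigma> * x)) \<partial>lborel)"
    by (rule lborel_integral_real_affine) (use assms in auto)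
  also have "\<dots> = (\<integral>x. complex_of_real (\<bar>\<sigma>\<bar> * normal_density 0 \<sigma> (0 + \<sigma> * x)) * cis (t * (0 + \<sigma> * x)) \<partial>lborel)"
    by (subst integral_scaleR_right[symmetric], intro Bochner_Integration.integral_cong refl)
      (simp only: scaleR_conv_of_real of_real_mult mult.assoc)
  also have "\<dots> = (\<integral>x. std_normal_density x *\<^sub>R iexp ((\<sigma> * t) * x) \<partial>lborel)"
    unfolding * by (simp add: scaleR_conv_of_real cis_conv_exp mult_ac)
  also have "\<dots> = char std_normal_distribution (\<sigma> * t)"
    unfolding char_def by (subst integral_density) auto
  also have "\<dots> = complex_of_real (exp (- (\<sigma>\<^sup>2 * t\<^sup>2 / 2)))"
    unfolding char_std_normal_distribution by (simp add: power_mult_distrib)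
  finally show ?thesis .
qed

text \<open>Completing the square; the exponential tilt of a Gaussian is a shifted Gaussian.\<close>

lemma normal_density_exp:
  assumes "\<sigma> > 0"
  shows "normal_density 0 \<sigma> x * exp (t * x) = exp (\<sigma>\<^sup>2 * t\<^sup>2 / 2) * normal_density (\<sigma>\<^sup>2 * t) \<sigma> x"
proof -
  have "- x\<^sup>2 / (2 * \<sigma>\<^sup>2) + t * x = \<sigma>\<^sup>2 * t\<^sup>2 / 2 + - (x - \<sigma>\<^sup>2 * t)\<^sup>2 / (2 * \<sigma>\<^sup>2)"
    using assms by (simp add: field_simps power2_eq_square)
  then have "exp (- x\<^sup>2 / (2 * \<sigma>\<^sup>2)) * exp (t * x) = exp (\<sigma>\<^sup>2 * t\<^sup>2 / 2) * exp (- (x - \<sigma>\<^sup>2 * t)\<^sup>2 / (2 * \<sigma>\<^sup>2))"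
    by (simp flip: exp_add)
  then show ?thesis by (simp add: normal_density_def)
qed

lemma measurable_cis [measurable]: "cis \<in> borel_measurable borel"
  by (intro borel_measurable_continuous_onI) (simp add: cis_conv_exp continuous_intros)

text \<open>The Gauss-Weierstrass kernel (4 pi s)^(-n/2) exp(-|y|^2 / (4 s)), see
  \<open>heat_eq\<close>, as a product of centred normal densities of variance 2s, so that
  one-dimensional facts tensorise.\<close>

definition heat :: "real \<Rightarrow> 'a::euclidean_space \<Rightarrow> real" where
  "heat s y = (\<Prod>b\<in>Basis. normal_density 0 (sqrt (2 * s)) (y \<bullet> b))"

lemma heat_eq:
  assumes "s > 0"
  shows "heat s (y::'a::euclidean_space) = (1 / sqrt (4 * pi * s)) ^ DIM('a) * exp (- (norm y)\<^sup>2 / (4 * s))"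
proof -
  have "heat s y = (\<Prod>b\<in>(Basis::'a set). 1 / sqrt (4 * pi * s) * exp (- (y \<bullet> b)\<^sup>2 / (4 * s)))"
    using assms by (simp add: heat_def normal_density_def mult_ac)
  also have "\<dots> = (1 / sqrt (4 * pi * s)) ^ DIM('a) * exp (\<Sum>b\<in>(Basis::'a set). - (y \<bullet> b)\<^sup>2 / (4 * s))"
    by (simp only: prod.distrib exp_sum[OF finite_Basis] prod_constant)
  also have "(\<Sum>b\<in>(Basis::'a set). - (y \<bullet> b)\<^sup>2 / (4 * s)) = - (norm y)\<^sup>2 / (4 * s)"
    unfolding power2_norm_eq_inner euclidean_inner[of y y]
    by (simp add: sum_negf power2_eq_square flip: sum_divide_distrib)
  finally show ?thesis .
qed

lemma heat_nonneg: "heat s y \<ge> 0"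
  by (simp add: heat_def prod_nonneg)

lemma heat_measurable [measurable]: "(\<lambda>(s, y). heat s (y::'a::euclidean_space)) \<in> borel_measurable (borel \<Otimes>\<^sub>M borel)"
  unfolding heat_def normal_density_def by measurable

lemma heat_measurable' [measurable]: "heat s \<in> borel_measurable (borel :: 'a::euclidean_space measure)"
  unfolding heat_def by measurable

lemma
  fixes \<xi> :: "'a::euclidean_space"
  assumes "s > 0"
  shows heat_fourier_integrable: "integrable lborel (\<lambda>y. complex_of_real (heat s y) * cis (\<xi> \<bullet> y))"
    and heat_fourier: "(\<integral>y. complex_of_real (heat s y) * cis (\<xi> \<bullet> y) \<partial>lborel)
      = complex_of_real (exp (- (s * (norm \<xi>)\<^sup>2)))"
proof -
  let ?f = "\<lambda>(b::'a) x. complex_of_real (normal_density 0 (sqrt (2 * s)) x) * cis (\<xi> \<bullet> b * x)"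
  have s: "sqrt (2 * s) > 0" using assms by simp
  have I: "integrable lborel (?f b)" for b
  proof (rule Bochner_Integration.integrable_bound)
    show "integrable lborel (normal_density 0 (sqrt (2 * s)))" using s by simp
    show "?f b \<in> borel_measurable lborel" by measurable
  qed (simp add: norm_mult)
  have cis_sum: "cis (sum g A) = (\<Prod>b\<in>A. cis (g b))" if "finite A" for A :: "'a set" and g
    using that by induction (auto simp: cis_mult[symmetric])
  have eq: "complex_of_real (heat s y) * cis (\<xi> \<bullet> y) = (\<Prod>b\<in>Basis. ?f b (y \<bullet> b))" for y
    unfolding heat_def euclidean_inner[of \<xi> y] by (simp add: cis_sum prod.distrib)
  show "integrable lborel (\<lambda>y. complex_of_real (heat s y) * cis (\<xi> \<bullet> y))"
    unfolding eq by (rule integrable_lborel_prod_Basis) (rule I)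
  have "(\<integral>y. complex_of_real (heat s y) * cis (\<xi> \<bullet> y) \<partial>lborel)
      = (\<Prod>b\<in>Basis. integral\<^sup>L lborel (?f b))"
    unfolding eq by (rule integral_lborel_prod_Basis) (rule I)
  also have "\<dots> = (\<Prod>b\<in>Basis. complex_of_real (exp (- (s * (\<xi> \<bullet> b)\<^sup>2))))"
    using assms by (subst normal_density_fourier) (auto simp: s)
  also have "\<dots> = complex_of_real (exp (\<Sum>b\<in>Basis. - (s * (\<xi> \<bullet> b)\<^sup>2)))"
    by (simp add: exp_sum)
  also have "(\<Sum>b\<in>Basis. - (s * (\<xi> \<bullet> b)\<^sup>2)) = - (s * (norm \<xi>)\<^sup>2)"
    unfolding power2_norm_eq_inner euclidean_inner[of \<xi> \<xi>]
    by (simp add: sum_negf power2_eq_square flip: sum_distrib_left)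
  finally show "(\<integral>y. complex_of_real (heat s y) * cis (\<xi> \<bullet> y) \<partial>lborel)
      = complex_of_real (exp (- (s * (norm \<xi>)\<^sup>2)))" .
qed

lemma
  assumes "s > 0"
  shows heat_integrable: "integrable lborel (heat s :: 'a::euclidean_space \<Rightarrow> real)"
    and heat_integral: "integral\<^sup>L lborel (heat s :: 'a \<Rightarrow> real) = 1"
proof -
  have "complex_integrable lborel (\<lambda>y::'a. complex_of_real (heat s y))"
    using heat_fourier_integrable[OF assms, of "0::'a"] by simp
  then show "integrable lborel (heat s :: 'a \<Rightarrow> real)" by (simp add: complex_of_real_integrable_eq)
  have "complex_of_real (integral\<^sup>L lborel (heat s :: 'a \<Rightarrow> real)) = 1"
    using heat_fourier[OF assms, of "0::'a"] by simp
  then show "integral\<^sup>L lborel (heat s :: 'a \<Rightarrow> real) = 1" by simp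
qed

text \<open>The norm is at most the sum of the coordinates in absolute value, and e^|z| \<le> e^z +
  e^(-z). The integral then splits into one-dimensional moments, each equal to 2 exp(s e^2).\<close>

lemma heat_exp_moment:
  fixes s e :: real
  assumes s: "s > 0" and e: "e \<ge> 0"
  shows "(\<integral>\<^sup>+y. ennreal (heat s (y::'a::euclidean_space) * exp (e * norm y)) \<partial>lborel)
    \<le> ennreal (2 ^ DIM('a) * exp (DIM('a) * e\<^sup>2 * s))"
proof -
  let ?r = "sqrt (2 * s)"
  let ?f = "\<lambda>x. normal_density 0 ?r x * (exp (e * x) + exp ((-e) * x))"
  have r: "?r > 0" using s by simp
  have f: "?f x = exp (s * e\<^sup>2) * normal_density (?r\<^sup>2 * e) ?r x + exp (s * e\<^sup>2) * normal_density (?r\<^sup>2 * (-e)) ?r x" for x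
    unfolding distrib_left normal_density_exp[OF r] using s by simp
  have I: "integrable lborel ?f" "integral\<^sup>L lborel ?f = 2 * exp (s * e\<^sup>2)"
    unfolding f using r by auto
  have le: "heat s y * exp (e * norm y) \<le> (\<Prod>b\<in>Basis. ?f (y \<bullet> b))" for y :: 'a
  proof -
    have "exp (e * norm y) \<le> exp (e * (\<Sum>b\<in>Basis. \<bar>y \<bullet> b\<bar>))"
      using e norm_le_l1[of y] by (simp add: mult_left_mono)
    also have "\<dots> = (\<Prod>b\<in>Basis. exp (e * \<bar>y \<bullet> b\<bar>))" by (simp add: exp_sum sum_distrib_left)
    also have "\<dots> \<le> (\<Prod>b\<in>Basis. exp (e * (y \<bullet> b)) + exp ((-e) * (y \<bullet> b)))"
      by (intro prod_mono) (auto simp: abs_if)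
    finally have "heat s y * exp (e * norm y) \<le> heat s y * (\<Prod>b\<in>Basis. exp (e * (y \<bullet> b)) + exp ((-e) * (y \<bullet> b)))"
      by (intro mult_left_mono heat_nonneg)
    then show ?thesis by (simp add: heat_def prod.distrib)
  qed
  have "(\<integral>\<^sup>+y. ennreal (heat s (y::'a) * exp (e * norm y)) \<partial>lborel)
    \<le> (\<integral>\<^sup>+(y::'a). ennreal (\<Prod>b\<in>Basis. ?f (y \<bullet> b)) \<partial>lborel)"
    by (intro nn_integral_mono ennreal_leI le)
  also have "\<dots> = ennreal (\<integral>(y::'a). (\<Prod>b\<in>Basis. ?f (y \<bullet> b)) \<partial>lborel)"
    by (intro nn_integral_eq_integral integrable_lborel_prod_Basis I) (auto intro!: prod_nonneg add_nonneg_nonneg)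
  also have "(\<integral>(y::'a). (\<Prod>b\<in>Basis. ?f (y \<bullet> b)) \<partial>lborel) = (2 * exp (s * e\<^sup>2)) ^ DIM('a)"
    by (subst integral_lborel_prod_Basis) (use I in auto)
  also have "\<dots> = 2 ^ DIM('a) * exp (DIM('a) * e\<^sup>2 * s)"
    by (simp add: power_mult_distrib mult_ac flip: exp_of_nat_mult)
  finally show ?thesis .
qed

section \<open>Injectivity of the Fourier transform on integrable functions\<close>

lemma lborel_distr_isometric_affine:
  fixes t :: "'a::euclidean_space"
  assumes "\<bar>c\<bar> = 1"
  shows "distr lborel borel (\<lambda>x. t + c *\<^sub>R x) = lborel"
proof -
  have "lborel = density (distr lborel borel (\<lambda>x. t + c *\<^sub>R x)) (\<lambda>_. 1)"
    using lborel_affine[of c t] assms by auto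
  then show ?thesis by (simp add: density_1)
qed

lemma
  fixes f :: "'a::euclidean_space \<Rightarrow> 'b::{banach,second_countable_topology}"
  assumes [measurable]: "f \<in> borel_measurable borel"
  shows integrable_lborel_shift_iff: "integrable lborel (\<lambda>x. f (x - t)) \<longleftrightarrow> integrable lborel f"
    and integral_lborel_shift: "(\<integral>x. f (x - t) \<partial>lborel) = integral\<^sup>L lborel f"
    and integral_lborel_reflect: "(\<integral>x. f (t - x) \<partial>lborel) = integral\<^sup>L lborel f"
proof -
  have 1: "distr lborel borel (\<lambda>x. x - t) = lborel" and 2: "distr lborel borel (\<lambda>x. t - x) = lborel"
    using lborel_distr_isometric_affine[of 1 "- t"] lborel_distr_isometric_affine[of "-1" t] by auto
  show "integrable lborel (\<lambda>x. f (x - t)) \<longleftrightarrow> integrable lborel f"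
    by (subst (2) 1[symmetric], subst integrable_distr_eq) auto
  show "(\<integral>x. f (x - t) \<partial>lborel) = integral\<^sup>L lborel f"
    by (subst (2) 1[symmetric], subst integral_distr) auto
  show "(\<integral>x. f (t - x) \<partial>lborel) = integral\<^sup>L lborel f"
    by (subst (2) 2[symmetric], subst integral_distr) auto
qed

text \<open>A Gaussian is the Fourier transform of a Gaussian: up to a constant,
  \<open>heat r\<close> is the transform of \<open>heat s\<close> with 4rs = 1. Fubini then moves
  the oscillating factor onto \<open>g\<close>.\<close>

lemma heat_fourier_zero:
  fixes g :: "'a::euclidean_space \<Rightarrow> real"
  assumes g: "integrable lborel g"
    and F: "\<And>\<xi>. (\<integral>y. complex_of_real (g y) * cis (- (\<xi> \<bullet> y)) \<partial>lborel) = 0"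
    and r: "r > 0"
  shows "(\<integral>y. g y * heat r (x - y) \<partial>lborel) = 0"
proof -
  define s where "s = 1 / (4 * r)"
  have s: "s > 0" using r by (simp add: s_def)
  have [measurable]: "g \<in> borel_measurable borel" using g by auto
  let ?f = "\<lambda>(\<xi>::'a) y. complex_of_real (g y) * (complex_of_real (heat s \<xi>) * cis ((x - y) \<bullet> \<xi>))"
  have int: "integrable (lborel \<Otimes>\<^sub>M lborel) (case_prod ?f)"
  proof (rule lborel_pair.Fubini_integrable)
    show "case_prod ?f \<in> borel_measurable (lborel \<Otimes>\<^sub>M lborel)" by measurable
    have "(\<integral>y. norm (?f \<xi> y) \<partial>lborel) = heat s \<xi> * (\<integral>y. \<bar>g y\<bar> \<partial>lborel)" for \<xi>
      by (subst integral_mult_right_zero[symmetric])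
        (simp add: norm_mult heat_nonneg mult.commute)
    then show "integrable lborel (\<lambda>\<xi>. \<integral>y. norm (case_prod ?f (\<xi>, y)) \<partial>lborel)"
      using heat_integrable[OF s, where ?'a = 'a] by simp
    show "AE \<xi> in lborel. integrable lborel (\<lambda>y. case_prod ?f (\<xi>, y))"
    proof (rule AE_I2)
      fix \<xi>
      show "integrable lborel (\<lambda>y. case_prod ?f (\<xi>, y))"
        by (rule Bochner_Integration.integrable_bound[OF integrable_mult_right[OF g, of "heat s \<xi>"]])
          (auto simp: norm_mult heat_nonneg abs_mult mult.commute)
    qed
  qed
  have e: "complex_of_real (exp (- (s * (norm (x - y))\<^sup>2))) = (\<integral>\<xi>. complex_of_real (heat s \<xi>) * cis ((x - y) \<bullet> \<xi>) \<partial>lborel)" for y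
    using heat_fourier[OF s, of "x - y"] by simp
  have "(\<integral>y. complex_of_real (g y * exp (- (s * (norm (x - y))\<^sup>2))) \<partial>lborel) = (\<integral>y. (\<integral>\<xi>. ?f \<xi> y \<partial>lborel) \<partial>lborel)"
    unfolding of_real_mult e by simp
  also have "\<dots> = (\<integral>\<xi>. (\<integral>y. ?f \<xi> y \<partial>lborel) \<partial>lborel)"
    by (rule lborel_pair.Fubini_integral[OF int])
  also have "\<dots> = (\<integral>\<xi>. complex_of_real (heat s \<xi>) * cis (x \<bullet> \<xi>) * (\<integral>y. complex_of_real (g y) * cis (- (\<xi> \<bullet> y)) \<partial>lborel) \<partial>lborel)"
    by (subst integral_mult_right_zero[symmetric], intro Bochner_Integration.integral_cong refl)
      (simp add: inner_diff_right inner_commute[of "x - _"] inner_commute[of x] cis_mult mult_ac)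
  also have "\<dots> = 0" unfolding F by simp
  finally have "(\<integral>y. g y * exp (- (s * (norm (x - y))\<^sup>2)) \<partial>lborel) = 0"
    by (simp only: integral_complex_of_real of_real_eq_0_iff)
  moreover have "g y * heat r (x - y) = (1 / sqrt (4 * pi * r)) ^ DIM('a) * (g y * exp (- (s * (norm (x - y))\<^sup>2)))" for y
    using r by (simp add: heat_eq s_def)
  ultimately show ?thesis by (simp only: integral_mult_right_zero mult_zero_right)
qed

text \<open>The substitution x = y + c w moves the scale from the kernel into the argument of
  \<open>\<phi>\<close>, where it can tend to 0 under a fixed density.\<close>

lemma heat_convolution_rescale:
  fixes \<phi> :: "'a::euclidean_space \<Rightarrow> real"
  assumes c: "c > 0" and [measurable]: "\<phi> \<in> borel_measurable borel"
  shows "(\<integral>x. \<phi> x * heat (c\<^sup>2) (x - y) \<partial>lborel) = (\<integral>w. \<phi> (y + c *\<^sub>R w) * heat 1 w \<partial>lborel)"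
proof -
  have eq: "\<bar>c\<bar> ^ DIM('a) * heat (c\<^sup>2) (c *\<^sub>R w) = heat 1 (w::'a)" for w
    using c by (simp add: heat_eq real_sqrt_mult power_divide power_mult_distrib)
  have "(\<integral>x. \<phi> x * heat (c\<^sup>2) (x - y) \<partial>lborel)
     = (\<integral>w. \<bar>c\<bar> ^ DIM('a) *\<^sub>R (\<phi> (y + c *\<^sub>R w) * heat (c\<^sup>2) (c *\<^sub>R w)) \<partial>lborel)"
    using c by (subst lborel_affine[of c y]) (auto simp: integral_density integral_distr)
  also have "\<dots> = (\<integral>w. \<phi> (y + c *\<^sub>R w) * heat 1 w \<partial>lborel)"
    unfolding eq[symmetric] by (simp add: mult_ac)
  finally show ?thesis .
qed

text \<open>\<open>P k\<close> is \<open>\<phi>\<close> mollified by the heat kernel at scale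
  1/(k+1). Its integral against \<open>g\<close> is 0 by Fubini, and \<open>P k\<close> tends to
  \<open>\<phi>\<close> boundedly.\<close>

lemma fourier_zero_bounded_continuous:
  fixes g :: "'a::euclidean_space \<Rightarrow> real"
  assumes g: "integrable lborel g"
    and F: "\<And>\<xi>. (\<integral>y. complex_of_real (g y) * cis (- (\<xi> \<bullet> y)) \<partial>lborel) = 0"
    and \<phi>: "continuous_on UNIV \<phi>" "\<And>x. \<bar>\<phi> x\<bar> \<le> 1"
  shows "(\<integral>y. g y * \<phi> y \<partial>lborel) = 0"
proof -
  have [measurable]: "g \<in> borel_measurable borel" "\<phi> \<in> borel_measurable borel"
    using g \<phi>(1) by (auto intro: borel_measurable_continuous_onI)
  define P where "P k y = (\<integral>w. \<phi> (y + (1 / Suc k) *\<^sub>R w) * heat 1 w \<partial>lborel)" for k y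
  have [measurable]: "P k \<in> borel_measurable borel" for k unfolding P_def by measurable
  have zero: "(\<integral>y. g y * P k y \<partial>lborel) = 0" for k
  proof -
    let ?r = "(1 / Suc k)\<^sup>2"
    have r: "?r > 0" by simp
    let ?f = "\<lambda>x y. g y * (\<phi> x * heat ?r (x - y))"
    have shift: "integrable lborel (\<lambda>x. heat ?r (x - y))" "(\<integral>x. heat ?r (x - y) \<partial>lborel) = 1" for y :: 'a
      using heat_integrable[OF r, where ?'a='a] heat_integral[OF r, where ?'a='a]
      by (simp_all add: integrable_lborel_shift_iff integral_lborel_shift)
    have b: "integrable lborel (\<lambda>x. ?f x y)" for y
      by (rule Bochner_Integration.integrable_bound[OF integrable_mult_right[OF shift(1)[of y], of "g y"]])
        (use \<phi>(2) in \<open>auto simp: abs_mult heat_nonneg intro!: mult_left_mono mult_left_le_one_le\<close>)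
    have int: "integrable (lborel \<Otimes>\<^sub>M lborel) (case_prod (\<lambda>y x. ?f x y))"
    proof (rule lborel_pair.Fubini_integrable)
      show "integrable lborel (\<lambda>y. \<integral>x. norm (case_prod (\<lambda>y x. ?f x y) (y, x)) \<partial>lborel)"
      proof (rule Bochner_Integration.integrable_bound[OF g], goal_cases)
        case 2
        have "(\<integral>x. \<bar>?f x y\<bar> \<partial>lborel) \<le> (\<integral>x. \<bar>g y\<bar> * heat ?r (x - y) \<partial>lborel)" for y
          by (rule integral_mono'[OF integrable_mult_right[OF shift(1)]])
            (use \<phi>(2) in \<open>auto simp: abs_mult heat_nonneg intro!: mult_left_mono mult_left_le_one_le\<close>)
        then show ?case using shift(2) by simp
      qed measurable
    qed (use b in auto)
    have "(\<integral>y. g y * P k y \<partial>lborel) = (\<integral>y. (\<integral>x. ?f x y \<partial>lborel) \<partial>lborel)"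
      unfolding P_def by (subst heat_convolution_rescale[symmetric]) auto
    also have "\<dots> = (\<integral>x. (\<integral>y. ?f x y \<partial>lborel) \<partial>lborel)"
      by (rule lborel_pair.Fubini_integral[OF int, symmetric])
    also have "\<dots> = (\<integral>x. \<phi> x * (\<integral>y. g y * heat ?r (x - y) \<partial>lborel) \<partial>lborel)"
      by (subst integral_mult_right_zero[symmetric]) (simp add: mult_ac)
    also have "\<dots> = 0" unfolding heat_fourier_zero[OF g F r] by simp
    finally show ?thesis .
  qed
  have conv: "(\<lambda>k. P k y) \<longlonglongrightarrow> \<phi> y" for y
  proof -
    have "(\<lambda>k. P k y) \<longlonglongrightarrow> (\<integral>(w::'a). \<phi> y * heat 1 w \<partial>lborel)"
      unfolding P_def
    proof (rule integral_dominated_convergence[where w = "\<lambda>w::'a. heat 1 w"])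
      show "integrable lborel (heat 1 :: 'a \<Rightarrow> real)" by (rule heat_integrable) simp
      show "AE w in lborel. (\<lambda>k. \<phi> (y + (1 / real (Suc k)) *\<^sub>R w) * heat 1 w) \<longlonglongrightarrow> \<phi> y * heat 1 w"
      proof (rule AE_I2)
        fix w :: 'a
        have "(\<lambda>k. (1 / real (Suc k)) *\<^sub>R w) \<longlonglongrightarrow> 0 *\<^sub>R w"
          using LIMSEQ_inverse_real_of_nat by (intro tendsto_scaleR tendsto_const) (simp add: inverse_eq_divide)
        then have "(\<lambda>k. y + (1 / real (Suc k)) *\<^sub>R w) \<longlonglongrightarrow> y"
          using tendsto_add[OF tendsto_const[of y]] by fastforce
        then have "(\<lambda>k. \<phi> (y + (1 / real (Suc k)) *\<^sub>R w)) \<longlonglongrightarrow> \<phi> y"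
          using \<phi>(1) by (metis UNIV_I continuous_on_eq_continuous_at isCont_tendsto_compose open_UNIV)
        then show "(\<lambda>k. \<phi> (y + (1 / real (Suc k)) *\<^sub>R w) * heat 1 w) \<longlonglongrightarrow> \<phi> y * heat 1 w"
          by (intro tendsto_mult tendsto_const)
      qed
      show "AE w in lborel. norm (\<phi> (y + (1 / real (Suc k)) *\<^sub>R w) * heat 1 w) \<le> heat 1 w" for k
        using \<phi>(2) by (auto simp: abs_mult heat_nonneg mult_left_le_one_le)
    qed auto
    then show ?thesis using heat_integral[where ?'a='a, of 1] by simp
  qed
  have Ple: "\<bar>P k y\<bar> \<le> 1" for k y
  proof -
    have "\<bar>P k y\<bar> \<le> (\<integral>w. heat 1 (w::'a) \<partial>lborel)"
      unfolding P_def using \<phi>(2) heat_integrable[where ?'a='a, of 1]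
      by (intro integral_abs_bound[THEN order_trans] integral_mono') (auto simp: abs_mult heat_nonneg mult_left_le_one_le)
    then show ?thesis using heat_integral[where ?'a='a, of 1] by simp
  qed
  have "(\<lambda>k. \<integral>y. g y * P k y \<partial>lborel) \<longlonglongrightarrow> (\<integral>y. g y * \<phi> y \<partial>lborel)"
  proof (rule integral_dominated_convergence[where w = "\<lambda>y. \<bar>g y\<bar>"])
    show "integrable lborel (\<lambda>y. \<bar>g y\<bar>)" using g by simp
    show "AE y in lborel. (\<lambda>k. g y * P k y) \<longlonglongrightarrow> g y * \<phi> y"
      by (intro AE_I2 tendsto_mult tendsto_const conv)
    show "AE y in lborel. norm (g y * P k y) \<le> \<bar>g y\<bar>" for k
      using Ple by (auto simp: abs_mult mult_left_le)
  qed auto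
  then show ?thesis unfolding zero using LIMSEQ_unique tendsto_const by blast
qed

text \<open>It suffices that \<open>g\<close> has integral 0 over every Borel set. Closed sets are
  reached by continuous functions, the others by a pi-lambda argument.\<close>

lemma fourier_zero_imp_AE_zero:
  fixes g :: "'a::euclidean_space \<Rightarrow> real"
  assumes g: "integrable lborel g"
    and F: "\<And>\<xi>. (\<integral>y. complex_of_real (g y) * cis (- (\<xi> \<bullet> y)) \<partial>lborel) = 0"
  shows "AE y in lborel. g y = 0"
proof (rule sigma_finite_measure.density_zero[OF sigma_finite_lborel g])
  have [measurable]: "g \<in> borel_measurable borel" using g by auto
  have si: "set_integrable lborel B g" if "B \<in> sets lborel" for B
    unfolding set_integrable_def by (rule integrable_mult_indicator[OF that g])
  have closed: "set_lebesgue_integral lborel A g = 0" if A: "closed A" for A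
  proof (cases "A = {}")
    case False
    \<comment> \<open>Continuous tents that equal 1 on \<open>A\<close> and are eventually 0 at each
      point off \<open>A\<close>, since a closed set has positive distance from it.\<close>
    define \<phi> where "\<phi> k x = max 0 (1 - real k * infdist x A)" for k x
    have "(\<lambda>k. \<integral>y. g y * \<phi> k y \<partial>lborel) \<longlonglongrightarrow> (\<integral>y. g y * indicator A y \<partial>lborel)"
    proof (rule integral_dominated_convergence[where w = "\<lambda>y. \<bar>g y\<bar>"])
      have "(\<lambda>k. \<phi> k y) \<longlonglongrightarrow> indicator A y" for y
      proof (cases "y \<in> A")
        case True
        then show ?thesis by (simp add: \<phi>_def)
      next
        case F: False
        have d: "infdist y A > 0" using F A False infdist_pos_not_in_closed by blast
        obtain N :: nat where N: "1 < real N * infdist y A" using reals_Archimedean3[OF d] by blast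
        have "\<phi> k y = 0" if "k \<ge> N" for k
        proof -
          have "1 < real k * infdist y A" using N that d
            by (meson less_le_trans mult_right_mono of_nat_le_iff less_imp_le)
          then show ?thesis by (simp add: \<phi>_def)
        qed
        then have "eventually (\<lambda>k. \<phi> k y = 0) sequentially" by (auto simp: eventually_sequentially)
        then show ?thesis using F by (simp add: tendsto_eventually)
      qed
      then show "AE y in lborel. (\<lambda>k. g y * \<phi> k y) \<longlonglongrightarrow> g y * indicator A y"
        by (intro AE_I2 tendsto_mult tendsto_const)
      show "AE y in lborel. norm (g y * \<phi> k y) \<le> \<bar>g y\<bar>" for k
        by (auto simp: abs_mult \<phi>_def infdist_nonneg intro!: mult_left_le)
      show "(\<lambda>y. g y * \<phi> k y) \<in> borel_measurable lborel" for k
      proof -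
        have [measurable]: "\<phi> k \<in> borel_measurable borel"
          unfolding \<phi>_def by (intro borel_measurable_continuous_onI continuous_intros)
        show ?thesis by measurable
      qed
      show "(\<lambda>y. g y * indicator A y) \<in> borel_measurable lborel"
      proof -
        have [measurable]: "A \<in> sets borel" using A by simp
        show ?thesis by measurable
      qed
    qed (use g in simp)
    moreover have "(\<integral>y. g y * \<phi> k y \<partial>lborel) = 0" for k
      by (rule fourier_zero_bounded_continuous[OF g F])
        (auto simp: \<phi>_def infdist_nonneg intro!: continuous_intros)
    ultimately show ?thesis
      by (simp add: set_lebesgue_integral_def mult.commute LIMSEQ_const_iff)
  qed (simp add: set_lebesgue_integral_def)
  fix A :: "'a set" assume "A \<in> sets lborel"
  then have A: "A \<in> sigma_sets UNIV (Collect closed)" by (simp add: borel_eq_closed)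
  \<comment> \<open>Closed sets form an intersection-stable generator. Complements are handled
    through the whole space, which is itself closed.\<close>
  have st: "Int_stable (Collect closed :: 'a set set)" by (auto simp: Int_stable_def)
  have sub: "(Collect closed :: 'a set set) \<subseteq> Pow UNIV" by simp
  show "set_lebesgue_integral lborel A g = 0"
  proof (induction rule: sigma_sets_induct_disjoint[OF st sub A])
    case (1 A) then show ?case using closed by simp
  next
    case 2 then show ?case by (simp add: set_lebesgue_integral_def)
  next
    case (3 A)
    have [simp]: "A \<in> sets borel" "UNIV - A \<in> sets borel" using 3 by (auto simp: borel_eq_closed intro: sigma_sets.Compl)
    have "set_lebesgue_integral lborel (A \<union> (UNIV - A)) g = set_lebesgue_integral lborel A g + set_lebesgue_integral lborel (UNIV - A) g"
      by (rule set_integral_Un) (auto intro!: si)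
    then show ?case using 3 closed[of UNIV] by simp
  next
    case (4 A)
    have [simp]: "A i \<in> sets borel" for i using 4 by (auto simp: borel_eq_closed)
    have "set_lebesgue_integral lborel (\<Union>i. A i) g = (\<Sum>i. set_lebesgue_integral lborel (A i) g)"
      by (rule lebesgue_integral_countable_add)
        (use 4 in \<open>auto simp: disjoint_family_on_def intro!: si\<close>)
    then show ?case using 4 by simp
  qed
qed

section \<open>The Bessel kernel\<close>

text \<open>From 1/(1+|\<xi>|^2) = \<integral> e^(-s) e^(-s|\<xi>|^2) ds over s > 0: the inverse
  transform is a Laplace superposition of heat kernels. Where the integral diverges, the value is
  0.\<close>

definition bessel :: "'a::euclidean_space \<Rightarrow> real" where
  "bessel y = (\<integral>s. indicator {0<..} s * exp (- s) * heat s y \<partial>lborel)"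

lemma bessel_nonneg: "bessel y \<ge> 0"
  unfolding bessel_def by (rule Bochner_Integration.integral_nonneg) (simp add: heat_nonneg)

lemma bessel_measurable [measurable]: "bessel \<in> borel_measurable (borel :: 'a::euclidean_space measure)"
  unfolding bessel_def by measurable

lemma exp_integral_Ioi:
  assumes "(u::real) > 0"
  shows "has_bochner_integral lborel (\<lambda>s. indicator {0<..} s * exp (- (s * u))) (1 / u)"
  using has_bochner_integral_I0i_power_exp_m[of 0, THEN lborel_has_bochner_integral_real_affine_iff[where c = u and t = 0, THEN iffD1, rotated]] assms
  by (auto simp: zero_less_mult_iff indicator_def field_simps has_bochner_integral_iff)

lemma nn_integral_exp_Ioi:
  assumes "(u::real) > 0"
  shows "(\<integral>\<^sup>+s. ennreal (indicator {0<..} s * exp (- (s * u))) \<partial>lborel) = ennreal (1 / u)"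
  using exp_integral_Ioi[OF assms] by (subst nn_integral_eq_integral) (auto simp: has_bochner_integral_iff)

text \<open>Each heat kernel has mass 1, so the total mass is the integral of e^(-s). This justifies
  all later exchanges of the integrals over s and y.\<close>

lemma bessel_product_integrable:
  "integrable (lborel \<Otimes>\<^sub>M lborel) (\<lambda>(y::'a::euclidean_space, s). indicator {0<..} s * exp (- s) * heat s y)"
proof (subst integrable_iff_bounded, intro conjI)
  have "(\<integral>\<^sup>+z. ennreal (norm (case z of (y::'a, s) \<Rightarrow> indicator {0<..} s * exp (- s) * heat s y)) \<partial>(lborel \<Otimes>\<^sub>M lborel))
     = (\<integral>\<^sup>+s. (\<integral>\<^sup>+(y::'a). ennreal (indicator {0<..} s * exp (- s)) * ennreal (heat s y) \<partial>lborel) \<partial>lborel)"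
    by (subst lborel_pair.nn_integral_snd[symmetric]) (auto simp: heat_nonneg ennreal_mult')
  also have "\<dots> = (\<integral>\<^sup>+s. ennreal (indicator {0<..} s * exp (- (s * 1))) \<partial>lborel)"
  proof (intro nn_integral_cong)
    fix s :: real
    show "(\<integral>\<^sup>+(y::'a). ennreal (indicator {0<..} s * exp (- s)) * ennreal (heat s y) \<partial>lborel) = ennreal (indicator {0<..} s * exp (- (s * 1)))"
    proof (cases "s > 0")
      case True
      then have "(\<integral>\<^sup>+(y::'a). ennreal (heat s y) \<partial>lborel) = 1"
        using heat_integral[where ?'a = 'a] by (subst nn_integral_eq_integral[OF heat_integrable]) (auto simp: heat_nonneg)
      then show ?thesis by (simp add: nn_integral_cmult)
    qed simp
  qed
  also have "\<dots> = ennreal (1 / 1)" by (rule nn_integral_exp_Ioi) simp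
  finally show "(\<integral>\<^sup>+z. ennreal (norm (case z of (y::'a, s) \<Rightarrow> indicator {0<..} s * exp (- s) * heat s y)) \<partial>(lborel \<Otimes>\<^sub>M lborel)) < \<infinity>"
    by simp
qed measurable

lemma AE_bessel_integrable:
  "AE y in lborel. integrable lborel (\<lambda>s. indicator {0<..} s * exp (- s) * heat s (y::'a::euclidean_space))"
  using lborel_pair.AE_integrable_fst'[OF bessel_product_integrable] by simp

lemma bessel_integrable: "integrable lborel (bessel :: 'a::euclidean_space \<Rightarrow> real)"
  using lborel_pair.integrable_fst'[OF bessel_product_integrable] unfolding bessel_def[abs_def] by simp

lemma bessel_fourier:
  fixes \<xi> :: "'a::euclidean_space"
  shows "(\<integral>y. complex_of_real (bessel y) * cis (- (\<xi> \<bullet> y)) \<partial>lborel) = complex_of_real (1 / (1 + (norm \<xi>)\<^sup>2))"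
proof -
  let ?f = "\<lambda>y s. complex_of_real (indicator {0<..} s * exp (- s) * heat s y) * cis (- (\<xi> \<bullet> y))"
  have int: "integrable (lborel \<Otimes>\<^sub>M lborel) (case_prod ?f)"
    by (rule Bochner_Integration.integrable_bound[OF bessel_product_integrable]) (auto simp: norm_mult)
  have "(\<integral>y. complex_of_real (bessel y) * cis (- (\<xi> \<bullet> y)) \<partial>lborel) = (\<integral>y. (\<integral>s. ?f y s \<partial>lborel) \<partial>lborel)"
    unfolding bessel_def integral_complex_of_real[symmetric] by simp
  also have "\<dots> = (\<integral>s. (\<integral>y. ?f y s \<partial>lborel) \<partial>lborel)"
    by (rule lborel_pair.Fubini_integral[OF int, symmetric])
  also have "\<dots> = (\<integral>s. complex_of_real (indicator {0<..} s * exp (- (s * (1 + (norm \<xi>)\<^sup>2)))) \<partial>lborel)"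
  proof (intro Bochner_Integration.integral_cong refl)
    fix s :: real
    show "(\<integral>y. ?f y s \<partial>lborel) = complex_of_real (indicator {0<..} s * exp (- (s * (1 + (norm \<xi>)\<^sup>2))))"
    proof (cases "s > 0")
      case True
      have "(\<integral>y. ?f y s \<partial>lborel) = complex_of_real (exp (- s)) * (\<integral>y. complex_of_real (heat s y) * cis ((- \<xi>) \<bullet> y) \<partial>lborel)"
        using True by (subst integral_mult_right_zero[symmetric]) (simp add: mult_ac)
      also have "\<dots> = complex_of_real (exp (- s) * exp (- (s * (norm \<xi>)\<^sup>2)))"
        unfolding heat_fourier[OF True] by simp
      also have "exp (- s) * exp (- (s * (norm \<xi>)\<^sup>2)) = exp (- (s * (1 + (norm \<xi>)\<^sup>2)))"
        by (simp add: algebra_simps flip: exp_add)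
      finally show ?thesis using True by simp
    qed simp
  qed
  also have "\<dots> = complex_of_real (1 / (1 + (norm \<xi>)\<^sup>2))"
    using exp_integral_Ioi[of "1 + (norm \<xi>)\<^sup>2"]
    by (simp only: integral_complex_of_real has_bochner_integral_iff) (simp add: add_pos_nonneg)
  finally show ?thesis .
qed

lemma bessel_integral: "integral\<^sup>L lborel (bessel :: 'a::euclidean_space \<Rightarrow> real) = 1"
proof -
  have "complex_of_real (integral\<^sup>L lborel (bessel :: 'a \<Rightarrow> real)) = 1"
    using bessel_fourier[of "0::'a"] by simp
  then show ?thesis by simp
qed

text \<open>The moment of the heat kernel grows like exp(n e^2 s), with n the dimension; the factor
  e^(-s) beats it if n e^2 < 1.\<close>

lemma bessel_exp_moment:
  fixes e :: real
  assumes e: "e \<ge> 0" "DIM('a) * e\<^sup>2 < 1"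
  shows "integrable lborel (\<lambda>y::'a::euclidean_space. bessel y * exp (e * norm y))"
proof (subst integrable_iff_bounded, intro conjI)
  let ?u = "1 - DIM('a) * e\<^sup>2"
  have "(\<integral>\<^sup>+(y::'a). ennreal (norm (bessel y * exp (e * norm y))) \<partial>lborel)
     = (\<integral>\<^sup>+(y::'a). (\<integral>\<^sup>+s. ennreal (indicator {0<..} s * exp (- s) * heat s y * exp (e * norm y)) \<partial>lborel) \<partial>lborel)"
  proof (rule nn_integral_cong_AE, use AE_bessel_integrable in eventually_elim)
    case (elim y)
    have "(\<integral>\<^sup>+s. ennreal (indicator {0<..} s * exp (- s) * heat s y * exp (e * norm y)) \<partial>lborel)
      = ennreal (\<integral>s. indicator {0<..} s * exp (- s) * heat s y * exp (e * norm y) \<partial>lborel)"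
      by (rule nn_integral_eq_integral) (use elim in \<open>auto simp: heat_nonneg\<close>)
    then show ?case by (simp add: bessel_def[symmetric] bessel_nonneg)
  qed
  also have "\<dots> = (\<integral>\<^sup>+s. (\<integral>\<^sup>+(y::'a). ennreal (indicator {0<..} s * exp (- s)) * ennreal (heat s y * exp (e * norm y)) \<partial>lborel) \<partial>lborel)"
    by (subst lborel_pair.Fubini') (auto simp: ennreal_mult'[symmetric] mult.assoc)
  also have "\<dots> \<le> (\<integral>\<^sup>+s. ennreal (2 ^ DIM('a)) * ennreal (indicator {0<..} s * exp (- (s * ?u))) \<partial>lborel)"
  proof (intro nn_integral_mono)
    fix s :: real
    show "(\<integral>\<^sup>+(y::'a). ennreal (indicator {0<..} s * exp (- s)) * ennreal (heat s y * exp (e * norm y)) \<partial>lborel)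
      \<le> ennreal (2 ^ DIM('a)) * ennreal (indicator {0<..} s * exp (- (s * ?u)))"
    proof (cases "s > 0")
      case True
      have "(\<integral>\<^sup>+(y::'a). ennreal (indicator {0<..} s * exp (- s)) * ennreal (heat s y * exp (e * norm y)) \<partial>lborel)
        = ennreal (exp (- s)) * (\<integral>\<^sup>+(y::'a). ennreal (heat s y * exp (e * norm y)) \<partial>lborel)"
        using True by (subst nn_integral_cmult) auto
      also have "\<dots> \<le> ennreal (exp (- s)) * ennreal (2 ^ DIM('a) * exp (DIM('a) * e\<^sup>2 * s))"
        by (intro mult_left_mono heat_exp_moment True e(1)) auto
      also have "\<dots> = ennreal (2 ^ DIM('a) * (exp (- s) * exp (DIM('a) * e\<^sup>2 * s)))"
        by (subst ennreal_mult[symmetric]) (auto simp: mult_ac)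
      also have "exp (- s) * exp (DIM('a) * e\<^sup>2 * s) = exp (- (s * ?u))"
        by (simp add: algebra_simps flip: exp_add)
      finally show ?thesis using True by (simp add: ennreal_mult')
    qed simp
  qed
  also have "\<dots> = ennreal (2 ^ DIM('a)) * ennreal (1 / ?u)"
    using e by (subst nn_integral_cmult) (simp_all add: nn_integral_exp_Ioi del: ennreal_numeral)
  also have "\<dots> < \<infinity>" by (simp add: ennreal_mult_less_top)
  finally show "(\<integral>\<^sup>+(y::'a). ennreal (norm (bessel y * exp (e * norm y))) \<partial>lborel) < \<infinity>" .
qed measurable

text \<open>Only s in [1+|y|, 2+|y|], an interval of length 1, is kept. There e^(-s), the Gaussian
  factor and the normalisation contribute decay rates 1, 1 and n, which add up to n + 2.\<close>

lemma bessel_lower_bound: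
  "AE y in lborel. bessel (y::'a::euclidean_space)
      \<ge> exp (- 2) * (1 / (8 * pi)) ^ DIM('a) * exp (- ((real DIM('a) + 2) * norm y))"
  using AE_bessel_integrable
proof eventually_elim
  case (elim y)
  let ?n = "DIM('a)" let ?r = "norm y"
  let ?c = "exp (- 2) * (1 / (8 * pi)) ^ ?n * exp (- ((real ?n + 2) * ?r))"
  have le: "?c \<le> exp (- s) * heat s y" if s: "s \<in> {1 + ?r..2 + ?r}" for s
  proof -
    have s0: "s > 0" "s \<ge> 1" using s norm_ge_zero[of y] by (auto simp del: norm_ge_zero)
    have 1: "exp (- 2) * exp (- ?r) \<le> exp (- s)" using s by (simp flip: exp_add)
    have "?r \<le> 4 * s" using s s0 by auto
    then have "?r\<^sup>2 \<le> ?r * (4 * s)" unfolding power2_eq_square by (rule mult_left_mono) simp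
    then have 2: "exp (- ?r) \<le> exp (- ?r\<^sup>2 / (4 * s))" using s0 by (simp add: field_simps)
    have "1 + ?r \<le> exp ?r" by (rule exp_ge_add_one_self)
    then have "s \<le> 2 * exp ?r" using s norm_ge_zero[of y] unfolding atLeastAtMost_iff by linarith
    then have "4 * pi * s \<le> 8 * pi * exp ?r" by simp
    moreover have "sqrt (4 * pi * s) \<le> 4 * pi * s"
    proof -
      have "4 * pi * s \<ge> 1 * 1 * 1" using pi_ge_two s0 by (intro mult_mono) auto
      then show ?thesis by (intro real_le_lsqrt) (auto intro: self_le_power simp del: power_mult_distrib)
    qed
    ultimately have "sqrt (4 * pi * s) \<le> 8 * pi * exp ?r" by linarith
    then have "1 / (8 * pi * exp ?r) \<le> 1 / sqrt (4 * pi * s)" using s0 by (intro divide_left_mono) auto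
    then have "(1 / (8 * pi) * exp (- ?r)) ^ ?n \<le> (1 / sqrt (4 * pi * s)) ^ ?n"
      by (intro power_mono) (auto simp: exp_minus field_simps)
    then have 3: "(1 / (8 * pi)) ^ ?n * exp (- (?n * ?r)) \<le> (1 / sqrt (4 * pi * s)) ^ ?n"
      using exp_of_nat_mult[of ?n "- ?r"] by (simp only: power_mult_distrib mult_minus_right)
    have "?c = (exp (- 2) * exp (- ?r)) * (((1 / (8 * pi)) ^ ?n * exp (- (?n * ?r))) * exp (- ?r))"
      by (simp add: algebra_simps flip: exp_add)
    also have "\<dots> \<le> exp (- s) * ((1 / sqrt (4 * pi * s)) ^ ?n * exp (- ?r\<^sup>2 / (4 * s)))"
      using s0 by (intro mult_mono 1 2 3) (auto intro!: mult_nonneg_nonneg zero_le_power)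
    finally show ?thesis using s0 by (simp add: heat_eq)
  qed
  have "?c = (\<integral>s. ?c * indicator {1 + ?r..2 + ?r} s \<partial>lborel)" by simp
  also have "\<dots> \<le> bessel y"
    unfolding bessel_def
  proof (rule integral_mono'[OF elim])
    fix s
    show "?c * indicator {1 + ?r..2 + ?r} s \<le> indicator {0<..} s * exp (- s) * heat s y"
      using le[of s] norm_ge_zero[of y] heat_nonneg[of s y] by (auto simp: indicator_def simp del: norm_ge_zero)
    show "0 \<le> indicator {0<..} s * exp (- s) * heat s y" by (simp add: heat_nonneg)
  qed
  finally show ?case .
qed

text \<open>\<open>bessel\<close> witnesses the property by which \<open>Bker\<close> is chosen, so
  \<open>Bker\<close> has it too; equal Fourier transforms then force equality almost
  everywhere.\<close>

lemma Bker_AE_eq_bessel: "AE y in lebesgue. Bker y = bessel (y :: real^'n)"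
proof -
  have borel_case: "(\<integral>y. complex_of_real (h y) * cis (- (\<xi> \<bullet> y)) \<partial>lebesgue) = (\<integral>y. complex_of_real (h y) * cis (- (\<xi> \<bullet> y)) \<partial>lborel)"
    if "h \<in> borel_measurable borel" for h :: "real^'n \<Rightarrow> real" and \<xi>
    using that by (intro integral_completion) simp
  let ?P = "\<lambda>g::real^'n \<Rightarrow> real. integrable lebesgue g \<and>
     (\<forall>\<xi>. (\<integral>y. complex_of_real (g y) * cis (- (\<xi> \<bullet> y)) \<partial>lebesgue) = complex_of_real (1 / (1 + (norm \<xi>)\<^sup>2)))"
  have "?P bessel"
    using bessel_integrable bessel_fourier borel_case[OF bessel_measurable]
    by (auto simp: integrable_completion)
  then have P: "?P Bker" unfolding Bker_def by (rule someI[of ?P])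
  then have "Bker \<in> borel_measurable (completion lborel :: (real^'n) measure)" by auto
  \<comment> \<open>\<open>Bker\<close> is known only to be Lebesgue measurable, while the
    uniqueness result concerns Borel functions; hence a Borel representative.\<close>
  then obtain h :: "real^'n \<Rightarrow> real" where h: "h \<in> borel_measurable lborel" and eq: "AE y in lborel. Bker y = h y"
    using completion_ex_borel_measurable_real by blast
  have h' [measurable]: "h \<in> borel_measurable borel" using h by simp
  have eq': "AE y in lebesgue. Bker y = h y" using eq by (rule AE_completion)
  have "integrable lebesgue h"
    using P eq' h by (subst integrable_cong_AE[of _ _ Bker]) (auto intro: measurable_completion)
  then have hi: "integrable lborel h" by (simp add: integrable_completion)
  have hF: "(\<integral>y. complex_of_real (h y) * cis (- (\<xi> \<bullet> y)) \<partial>lborel) = complex_of_real (1 / (1 + (norm \<xi>)\<^sup>2))" for \<xi>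
  proof -
    have "(\<integral>y. complex_of_real (h y) * cis (- (\<xi> \<bullet> y)) \<partial>lebesgue) = (\<integral>y. complex_of_real (Bker y) * cis (- (\<xi> \<bullet> y)) \<partial>lebesgue)"
    proof (rule integral_cong_AE)
      have [measurable]: "(\<lambda>y. cis (- (\<xi> \<bullet> y))) \<in> borel_measurable lebesgue"
        by (intro measurable_completion) measurable
      have [measurable]: "h \<in> borel_measurable lebesgue" using h by (rule measurable_completion)
      have [measurable]: "Bker \<in> borel_measurable (lebesgue :: (real^'n) measure)" using P by auto
      show "(\<lambda>y. complex_of_real (h y) * cis (- (\<xi> \<bullet> y))) \<in> borel_measurable lebesgue" by measurable
      show "(\<lambda>y. complex_of_real (Bker y) * cis (- (\<xi> \<bullet> y))) \<in> borel_measurable lebesgue" by measurable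
    qed (use eq' in auto)
    then show ?thesis using P borel_case[OF h', of \<xi>] by simp
  qed
  have "AE y in lborel. h y - bessel y = 0"
  proof (rule fourier_zero_imp_AE_zero)
    show "integrable lborel (\<lambda>y. h y - bessel y)" using hi bessel_integrable by auto
    fix \<xi> :: "real^'n"
    have int: "integrable lborel (\<lambda>y. complex_of_real (f y) * cis (- (\<xi> \<bullet> y)))" if f: "integrable lborel f" for f :: "real^'n \<Rightarrow> real"
    proof (rule Bochner_Integration.integrable_bound[OF f])
      have [measurable]: "f \<in> borel_measurable borel" using f by auto
      show "(\<lambda>y. complex_of_real (f y) * cis (- (\<xi> \<bullet> y))) \<in> borel_measurable lborel" by measurable
    qed (simp add: norm_mult)
    show "(\<integral>y. complex_of_real (h y - bessel y) * cis (- (\<xi> \<bullet> y)) \<partial>lborel) = 0"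
      using hF[of \<xi>] bessel_fourier[of \<xi>] int[OF hi] int[OF bessel_integrable]
      by (simp add: left_diff_distrib)
  qed
  then have "AE y in lebesgue. h y - bessel y = 0" by (rule AE_completion)
  with eq' show ?thesis by eventually_elim simp
qed

section \<open>s-solutions as fixed points\<close>

lemma lebesgue_integral_eq_lborel_integral_AE:
  fixes f g :: "'a::euclidean_space \<Rightarrow> real"
  assumes g: "g \<in> borel_measurable borel" and eq: "AE x in lebesgue. f x = g x"
  shows "integral\<^sup>L lebesgue f = integral\<^sup>L lborel g"
proof -
  have g': "g \<in> borel_measurable lebesgue" using g by (intro measurable_completion) simp
  have "AE x in lebesgue. g x = f x" using eq by eventually_elim simp
  then have "f \<in> borel_measurable lebesgue" by (rule borel_measurable_AE[OF g'])
  then have "integral\<^sup>L lebesgue f = integral\<^sup>L lebesgue g" by (rule integral_cong_AE[OF _ g' eq])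
  also have "\<dots> = integral\<^sup>L lborel g" using g by (intro integral_completion) simp
  finally show ?thesis .
qed

lemma AE_lborel_reflect:
  fixes x :: "'a::euclidean_space"
  assumes "AE z in lborel. P z"
  shows "AE y in lborel. P (x - y)"
proof -
  have eq: "distr lborel borel (\<lambda>y. x - y) = lborel" using lborel_distr_isometric_affine[of "-1" x] by simp
  have "AE z in distr lborel borel (\<lambda>y. x - y). P z" unfolding eq by (rule assms)
  then show ?thesis by (rule AE_distrD[rotated]) simp
qed

text \<open>Equality almost everywhere is preserved by the reflection y to x - y, so the chosen
  kernel can be replaced under the integral at every x.\<close>

lemma Bop_eq:
  fixes \<psi> :: "real^'n \<Rightarrow> real"
  assumes [measurable]: "\<psi> \<in> borel_measurable borel"
  shows "Bop \<psi> x = (\<integral>y. bessel y * \<psi> (x - y) \<partial>lborel)"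
proof -
  have "AE z in lborel. Bker z = bessel (z :: real^'n)"
    using Bker_AE_eq_bessel by (simp add: AE_completion_iff)
  then have "AE y in lebesgue. Bker (x - y) = bessel (x - y)"
    by (intro AE_completion AE_lborel_reflect)
  then have "AE y in lebesgue. Bker (x - y) * \<psi> y = bessel (x - y) * \<psi> y" by eventually_elim simp
  then have "Bop \<psi> x = (\<integral>y. bessel (x - y) * \<psi> y \<partial>lborel)"
    unfolding Bop_def by (intro lebesgue_integral_eq_lborel_integral_AE) measurable
  also have "\<dots> = (\<integral>y. bessel (x - y) * \<psi> (x - (x - y)) \<partial>lborel)" by simp
  also have "\<dots> = (\<integral>y. bessel y * \<psi> (x - y) \<partial>lborel)"
    by (rule integral_lborel_reflect[of "\<lambda>y. bessel y * \<psi> (x - y)"]) measurable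
  finally show ?thesis .
qed

section \<open>The weighted norm and the solution class\<close>

lemma BC_weighted_bound:
  fixes \<psi> :: "real^'n \<Rightarrow> real"
  assumes "\<psi> \<in> BC a" "a \<ge> 0"
  obtains C where "C \<ge> 0" "\<And>x. \<bar>\<psi> x\<bar> \<le> C * (1 + norm x) powr a"
proof -
  obtain C R where C: "\<And>x. norm x \<ge> R \<Longrightarrow> \<bar>\<psi> x\<bar> \<le> C * pw (norm x) a" and cont: "continuous_on UNIV \<psi>"
    using assms(1) by (auto simp: BC_def)
  have "bounded (\<psi> ` cball 0 R)"
    by (intro compact_imp_bounded compact_continuous_image continuous_on_subset[OF cont]) auto
  then obtain B where B: "\<And>x. norm x \<le> R \<Longrightarrow> \<bar>\<psi> x\<bar> \<le> B" by (force simp: bounded_iff)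
  show ?thesis
  proof (rule that[of "max 0 (max B C)"])
    fix x :: "real^'n"
    have w: "(1 + norm x) powr a \<ge> 1" using assms(2) by (intro ge_one_powr_ge_zero) auto
    show "\<bar>\<psi> x\<bar> \<le> max 0 (max B C) * (1 + norm x) powr a"
    proof (cases "norm x \<ge> R")
      case True
      have "\<bar>\<psi> x\<bar> \<le> C * pw (norm x) a" by (rule C[OF True])
      also have "\<dots> \<le> max 0 (max B C) * (1 + norm x) powr a"
        using pw_le_powr[OF norm_ge_zero assms(2), of x] pw_nonneg[OF norm_ge_zero, of x a]
        by (intro mult_mono) auto
      finally show ?thesis .
    next
      case False
      then have "\<bar>\<psi> x\<bar> \<le> B" by (intro B) auto
      also have "\<dots> \<le> max 0 (max B C) * 1" by simp
      also have "\<dots> \<le> max 0 (max B C) * (1 + norm x) powr a" by (intro mult_left_mono w) auto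
      finally show ?thesis .
    qed
  qed simp
qed

lemma one_plus_norm_powr_pos: "(1 + norm x) powr a > 0"
  using norm_ge_zero[of x] unfolding powr_gt_zero by linarith

text \<open>A real supremum is an upper bound only for a bounded set; the premise with some
  \<open>C\<close> provides the boundedness.\<close>

lemma wnorm_upper:
  assumes "\<And>x. \<bar>\<psi> x\<bar> \<le> C * (1 + norm x) powr a"
  shows "\<bar>\<psi> x\<bar> \<le> wnorm a \<psi> * (1 + norm x) powr a"
proof -
  have "bdd_above (range (\<lambda>x. \<bar>\<psi> x\<bar> / (1 + norm x) powr a))"
    using assms by (intro bdd_aboveI2[of _ _ C]) (simp only: pos_divide_le_eq[OF one_plus_norm_powr_pos])
  then have "\<bar>\<psi> x\<bar> / (1 + norm x) powr a \<le> wnorm a \<psi>"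
    unfolding wnorm_def by (intro cSUP_upper) auto
  then show ?thesis using one_plus_norm_powr_pos[of x a] by (simp add: divide_le_eq)
qed

lemma wnorm_least:
  assumes "\<And>x. \<bar>\<psi> x\<bar> \<le> C * (1 + norm x) powr a"
  shows "wnorm a \<psi> \<le> C"
  unfolding wnorm_def
  by (intro cSUP_least) (simp_all only: pos_divide_le_eq[OF one_plus_norm_powr_pos] assms UNIV_not_empty not_False_eq_True)

lemma wnorm_nonneg:
  assumes "\<And>x. \<bar>\<psi> x\<bar> \<le> C * (1 + norm x) powr a"
  shows "wnorm a \<psi> \<ge> 0"
  using wnorm_upper[OF assms, of 0] by (simp add: order_trans[OF abs_ge_zero])

text \<open>Norm continuity in time makes the weighted norm continuous, hence bounded on compact
  time intervals. It also controls time increments locally uniformly in x, which with continuity of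
  each time slice gives joint continuity.\<close>

lemma Zinf_imp_adm:
  fixes \<mu> :: "real^'n \<Rightarrow> real \<Rightarrow> real"
  assumes Z: "Zinf a \<mu>" and a: "a \<ge> 0" and nonneg: "\<And>x t. t \<ge> 0 \<Longrightarrow> 0 \<le> \<mu> x t"
  shows "adm a \<mu>"
proof -
  define \<omega> where "\<omega> s t = wnorm a (\<lambda>x. \<mu> x t - \<mu> x s)" for s t
  have bnd: "\<exists>C. \<forall>x. \<bar>\<mu> x t\<bar> \<le> C * (1 + norm x) powr a" if t: "t \<ge> 0" for t
  proof -
    have "(\<lambda>x. \<mu> x t) \<in> BC a" using Z t unfolding Zinf_def by blast
    then obtain C where "\<And>x. \<bar>\<mu> x t\<bar> \<le> C * (1 + norm x) powr a" using BC_weighted_bound[OF _ a] by blast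
    then show ?thesis by blast
  qed
  have diff_bnd: "\<exists>C. \<forall>x. \<bar>\<mu> x t - \<mu> x s\<bar> \<le> C * (1 + norm x) powr a" if ts: "t \<ge> 0" "s \<ge> 0" for t s
  proof -
    obtain C D where C: "\<And>x. \<bar>\<mu> x t\<bar> \<le> C * (1 + norm x) powr a" and D: "\<And>x. \<bar>\<mu> x s\<bar> \<le> D * (1 + norm x) powr a"
      using bnd[OF ts(1)] bnd[OF ts(2)] by blast
    have "\<bar>\<mu> x t - \<mu> x s\<bar> \<le> (C + D) * (1 + norm x) powr a" for x
      unfolding distrib_right using C[of x] D[of x] by linarith
    then show ?thesis by blast
  qed
  have dle: "\<bar>\<mu> x t - \<mu> x s\<bar> \<le> \<omega> s t * (1 + norm x) powr a" if "t \<ge> 0" "s \<ge> 0" for x t s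
  proof -
    from diff_bnd[OF that] obtain C where "\<And>x. \<bar>\<mu> x t - \<mu> x s\<bar> \<le> C * (1 + norm x) powr a" by blast
    then show ?thesis unfolding \<omega>_def by (rule wnorm_upper)
  qed
  have \<omega>0: "\<omega> s t \<ge> 0" if "t \<ge> 0" "s \<ge> 0" for s t
  proof -
    from diff_bnd[OF that] obtain C where "\<And>x. \<bar>\<mu> x t - \<mu> x s\<bar> \<le> C * (1 + norm x) powr a" by blast
    then show ?thesis unfolding \<omega>_def by (rule wnorm_nonneg)
  qed
  \<comment> \<open>The limit in \<open>Zinf\<close> disregards the value at \<open>s\<close>; this
    value is needed for time sequences that hit their limit.\<close>
  have \<omega>ss: "\<omega> s s = 0" for s by (simp add: \<omega>_def wnorm_def)
  have \<omega>lim: "(\<omega> s \<longlongrightarrow> 0) (at s within {0..})" if "s \<ge> 0" for s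
    using Z that unfolding Zinf_def \<omega>_def by blast
  have bound: "\<exists>C. \<forall>x. \<forall>t\<in>{0..T}. \<mu> x t \<le> C * (1 + norm x) powr a" for T
  proof -
    \<comment> \<open>The weighted norm of the time slice; it varies by at most
      \<open>\<omega>\<close>.\<close>
    define N where "N t = wnorm a (\<lambda>x. \<mu> x t)" for t
    have Nle: "\<bar>\<mu> x t\<bar> \<le> N t * (1 + norm x) powr a" if "t \<ge> 0" for x t
    proof -
      from bnd[OF that] obtain C where "\<And>x. \<bar>\<mu> x t\<bar> \<le> C * (1 + norm x) powr a" by blast
      then show ?thesis unfolding N_def by (rule wnorm_upper)
    qed
    have Nd: "N t \<le> N s + D" if "s \<ge> 0" "\<And>x. \<bar>\<mu> x t - \<mu> x s\<bar> \<le> D * (1 + norm x) powr a" for s t D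
      unfolding N_def[of t]
    proof (rule wnorm_least)
      fix x
      show "\<bar>\<mu> x t\<bar> \<le> (N s + D) * (1 + norm x) powr a"
        unfolding distrib_right using Nle[OF that(1), of x] that(2)[of x] by linarith
    qed
    have "continuous (at s within {0..}) N" if s: "s \<ge> 0" for s
    proof -
      have "eventually (\<lambda>t. norm (N t - N s) \<le> \<omega> s t) (at s within {0..})"
      proof (rule eventually_mono)
        show "eventually (\<lambda>t. t \<in> {0..}) (at s within {0..})" by (simp add: eventually_at_filter)
        fix t :: real assume "t \<in> {0..}"
        then have t: "t \<ge> 0" by simp
        have "N t \<le> N s + \<omega> s t" using dle[OF t s] by (intro Nd[OF s])
        moreover have "N s \<le> N t + \<omega> s t" using dle[OF t s] by (intro Nd[OF t]) (simp add: abs_minus_commute)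
        ultimately show "norm (N t - N s) \<le> \<omega> s t" by (simp add: abs_le_iff)
      qed
      then have "((\<lambda>t. N t - N s) \<longlongrightarrow> 0) (at s within {0..})" using \<omega>lim[OF s] by (rule Lim_null_comparison)
      then show ?thesis unfolding continuous_within by (rule LIM_zero_cancel)
    qed
    then have "continuous_on {0..} N" by (simp add: continuous_on_eq_continuous_within)
    then have "bounded (N ` {0..T})"
      by (intro compact_imp_bounded compact_continuous_image) (auto intro: continuous_on_subset)
    then obtain B where B': "\<And>y. y \<in> N ` {0..T} \<Longrightarrow> norm y \<le> B" unfolding bounded_iff by blast
    have B: "\<bar>N t\<bar> \<le> B" if "t \<in> {0..T}" for t using B'[of "N t"] that by simp
    show ?thesis
    proof (intro exI[of _ B] allI ballI)
      fix x t assume t: "t \<in> {0..T}"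
      have "\<mu> x t \<le> N t * (1 + norm x) powr a" using Nle[of t x] t by simp
      also have "\<dots> \<le> B * (1 + norm x) powr a" using B[OF t] by (intro mult_right_mono) auto
      finally show "\<mu> x t \<le> B * (1 + norm x) powr a" .
    qed
  qed
  have "continuous_on (UNIV \<times> {0..}) (\<lambda>(x, t). \<mu> x t)"
  proof (rule continuous_on_half_spaceI)
    fix X :: "nat \<Rightarrow> real^'n" and S x t
    assume X: "X \<longlonglongrightarrow> x" and S: "S \<longlonglongrightarrow> t" and S0: "\<And>n. S n \<ge> 0" and t0: "t \<ge> (0::real)"
    have "continuous (at t within {0..}) (\<omega> t)" unfolding continuous_within \<omega>ss using \<omega>lim[OF t0] .
    then have "(\<lambda>n. \<omega> t (S n)) \<longlonglongrightarrow> \<omega> t t"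
      using S S0 by (intro continuous_within_tendsto_compose'[of t "{0..}" "\<omega> t"]) auto
    moreover have "(\<lambda>n. (1 + norm (X n)) powr a) \<longlonglongrightarrow> (1 + norm x) powr a"
      using norm_ge_zero[of x] by (intro tendsto_intros X) linarith
    ultimately have "(\<lambda>n. \<omega> t (S n) * (1 + norm (X n)) powr a) \<longlonglongrightarrow> \<omega> t t * (1 + norm x) powr a"
      by (rule tendsto_mult)
    then have "(\<lambda>n. \<omega> t (S n) * (1 + norm (X n)) powr a) \<longlonglongrightarrow> 0" by (simp add: \<omega>ss)
    moreover have "\<forall>\<^sub>F n in sequentially. norm (\<mu> (X n) (S n) - \<mu> (X n) t) \<le> \<omega> t (S n) * (1 + norm (X n)) powr a"
      using dle[OF S0 t0] by simp
    ultimately have 1: "(\<lambda>n. \<mu> (X n) (S n) - \<mu> (X n) t) \<longlonglongrightarrow> 0" by (rule Lim_null_comparison[rotated])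
    have "continuous_on UNIV (\<lambda>x. \<mu> x t)" using Z t0 unfolding Zinf_def BC_def by blast
    then have 2: "(\<lambda>n. \<mu> (X n) t) \<longlonglongrightarrow> \<mu> x t"
      using X by (auto simp: continuous_on_eq_continuous_at intro: isCont_tendsto_compose)
    from tendsto_add[OF 1 2] show "(\<lambda>n. \<mu> (X n) (S n)) \<longlonglongrightarrow> \<mu> x t" by simp
  qed
  then show ?thesis unfolding adm_def using nonneg bound by blast
qed

text \<open>Admissible functions may oscillate in time ever faster for large |x| and need not be
  norm continuous. A time integral of one is locally Lipschitz in time in the weighted norm.\<close>

lemma time_integral_imp_Zinf:
  fixes g \<mu> :: "real^'n \<Rightarrow> real \<Rightarrow> real"
  assumes g: "adm a g" and a: "a \<ge> 0" and \<mu>: "\<And>x t. t \<ge> 0 \<Longrightarrow> \<mu> x t = integral {0..t} (g x)"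
  shows "Zinf a \<mu>"
  unfolding Zinf_def
proof (intro conjI allI impI)
  fix t :: real assume t: "t \<ge> 0"
  have int: "adm a (\<lambda>x t. integral {0..t} (g x))" by (rule adm_time_integral[OF g])
  obtain C where C: "C \<ge> 0" "\<And>x t'. t' \<in> {0..t} \<Longrightarrow> integral {0..t'} (g x) \<le> C * (1 + norm x) powr a"
    using adm_bound[OF int] by blast
  have "\<bar>\<mu> x t\<bar> \<le> C * 2 powr a * pw (norm x) a" if "norm x \<ge> 1" for x
  proof -
    have "(1 + norm x) powr a \<le> (2 * norm x) powr a" using that a by (intro powr_mono2) auto
    also have "\<dots> = 2 powr a * pw (norm x) a" using that by (auto simp: powr_mult pw_def)
    finally have "C * (1 + norm x) powr a \<le> C * (2 powr a * pw (norm x) a)" using C(1) by (rule mult_left_mono)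
    moreover have "\<bar>\<mu> x t\<bar> \<le> C * (1 + norm x) powr a" using C(2)[of t x] t \<mu>[OF t] adm_nonneg[OF int t, of x] by simp
    ultimately show ?thesis by simp
  qed
  moreover have "continuous_on UNIV (\<lambda>x. \<mu> x t)" using adm_continuous_space[OF int t] \<mu>[OF t] by simp
  ultimately show "(\<lambda>x. \<mu> x t) \<in> BC a" unfolding BC_def by blast
next
  fix s :: real assume s: "s \<ge> 0"
  obtain C where C: "C \<ge> 0" "\<And>x t'. t' \<in> {0..s + 1} \<Longrightarrow> g x t' \<le> C * (1 + norm x) powr a"
    using adm_bound[OF g] by blast
  have le: "\<bar>\<mu> x t - \<mu> x s\<bar> \<le> (C * \<bar>t - s\<bar>) * (1 + norm x) powr a" if t: "t \<in> {0..s + 1}" for x t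
  proof -
    have "\<bar>integral {0..t} (g x) - integral {0..s} (g x)\<bar> \<le> (C * (1 + norm x) powr a) * \<bar>t - s\<bar>"
      using t s C(2) adm_nonneg[OF g]
      by (intro time_integral_Lipschitz[of _ "s + 1"] adm_continuous_time[OF g]) auto
    then show ?thesis using t s \<mu> by (simp add: mult_ac)
  qed
  have "eventually (\<lambda>t. norm (wnorm a (\<lambda>x. \<mu> x t - \<mu> x s)) \<le> C * \<bar>t - s\<bar>) (at s within {0..})"
  proof (rule eventually_mono)
    show "eventually (\<lambda>t. t \<in> {0..s + 1}) (at s within {0..})"
      unfolding eventually_at by (intro exI[of _ 1]) (auto simp: dist_real_def)
    fix t assume t: "t \<in> {0..s + 1}"
    show "norm (wnorm a (\<lambda>x. \<mu> x t - \<mu> x s)) \<le> C * \<bar>t - s\<bar>"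
      using wnorm_least[of "\<lambda>x. \<mu> x t - \<mu> x s", OF le[OF t]] wnorm_nonneg[of "\<lambda>x. \<mu> x t - \<mu> x s", OF le[OF t]] by simp
  qed
  moreover have "((\<lambda>t. C * \<bar>t - s\<bar>) \<longlongrightarrow> 0) (at s within {0..})"
  proof -
    have "((\<lambda>t. C * \<bar>t - s\<bar>) \<longlongrightarrow> C * \<bar>s - s\<bar>) (at s within {0..})" by (intro tendsto_intros)
    then show ?thesis by simp
  qed
  ultimately show "((\<lambda>t. wnorm a (\<lambda>x. \<mu> x t - \<mu> x s)) \<longlongrightarrow> 0) (at s within {0..})"
    by (rule Lim_null_comparison)
qed

lemma LINT_Icc_eq_integral:
  fixes h :: "real \<Rightarrow> real"
  assumes "continuous_on {0..} h"
  shows "(LINT \<tau>:{0..t}|lborel. h \<tau>) = integral {0..t} h"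
proof -
  have "continuous_on {0..t} h" using assms by (rule continuous_on_subset) auto
  then show ?thesis by (intro set_borel_integral_eq_integral borel_integrable_atLeastAtMost')
qed

context pseudoparabolic
begin

text \<open>The difference of \<open>Nl f\<close> and \<open>f\<close>. The s-solution equation
  integrates the two parts separately, so they are needed one by one.\<close>

definition react :: "('a \<Rightarrow> real \<Rightarrow> real) \<Rightarrow> 'a \<Rightarrow> real \<Rightarrow> real" where
  "react f x t = exp ((1 - p) * t) * (W x t * f x t powr p)"

lemma adm_react:
  assumes f: "adm a f"
  shows "adm a (react f)"
proof -
  have eq: "react f x t = Nl f x t - f x t" for x t by (simp add: react_def Nl_def)
  have "continuous_on (UNIV \<times> {0..}) (\<lambda>z. (\<lambda>(x, t). Nl f x t) z - (\<lambda>(x, t). f x t) z)"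
    by (intro continuous_on_diff adm_continuous[OF f] adm_continuous[OF adm_Nl[OF f]])
  then have "continuous_on (UNIV \<times> {0..}) (\<lambda>(x, t). react f x t)" by (simp add: eq case_prod_beta')
  moreover have "0 \<le> react f x t" if "t \<ge> 0" for x t using W_nonneg[OF that] by (simp add: react_def)
  moreover have "\<exists>C. \<forall>x. \<forall>t\<in>{0..T}. react f x t \<le> C * (1 + norm x) powr a" for T
  proof -
    obtain C where C: "\<And>x t. t \<in> {0..T} \<Longrightarrow> Nl f x t \<le> C * (1 + norm x) powr a"
      using adm_bound[OF adm_Nl[OF f]] by blast
    have "react f x t \<le> C * (1 + norm x) powr a" if t: "t \<in> {0..T}" for x t
      using C[OF t, of x] adm_nonneg[OF f, of t x] t by (simp add: eq)
    then show ?thesis by blast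
  qed
  ultimately show ?thesis unfolding adm_def by blast
qed

lemma K_Nl:
  assumes f: "adm a f" and t: "t \<ge> 0"
  shows "K (\<lambda>y. Nl f y t) x = K (\<lambda>y. f y t) x + K (\<lambda>y. react f y t) x"
proof -
  have "Nl f y t = f y t + react f y t" for y by (simp add: react_def Nl_def)
  then show ?thesis
    unfolding K_def using K_integrable[OF f a_nonneg t, of x] K_integrable[OF adm_react[OF f] a_nonneg t, of x]
    by (simp add: distrib_left)
qed

text \<open>The factor e^((1-p)\<kappa>) of the time weight and e^(p\<kappa>) from the power combine
  to the same e^\<kappa> as in the linear term, which can therefore be taken out. What remains is
  the operator for the potential shifted by \<kappa>, written out because it belongs to another
  instance of the locale.\<close>

lemma Phi_shift:
  assumes f: "adm a f" and \<kappa>: "\<kappa> \<ge> 0"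
    and zero: "\<And>x t. t \<in> {0..\<kappa>} \<Longrightarrow> f x t = 0" and fg: "\<And>x t. t \<ge> 0 \<Longrightarrow> f x (t + \<kappa>) = exp \<kappa> * g x t"
    and g: "\<And>x t. t \<ge> 0 \<Longrightarrow> 0 \<le> g x t"
  shows "t \<in> {0..\<kappa>} \<Longrightarrow> \<Phi> f x t = 0"
    and "t \<ge> 0 \<Longrightarrow> \<Phi> f x (t + \<kappa>)
      = exp \<kappa> * integral {0..t} (\<lambda>\<tau>. K (\<lambda>y. g y \<tau> + exp ((1 - p) * \<tau>) * (W y (\<tau> + \<kappa>) * g y \<tau> powr p)) x)"
proof -
  have K0: "K (\<lambda>y. Nl f y \<tau>) x = 0" if "\<tau> \<in> {0..\<kappa>}" for \<tau>
    unfolding K_def Nl_def zero[OF that] by simp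
  show 1: "\<Phi> f x t = 0" if t: "t \<in> {0..\<kappa>}" for t
  proof -
    have "\<Phi> f x t = integral {0..t} (\<lambda>_. 0)"
      unfolding \<Phi>_def by (rule Henstock_Kurzweil_Integration.integral_cong) (use t K0 in auto)
    then show ?thesis by simp
  qed
  let ?h = "\<lambda>\<tau>. K (\<lambda>y. g y \<tau> + exp ((1 - p) * \<tau>) * (W y (\<tau> + \<kappa>) * g y \<tau> powr p)) x"
  show "\<Phi> f x (t + \<kappa>) = exp \<kappa> * integral {0..t} ?h" if t: "t \<ge> 0"
  proof -
    have "\<Phi> f x (t + \<kappa>) = integral {\<kappa>..t + \<kappa>} (\<lambda>\<tau>. K (\<lambda>y. Nl f y \<tau>) x)"
      using Phi_split[OF f \<kappa>, of "t + \<kappa>" x] 1[of \<kappa>] t \<kappa> by simp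
    also have "\<dots> = integral {0..t} (\<lambda>\<tau>. K (\<lambda>y. Nl f y (\<tau> + \<kappa>)) x)"
      using integral_shift_real_ivl[of \<kappa> \<kappa> "t + \<kappa>" "\<lambda>\<tau>. K (\<lambda>y. Nl f y \<tau>) x"] by simp
    also have "\<dots> = integral {0..t} (\<lambda>\<tau>. exp \<kappa> * ?h \<tau>)"
    proof (rule Henstock_Kurzweil_Integration.integral_cong)
      fix \<tau> assume "\<tau> \<in> {0..t}"
      then have \<tau>: "\<tau> \<ge> 0" by simp
      have "Nl f y (\<tau> + \<kappa>) = exp \<kappa> * (g y \<tau> + exp ((1 - p) * \<tau>) * (W y (\<tau> + \<kappa>) * g y \<tau> powr p))" for y
      proof -
        have "(exp \<kappa> * g y \<tau>) powr p = exp (\<kappa> * p) * g y \<tau> powr p"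
          using g[OF \<tau>, of y] by (subst powr_mult) (auto simp: exp_powr_real)
        moreover have "exp ((1 - p) * (\<tau> + \<kappa>)) * exp (\<kappa> * p) = exp \<kappa> * exp ((1 - p) * \<tau>)"
          by (simp add: algebra_simps flip: exp_add)
        moreover have "Nl f y (\<tau> + \<kappa>) = exp \<kappa> * g y \<tau>
            + exp ((1 - p) * (\<tau> + \<kappa>)) * (W y (\<tau> + \<kappa>) * (exp \<kappa> * g y \<tau>) powr p)"
          unfolding Nl_def fg[OF \<tau>] ..
        moreover have "A * (w * (B * h)) = (A * B) * (w * h)" for A w B h :: real by (simp add: mult_ac)
        ultimately have "Nl f y (\<tau> + \<kappa>) = exp \<kappa> * g y \<tau>
            + (exp \<kappa> * exp ((1 - p) * \<tau>)) * (W y (\<tau> + \<kappa>) * g y \<tau> powr p)" by simp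
        then show ?thesis by (simp only: distrib_left mult.assoc)
      qed
      then show "K (\<lambda>y. Nl f y (\<tau> + \<kappa>)) x = exp \<kappa> * ?h \<tau>"
        unfolding K_def by (subst integral_mult_right_zero[symmetric]) (simp add: mult_ac)
    qed
    finally show ?thesis by simp
  qed
qed

end

lemma adm_shift_back:
  fixes f :: "'a::euclidean_space \<Rightarrow> real \<Rightarrow> real"
  assumes f: "adm a f" and \<kappa>: "\<kappa> \<ge> 0" and g: "\<And>x t. t \<ge> 0 \<Longrightarrow> g x t = exp (- \<kappa>) * f x (t + \<kappa>)"
  shows "adm a g"
  unfolding adm_def
proof (intro conjI allI impI)
  have "continuous_on (UNIV \<times> {0..}) ((\<lambda>(x, t). f x t) \<circ> (\<lambda>z. (fst z, snd z + \<kappa>)))"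
    using \<kappa> by (intro continuous_on_compose continuous_on_subset[OF adm_continuous[OF f]] continuous_intros) auto
  then have "continuous_on (UNIV \<times> {0..}) (\<lambda>z. exp (- \<kappa>) * f (fst z) (snd z + \<kappa>))"
    by (intro continuous_intros) (simp add: o_def)
  then show "continuous_on (UNIV \<times> {0..}) (\<lambda>(x, t). g x t)"
    by (rule continuous_on_eq) (auto simp: g)
  show "0 \<le> g x t" if "t \<ge> 0" for x t using adm_nonneg[OF f] that \<kappa> by (simp add: g)
  fix T
  obtain C where C: "\<And>x t. t \<in> {0..T + \<kappa>} \<Longrightarrow> f x t \<le> C * (1 + norm x) powr a" using adm_bound[OF f] by blast
  show "\<exists>C. \<forall>x. \<forall>t\<in>{0..T}. g x t \<le> C * (1 + norm x) powr a"
  proof (intro exI[of _ "exp (- \<kappa>) * C"] allI ballI)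
    fix x :: 'a and t assume "t \<in> {0..T}"
    then show "g x t \<le> exp (- \<kappa>) * C * (1 + norm x) powr a"
      using C[of "t + \<kappa>" x] \<kappa> by (simp add: g)
  qed
qed

lemma adm_shift_forward:
  fixes g :: "'a::euclidean_space \<Rightarrow> real \<Rightarrow> real"
  assumes g: "adm a g" and \<kappa>: "\<kappa> \<ge> 0" and f: "\<And>x t. t \<ge> 0 \<Longrightarrow> f x t = exp \<kappa> * g x (max (t - \<kappa>) 0)"
  shows "adm a f"
  unfolding adm_def
proof (intro conjI allI impI)
  have "continuous_on (UNIV \<times> {0..}) ((\<lambda>(x, t). g x t) \<circ> (\<lambda>z. (fst z, max (snd z - \<kappa>) 0)))"
    by (intro continuous_on_compose continuous_on_subset[OF adm_continuous[OF g]] continuous_intros) auto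
  then have "continuous_on (UNIV \<times> {0..}) (\<lambda>z. exp \<kappa> * g (fst z) (max (snd z - \<kappa>) 0))"
    by (intro continuous_intros) (simp add: o_def)
  then show "continuous_on (UNIV \<times> {0..}) (\<lambda>(x, t). f x t)"
    by (rule continuous_on_eq) (auto simp: f)
  show "0 \<le> f x t" if "t \<ge> 0" for x t using adm_nonneg[OF g] that by (simp add: f)
  fix T
  obtain C where C: "\<And>x t. t \<in> {0..max T 0} \<Longrightarrow> g x t \<le> C * (1 + norm x) powr a" using adm_bound[OF g] by blast
  show "\<exists>C. \<forall>x. \<forall>t\<in>{0..T}. f x t \<le> C * (1 + norm x) powr a"
  proof (intro exI[of _ "exp \<kappa> * C"] allI ballI)
    fix x :: 'a and t assume "t \<in> {0..T}"
    then show "f x t \<le> exp \<kappa> * C * (1 + norm x) powr a"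
      using C[of "max (t - \<kappa>) 0" x] \<kappa> by (simp add: f)
  qed
qed

locale bessel_problem = pseudoparabolic bessel e0 b0 c0 W \<Lambda> \<sigma> \<theta>lo \<theta>up \<epsilon> p a
  for e0 b0 c0 and W :: "real^'n \<Rightarrow> real \<Rightarrow> real" and \<Lambda> \<sigma> \<theta>lo \<theta>up \<epsilon> p a
begin

lemma Bop_eq_K: "\<psi> \<in> borel_measurable borel \<Longrightarrow> Bop \<psi> x = K \<psi> x"
  unfolding K_def by (rule Bop_eq)

text \<open>Borel measurable time slices allow replacing \<open>Bop\<close> by \<open>K\<close>, and
  continuity in time identifies the Lebesgue integrals with gauge integrals.\<close>

lemma integral_equation_eq_Phi:
  assumes f: "adm a f"
  shows "(LINT \<tau>:{0..t}|lborel. Bop (\<lambda>y. f y \<tau>) x)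
     + (LINT \<tau>:{0..t}|lborel. exp ((1 - p) * \<tau>) * Bop (\<lambda>y. W y \<tau> * f y \<tau> powr p) x) = \<Phi> f x t"
proof -
  have 1: "Bop (\<lambda>y. f y \<tau>) x = K (\<lambda>y. f y \<tau>) x" if "\<tau> \<ge> 0" for \<tau>
    by (rule Bop_eq_K[OF adm_measurable[OF f that]])
  have 2: "exp ((1 - p) * \<tau>) * Bop (\<lambda>y. W y \<tau> * f y \<tau> powr p) x = K (\<lambda>y. react f y \<tau>) x" if \<tau>: "\<tau> \<ge> 0" for \<tau>
  proof -
    have "(\<lambda>y. exp (- ((1 - p) * \<tau>)) * react f y \<tau>) \<in> borel_measurable borel"
      by (intro borel_measurable_times borel_measurable_const adm_measurable[OF adm_react[OF f] \<tau>])
    moreover have "exp (- ((1 - p) * \<tau>)) * react f y \<tau> = W y \<tau> * f y \<tau> powr p" for y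
      unfolding react_def mult.assoc[symmetric] exp_add[symmetric] by simp
    ultimately have "Bop (\<lambda>y. W y \<tau> * f y \<tau> powr p) x = K (\<lambda>y. W y \<tau> * f y \<tau> powr p) x" by (intro Bop_eq_K) simp
    then show ?thesis
      unfolding K_def react_def by (simp only: mult.left_commute[of "bessel _"] integral_mult_right_zero)
  qed
  have "(LINT \<tau>:{0..t}|lborel. Bop (\<lambda>y. f y \<tau>) x) = (LINT \<tau>:{0..t}|lborel. K (\<lambda>y. f y \<tau>) x)"
    by (rule set_lebesgue_integral_cong) (use 1 in auto)
  also have "\<dots> = integral {0..t} (\<lambda>\<tau>. K (\<lambda>y. f y \<tau>) x)"
    by (rule LINT_Icc_eq_integral[OF adm_continuous_time[OF adm_K[OF f a_nonneg]]])
  finally have I1: "(LINT \<tau>:{0..t}|lborel. Bop (\<lambda>y. f y \<tau>) x) = integral {0..t} (\<lambda>\<tau>. K (\<lambda>y. f y \<tau>) x)" .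
  have "(LINT \<tau>:{0..t}|lborel. exp ((1 - p) * \<tau>) * Bop (\<lambda>y. W y \<tau> * f y \<tau> powr p) x)
      = (LINT \<tau>:{0..t}|lborel. K (\<lambda>y. react f y \<tau>) x)"
    by (rule set_lebesgue_integral_cong) (use 2 in auto)
  also have "\<dots> = integral {0..t} (\<lambda>\<tau>. K (\<lambda>y. react f y \<tau>) x)"
    by (rule LINT_Icc_eq_integral[OF adm_continuous_time[OF adm_K[OF adm_react[OF f] a_nonneg]]])
  finally have I2: "(LINT \<tau>:{0..t}|lborel. exp ((1 - p) * \<tau>) * Bop (\<lambda>y. W y \<tau> * f y \<tau> powr p) x)
      = integral {0..t} (\<lambda>\<tau>. K (\<lambda>y. react f y \<tau>) x)" .
  have "integral {0..t} (\<lambda>\<tau>. K (\<lambda>y. f y \<tau>) x) + integral {0..t} (\<lambda>\<tau>. K (\<lambda>y. react f y \<tau>) x)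
      = integral {0..t} (\<lambda>\<tau>. K (\<lambda>y. f y \<tau>) x + K (\<lambda>y. react f y \<tau>) x)"
    by (intro Henstock_Kurzweil_Integration.integral_add[symmetric] adm_integrable_time[OF adm_K[OF f a_nonneg]]
        adm_integrable_time[OF adm_K[OF adm_react[OF f] a_nonneg]]) auto
  also have "\<dots> = \<Phi> f x t"
    unfolding \<Phi>_def by (rule Henstock_Kurzweil_Integration.integral_cong) (simp add: K_Nl[OF f])
  finally show ?thesis unfolding I1 I2 .
qed

text \<open>The bridge between the definition and the operator. In the backward direction norm
  continuity is recovered because a fixed point is a time integral of an admissible
  function.\<close>

lemma s_solution_iff:
  "s_solution W p a u \<longleftrightarrow> adm a (\<lambda>x t. exp t * u x t) \<and>
     (\<forall>x t. t \<ge> 0 \<longrightarrow> exp t * u x t = \<Phi> (\<lambda>x t. exp t * u x t) x t)" (is "_ \<longleftrightarrow> adm a ?\<mu> \<and> ?F")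
proof
  assume s: "s_solution W p a u"
  then have Z: "Zinf a ?\<mu>" and u0: "\<And>x t. t \<ge> 0 \<Longrightarrow> 0 \<le> u x t"
    by (auto simp: s_solution_def Let_def)
  have adm: "adm a ?\<mu>" by (rule Zinf_imp_adm[OF Z a_nonneg]) (simp add: u0)
  with s show "adm a ?\<mu> \<and> ?F"
    using integral_equation_eq_Phi[OF adm] by (auto simp: s_solution_def Let_def)
next
  assume A: "adm a ?\<mu> \<and> ?F"
  then have adm: "adm a ?\<mu>" and F: ?F by auto
  have "0 \<le> u x t" if "t \<ge> 0" for x t using adm_nonneg[OF adm that, of x] by (simp add: zero_le_mult_iff)
  moreover have "Zinf a ?\<mu>"
    by (rule time_integral_imp_Zinf[OF adm_K_Nl[OF adm] a_nonneg]) (use F in \<open>simp add: \<Phi>_def\<close>)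
  ultimately show "s_solution W p a u"
    using F integral_equation_eq_Phi[OF adm] by (simp add: s_solution_def Let_def)
qed

end

section \<open>Classification of the s-solutions\<close>

text \<open>With n the dimension, the rate 1/(n+1) is admissible because n/(n+1)^2 < 1. The other
  two constants are those of \<open>bessel_lower_bound\<close>.\<close>

lemma bessel_conv_kernel:
  "conv_kernel (bessel :: 'a::euclidean_space \<Rightarrow> real) (1 / (DIM('a) + 1)) (DIM('a) + 2)
     (exp (- 2) * (1 / (8 * pi)) ^ DIM('a))"
proof
  show "integral\<^sup>L lborel (bessel :: 'a \<Rightarrow> real) = 1" by (rule bessel_integral)
  have "real DIM('a) * (1 / (DIM('a) + 1))\<^sup>2 < 1"
    by (simp add: power2_eq_square divide_simps) (simp add: algebra_simps add_pos_nonneg)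
  then show "integrable lborel (\<lambda>y::'a. bessel y * exp (1 / real (DIM('a) + 1) * norm y))"
    using bessel_exp_moment[where ?'a = 'a, of "1 / real (DIM('a) + 1)"] by simp
  show "AE y in lborel. exp (- 2) * (1 / (8 * pi)) ^ DIM('a) * exp (- (real (DIM('a) + 2) * norm y)) \<le> bessel (y::'a)"
    using bessel_lower_bound[where ?'a = 'a] by (simp add: add.commute)
qed (auto simp: bessel_nonneg)

text \<open>Extends the bounds on the potential from t > 0 to t = 0.\<close>

lemma nonneg_at_left_endpoint:
  fixes F :: "real \<Rightarrow> real"
  assumes cont: "continuous_on {0..} F" and pos: "\<And>t. t > 0 \<Longrightarrow> F t \<ge> 0" and t: "t \<ge> 0"
  shows "F t \<ge> 0"
proof (cases "t = 0")
  case True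
  have "(\<lambda>n. inverse (real (Suc n))) \<longlonglongrightarrow> 0" by (rule LIMSEQ_inverse_real_of_nat)
  then have "(F \<circ> (\<lambda>n. inverse (real (Suc n)))) \<longlonglongrightarrow> F 0"
    using cont unfolding continuous_on_sequentially by auto
  then show ?thesis using True pos by (intro LIMSEQ_le_const) (auto intro!: exI[of _ 0])
qed (use pos t in simp)

lemma set_integral_Bker_eq:
  fixes x :: "real^'n"
  shows "(LINT y:{y. norm (x - y) \<ge> 1}|lebesgue. Bker y * pw (norm (x - y)) r)
    = (\<integral>y. bessel y * (if norm (x - y) \<ge> 1 then pw (norm (x - y)) r else 0) \<partial>lborel)"
  unfolding set_lebesgue_integral_def
proof (rule lebesgue_integral_eq_lborel_integral_AE)
  have [measurable]: "(\<lambda>y. pw (norm (x - y)) r) \<in> borel_measurable borel"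
    unfolding pw_def by measurable
  show "(\<lambda>y. bessel y * (if norm (x - y) \<ge> 1 then pw (norm (x - y)) r else 0)) \<in> borel_measurable borel"
    by measurable
  show "AE y in lebesgue. indicat_real {y. 1 \<le> norm (x - y)} y *\<^sub>R (Bker y * pw (norm (x - y)) r)
      = bessel y * (if norm (x - y) \<ge> 1 then pw (norm (x - y)) r else 0)"
    using Bker_AE_eq_bessel by eventually_elim simp
qed

theorem mainTheorem7:
  fixes V :: "real^'n \<Rightarrow> real \<Rightarrow> real"
    and \<Lambda> \<alpha> :: "real \<Rightarrow> real"
    and \<sigma> \<theta>lo \<theta>up p \<epsilon>0 a :: real
    and u :: "real^'n \<Rightarrow> real \<Rightarrow> real"
  assumes sigma: "\<sigma> \<in> Jplus CARD('n)"
    and Lam_cont: "continuous_on {0..} \<Lambda>"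
    and Lam_pos: "\<forall>t\<ge>0. \<Lambda> t > 0"
    and theta: "\<theta>lo > 0" "\<theta>up > 0"
    and V_cont: "continuous_on (UNIV \<times> {0..}) (\<lambda>(x, t). V x t)"
    and V_nonneg: "\<forall>x. \<forall>t\<ge>0. V x t \<ge> 0"
    and V_lower: "\<forall>x t. norm x \<ge> 1 \<longrightarrow> t > 0 \<longrightarrow> V x t \<ge> \<theta>lo * \<Lambda> t * pw (norm x) \<sigma>"
    and V_upper: "\<forall>x t. t > 0 \<longrightarrow> V x t \<le> \<theta>up * \<Lambda> t * pw (norm x) \<sigma>"
    and eps0: "\<epsilon>0 > 0"
    and eps0_prop: "\<forall>x::real^'n. \<forall>d\<in>{0..\<sigma> * p / (1 - p)}.
        (LINT y:{y. norm (x - y) \<ge> 1}|lebesgue. Bker y * pw (norm (x - y)) (\<sigma> + d))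
          \<ge> \<epsilon>0 * pw (norm x) (\<sigma> + d)"
    and p: "0 < p" "p < 1" "p < \<epsilon>0 * \<theta>lo / \<theta>up"
    and a: "a \<ge> \<sigma> / (1 - p)"
    and alpha_cont: "continuous_on {0<..} \<alpha>"
    and alpha_pos: "\<forall>\<tau>>0. \<alpha> \<tau> > 0"
    and alpha_lim: "(\<alpha> \<longlongrightarrow> 1) (at_right 0)"
    and V_shift: "\<forall>x t \<tau>. t > 0 \<longrightarrow> \<tau> > 0 \<longrightarrow> V x (t + \<tau>) \<ge> \<alpha> \<tau> * V x t"
    and u_nonneg: "\<forall>x. \<forall>t\<ge>0. u x t \<ge> 0"
    and u_Z: "Zinf a u"
  shows "(s_solution V p a u \<and> (\<exists>x. \<exists>t\<ge>0. u x t \<noteq> 0)) \<longleftrightarrow>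
     (\<exists>\<kappa>\<ge>0. \<exists>w. max_s_solution (\<lambda>x t. V x (t + \<kappa>)) p a w \<and>
        (\<forall>x. \<forall>t\<ge>0. u x t = w x (max (t - \<kappa>) 0)))"
proof -
  have sigma0: "\<sigma> \<ge> 0" using sigma by (auto simp: Jplus_def split: if_splits)
  let ?e = "1 / real (DIM(real^'n) + 1)" and ?b = "real (DIM(real^'n) + 2)"
    and ?c = "exp (- 2) * (1 / (8 * pi)) ^ DIM(real^'n)"
  have V_time: "continuous_on {0..} (V x)" for x
  proof -
    have "continuous_on {0..} ((\<lambda>(x, t). V x t) \<circ> (\<lambda>t. (x, t)))"
      by (intro continuous_on_compose continuous_on_subset[OF V_cont] continuous_intros) auto
    then show ?thesis by (simp add: o_def)
  qed
  have lower: "V x t \<ge> \<theta>lo * \<Lambda> t * pw (norm x) \<sigma>" if "norm x \<ge> 1" "t \<ge> 0" for x t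
  proof -
    have "continuous_on {0..} (\<lambda>t. V x t - \<theta>lo * \<Lambda> t * pw (norm x) \<sigma>)" by (intro continuous_intros V_time Lam_cont)
    from nonneg_at_left_endpoint[OF this _ that(2)] show ?thesis using V_lower that by auto
  qed
  have upper: "V x t \<le> \<theta>up * \<Lambda> t * pw (norm x) \<sigma>" if "t \<ge> 0" for x t
  proof -
    have "continuous_on {0..} (\<lambda>t. \<theta>up * \<Lambda> t * pw (norm x) \<sigma> - V x t)" by (intro continuous_intros V_time Lam_cont)
    from nonneg_at_left_endpoint[OF this _ that] show ?thesis using V_upper by auto
  qed
  \<comment> \<open>Shifting time leaves \<open>\<theta>lo\<close>, \<open>\<theta>up\<close> and
    \<open>\<epsilon>0\<close> unchanged, so all results hold for every shifted potential; \<kappa>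
    = 0 is the original problem.\<close>
  have problem: "bessel_problem ?e ?b ?c (\<lambda>x t. V x (t + \<kappa>)) (\<lambda>t. \<Lambda> (t + \<kappa>)) \<sigma> \<theta>lo \<theta>up \<epsilon>0 p a"
    if \<kappa>: "\<kappa> \<ge> 0" for \<kappa>
  proof -
    interpret conv_kernel "bessel :: real^'n \<Rightarrow> real" ?e ?b ?c by (rule bessel_conv_kernel)
    show ?thesis
    proof
      have "continuous_on (UNIV \<times> {0..}) ((\<lambda>(x, t). V x t) \<circ> (\<lambda>z. (fst z, snd z + \<kappa>)))"
        using \<kappa> by (intro continuous_on_compose continuous_on_subset[OF V_cont] continuous_intros) auto
      then show "continuous_on (UNIV \<times> {0..}) (\<lambda>(x, t). V x (t + \<kappa>))" by (simp add: o_def case_prod_beta')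
      show "continuous_on {0..} (\<lambda>t. \<Lambda> (t + \<kappa>))"
        using \<kappa> by (intro continuous_on_compose2[OF Lam_cont] continuous_intros) auto
      show "p * \<theta>up < \<epsilon>0 * \<theta>lo" using p(3) theta by (simp add: less_divide_eq)
      show "\<epsilon>0 * pw (norm x) (\<sigma> + d)
          \<le> (\<integral>y. bessel y * (if 1 \<le> norm (x - y) then pw (norm (x - y)) (\<sigma> + d) else 0) \<partial>lborel)"
        if "d \<in> {0..\<sigma> * p / (1 - p)}" for d and x :: "real^'n"
        using bspec[OF spec[OF eps0_prop, of x] that] unfolding set_integral_Bker_eq .
    qed (use sigma0 Lam_pos theta V_nonneg lower upper eps0 p a \<kappa> in auto)
  qed
  have problem0: "bessel_problem ?e ?b ?c V \<Lambda> \<sigma> \<theta>lo \<theta>up \<epsilon>0 p a" using problem[of 0] by simp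
  interpret V0: bessel_problem ?e ?b ?c V \<Lambda> \<sigma> \<theta>lo \<theta>up \<epsilon>0 p a by (rule problem0)
  let ?f = "\<lambda>x t. exp t * u x t"
  show ?thesis
  proof
    assume L: "s_solution V p a u \<and> (\<exists>x. \<exists>t\<ge>0. u x t \<noteq> 0)"
    then have f: "adm a ?f" and ffix: "\<And>x t. t \<ge> 0 \<Longrightarrow> ?f x t = V0.\<Phi> ?f x t"
      by (auto simp: V0.s_solution_iff)
    \<comment> \<open>The times at which \<open>u\<close> is not identically zero; the infimum is
      the waiting time \<kappa>.\<close>
    define S where "S = {t. t \<ge> 0 \<and> (\<exists>x. u x t \<noteq> 0)}"
    define \<kappa> where "\<kappa> = Inf S"
    have S: "S \<noteq> {}" "bdd_below S" using L by (auto simp: S_def intro!: bdd_belowI[of _ 0])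
    have \<kappa>: "\<kappa> \<ge> 0" unfolding \<kappa>_def using S by (intro cInf_greatest) (auto simp: S_def)
    have before: "u x t = 0" if "t \<ge> 0" "t < \<kappa>" for x t
      using that cInf_lower[OF _ S(2), of t] by (force simp: S_def \<kappa>_def)
    \<comment> \<open>For \<kappa> > 0 by continuity along times increasing to \<kappa>, for
      \<kappa> = 0 because the fixed point equation integrates over a point.\<close>
    have at_\<kappa>: "?f x \<kappa> = 0" for x
    proof (cases "\<kappa> = 0")
      case True
      then show ?thesis using ffix[of 0 x] by (simp add: V0.\<Phi>_def)
    next
      case False
      have "(\<lambda>n. \<kappa> - \<kappa> * inverse (real (Suc n))) \<longlonglongrightarrow> \<kappa> - \<kappa> * 0"
        by (intro tendsto_intros LIMSEQ_inverse_real_of_nat)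
      moreover have in01: "0 \<le> \<kappa> - \<kappa> * inverse (real (Suc n))" "\<kappa> - \<kappa> * inverse (real (Suc n)) < \<kappa>" for n
        using \<kappa> False by (auto simp: field_simps)
      ultimately have "(?f x \<circ> (\<lambda>n. \<kappa> - \<kappa> * inverse (real (Suc n)))) \<longlonglongrightarrow> ?f x \<kappa>"
        using adm_continuous_time[OF f, of x] \<kappa> unfolding continuous_on_sequentially by simp
      moreover have "?f x \<circ> (\<lambda>n. \<kappa> - \<kappa> * inverse (real (Suc n))) = (\<lambda>_. 0)"
        using before[OF in01] by (auto simp: o_def)
      ultimately show ?thesis using LIMSEQ_unique tendsto_const by metis
    qed
    have zero: "?f x t = 0" if "t \<in> {0..\<kappa>}" for x t
      using that before[of t x] at_\<kappa>[of x] by (cases "t = \<kappa>") auto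
    define w where "w x t = u x (t + \<kappa>)" for x t
    let ?g = "\<lambda>x t. exp t * w x t"
    interpret Vk: bessel_problem ?e ?b ?c "\<lambda>x t. V x (t + \<kappa>)" "\<lambda>t. \<Lambda> (t + \<kappa>)" \<sigma> \<theta>lo \<theta>up \<epsilon>0 p a
      by (rule problem[OF \<kappa>])
    have g: "adm a ?g" by (rule adm_shift_back[OF f \<kappa>]) (simp add: w_def exp_add exp_minus field_simps)
    have fg: "?f x (t + \<kappa>) = exp \<kappa> * ?g x t" if "t \<ge> 0" for x t by (simp add: w_def exp_add)
    have gfix: "?g x t = Vk.\<Phi> ?g x t" if t: "t \<ge> 0" for x t
    proof -
      have "exp \<kappa> * ?g x t = ?f x (t + \<kappa>)" by (simp add: w_def exp_add)
      also have "\<dots> = V0.\<Phi> ?f x (t + \<kappa>)" using ffix t \<kappa> by simp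
      also have "\<dots> = exp \<kappa> * Vk.\<Phi> ?g x t"
        unfolding Vk.\<Phi>_def Vk.Nl_def
        by (rule V0.Phi_shift(2)[OF f \<kappa> zero fg adm_nonneg[OF g] t])
      finally show ?thesis by simp
    qed
    \<comment> \<open>By the definition of the infimum there are times arbitrarily close to \<kappa>
      with \<open>u\<close> nonzero, and they are strictly later since \<open>u\<close> still
      vanishes at \<kappa>. The shifted solution is thus immediately positive.\<close>
    have pos: "\<exists>x \<tau>. 0 < \<tau> \<and> \<tau> < t \<and> ?g x \<tau> > 0" if t: "t > 0" for t
    proof -
      have "\<kappa> < \<kappa> + t" using t by simp
      then obtain s where s: "s \<in> S" "s < \<kappa> + t" using cInf_less_iff[OF S, of "\<kappa> + t"] by (auto simp: \<kappa>_def)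
      then obtain x where x: "u x s \<noteq> 0" "s \<ge> 0" by (auto simp: S_def)
      have "s > \<kappa>" using zero[of s x] x by force
      moreover have "u x s > 0" using u_nonneg x by (simp add: less_le)
      ultimately show ?thesis using s by (intro exI[of _ x] exI[of _ "s - \<kappa>"]) (auto simp: w_def)
    qed
    have low: "Vk.\<phi> x t \<le> ?g x t" if "t \<ge> 0" for x t
      by (rule Vk.fixed_point_lower_bound[OF g gfix pos that])
    have "max_s_solution (\<lambda>x t. V x (t + \<kappa>)) p a w"
      unfolding max_s_solution_def
    proof (intro conjI allI impI)
      show "s_solution (\<lambda>x t. V x (t + \<kappa>)) p a w" unfolding Vk.s_solution_iff using g gfix by blast
      fix v x t assume v: "s_solution (\<lambda>x t. V x (t + \<kappa>)) p a v" and t: "0 \<le> (t::real)"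
      then have v': "adm a (\<lambda>x t. exp t * v x t)" "\<And>x t. t \<ge> 0 \<Longrightarrow> exp t * v x t = Vk.\<Phi> (\<lambda>x t. exp t * v x t) x t"
        by (auto simp: Vk.s_solution_iff)
      \<comment> \<open>Any competitor is a fixed point of the same operator, so comparison gives
        maximality.\<close>
      have "exp t * v x t \<le> ?g x t" by (rule Vk.fixed_point_comparison[OF g gfix low v' t])
      then show "v x t \<le> w x t" by simp
    qed
    moreover have "u x t = w x (max (t - \<kappa>) 0)" if "t \<ge> 0" for x t
      using zero[of t x] zero[of \<kappa> x] \<kappa> that by (cases "t \<le> \<kappa>") (auto simp: w_def max_def)
    ultimately show "\<exists>\<kappa>\<ge>0. \<exists>w. max_s_solution (\<lambda>x t. V x (t + \<kappa>)) p a w \<and>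
        (\<forall>x. \<forall>t\<ge>0. u x t = w x (max (t - \<kappa>) 0))" using \<kappa> by blast
  next
    assume "\<exists>\<kappa>\<ge>0. \<exists>w. max_s_solution (\<lambda>x t. V x (t + \<kappa>)) p a w \<and> (\<forall>x. \<forall>t\<ge>0. u x t = w x (max (t - \<kappa>) 0))"
    then obtain \<kappa> w where \<kappa>: "\<kappa> \<ge> 0" and w: "max_s_solution (\<lambda>x t. V x (t + \<kappa>)) p a w"
      and uw: "\<And>x t. t \<ge> 0 \<Longrightarrow> u x t = w x (max (t - \<kappa>) 0)" by blast
    let ?g = "\<lambda>x t. exp t * w x t"
    interpret Vk: bessel_problem ?e ?b ?c "\<lambda>x t. V x (t + \<kappa>)" "\<lambda>t. \<Lambda> (t + \<kappa>)" \<sigma> \<theta>lo \<theta>up \<epsilon>0 p a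
      by (rule problem[OF \<kappa>])
    have g: "adm a ?g" and gfix: "\<And>x t. t \<ge> 0 \<Longrightarrow> ?g x t = Vk.\<Phi> ?g x t"
      using w by (auto simp: max_s_solution_def Vk.s_solution_iff)
    \<comment> \<open>Makes the extension consistent: for t \<le> \<kappa> the value
      \<open>w x (max (t - \<kappa>) 0)\<close> is 0.\<close>
    have g0: "w x 0 = 0" for x using gfix[of 0 x] by (simp add: Vk.\<Phi>_def)
    have f_eq: "?f x t = exp \<kappa> * ?g x (max (t - \<kappa>) 0)" if "t \<ge> 0" for x t
      using that by (simp add: uw g0 max_def flip: exp_add)
    have f: "adm a ?f" by (rule adm_shift_forward[OF g \<kappa> f_eq])
    have zero: "?f x t = 0" if "t \<in> {0..\<kappa>}" for x t using that f_eq[of t x] g0[of x] by simp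
    have fg: "?f x (t + \<kappa>) = exp \<kappa> * ?g x t" if "t \<ge> 0" for x t using that f_eq[of "t + \<kappa>" x] \<kappa> by simp
    have ffix: "?f x t = V0.\<Phi> ?f x t" if t: "t \<ge> 0" for x t
    proof (cases "t \<le> \<kappa>")
      case True
      then show ?thesis using V0.Phi_shift(1)[OF f \<kappa> zero fg adm_nonneg[OF g], of t x] zero[of t x] t by simp
    next
      case False
      then have t': "t - \<kappa> \<ge> 0" by simp
      have "V0.\<Phi> ?f x (t - \<kappa> + \<kappa>) = exp \<kappa> * Vk.\<Phi> ?g x (t - \<kappa>)"
        unfolding Vk.\<Phi>_def Vk.Nl_def by (rule V0.Phi_shift(2)[OF f \<kappa> zero fg adm_nonneg[OF g] t'])
      also have "\<dots> = ?f x (t - \<kappa> + \<kappa>)" using gfix[OF t', of x] fg[OF t', of x] by simp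
      finally show ?thesis by simp
    qed
    have "s_solution V p a u" unfolding V0.s_solution_iff using f ffix by blast
    moreover have "\<exists>x. \<exists>t\<ge>0. u x t \<noteq> 0"
    proof -
      \<comment> \<open>Maximality puts \<open>w\<close> above the constructed fixed point and hence
        above a positive multiple of the barrier, which is positive at |x| = 1, t = 1.\<close>
      obtain h where h: "adm a h" "\<And>x t. t \<ge> 0 \<Longrightarrow> h x t = Vk.\<Phi> h x t" "\<And>x t. t \<ge> 0 \<Longrightarrow> Vk.\<phi> x t \<le> h x t"
        using Vk.exists_fixed_point by blast
      have "s_solution (\<lambda>x t. V x (t + \<kappa>)) p a (\<lambda>x t. exp (- t) * h x t)"
        unfolding Vk.s_solution_iff using h(1,2) by (simp add: mult.assoc[symmetric] flip: exp_add)
      then have hw: "exp (- 1) * h x 1 \<le> w x 1" for x using w unfolding max_s_solution_def by force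
      obtain x :: "real^'n" where x: "norm x = 1" using vector_choose_size[of 1] by auto
      have "(1 - p) * \<epsilon>0 * \<theta>lo * Vk.L 1 * pw (norm x) \<sigma> > 0"
        using p eps0 theta Vk.L_pos[of 1] by (simp add: x pw_def)
      then have "Vk.\<phi> x 1 > 0" unfolding Vk.\<phi>_def powr_gt_zero by linarith
      then have "exp (- 1) * h x 1 > 0" using h(3)[of 1 x] by simp
      then have "w x 1 > 0" using hw[of x] by linarith
      then show ?thesis using uw[of "1 + \<kappa>" x] \<kappa> by (intro exI[of _ x] exI[of _ "1 + \<kappa>"]) auto
    qed
    ultimately show "s_solution V p a u \<and> (\<exists>x. \<exists>t\<ge>0. u x t \<noteq> 0)" by blast
  qed
qed

end
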